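(* Let $\{X_i\}$ be a discrete, stationary and ergodic source. For any distortion $D$, any $n$, and feed-forward with delay $s=1$, the rate $$R_n(D)=\frac1n\min_{p(\hat x^n|x^n):\ \mathbb E[d(X^n,\hat X^n)]\le D} I(\hat X^n\to X^n)$$ is an achievable rate, i.e. the pair $(R_n(D),D)$ is achievable for source coding with feed-forward.
   Context: Notation: $\mathcal X$ (source alphabet) and $\hat{\mathcal X}$ (reconstruction alphabet) are finite; $x^n=(x_1,\dots,x_n)$, $x_a^b=(x_a,\dots,x_b)$; logarithms are base 2; $p(x^n)$ is the law of $X^n$. Directed information: for a joint law $p(x^n)p(\hat x^n|x^n)$, $I(\hat X^n\to X^n)=\sum_{i=1}^n I(\hat X^i;X_i|X^{i-1})$. Distortion: a normalized, bounded distortion measure $d:\mathcal X^n\times\hat{\mathcal X}^n\to\mathbb R^+$ on pairs of sequences, assumed to be of the form $d(x^n,\hat x^n)=\frac1n\sum_{i=1}^n d(x_{i-m}^i,\hat x_i)$ for some $m$. In the definition of $R_n(D)$ the minimum is over all conditional pmfs $p(\hat x^n|x^n)$ satisfying the distortion constraint; $D$ is such that $R_n(D)<\infty$. Code: a source code with feed-forward (delay 1) of block length $N$ and rate $R$ consists of an encoder $f:\mathcal X^N\to\{1,\dots,2^{NR}\}$ and decoder maps $g_i:\{1,\dots,2^{NR}\}\times\mathcal X^{i-1}\to\hat{\mathcal X}$, $i=1,\dots,N$; the reconstruction is $\hat X_i=g_i(f(X^N),X^{i-1})$. Achievability: $(R,D)$ is achievable if there is a sequence of such codes of rate $R$ and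 block lengths $N\to\infty$ with $\lim_{N\to\infty}\mathbb E[d(X^N,\hat X^N)]\le D$. An equivalent version of the assertion: for any $D$ with $R_n(D)<\infty$, any $\delta>0$ and any $L$ sufficiently large, there is a code of block length $L$ with at most $2^{L(R_n(D)+\delta)}$ messages and $\mathbb E[d(X^L,\hat X^L)]\le D+\delta$. *)

theory Defs
  imports "HOL-Probability.Probability"
begin

section \<open>Stationary and ergodic sources\<close>

text \<open>
  A source is a two-sided process \<open>X :: int \<Rightarrow> 'w \<Rightarrow> 'a\<close> over a finite alphabet. Block codes and
  test channels only see the letters at times \<open>1, 2, \<dots>\<close>; the letters at times \<open>\<le> 0\<close> are needed
  because the distortion at time \<open>i\<close> looks at the source letters \<open>i - m, \<dots>, i\<close>.
\<close>

definition seq_space :: "(int \<Rightarrow> 'a) measure" where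
  "seq_space = Pi\<^sub>M UNIV (\<lambda>_. count_space UNIV)"

definition shift :: "(int \<Rightarrow> 'a) \<Rightarrow> int \<Rightarrow> 'a" where
  "shift x = (\<lambda>i. x (i + 1))"

definition process_law :: "'w measure \<Rightarrow> (int \<Rightarrow> 'w \<Rightarrow> 'a) \<Rightarrow> (int \<Rightarrow> 'a) measure" where
  "process_law M X = distr M seq_space (\<lambda>\<omega> i. X i \<omega>)"

definition discrete_source :: "'w measure \<Rightarrow> (int \<Rightarrow> 'w \<Rightarrow> 'a::finite) \<Rightarrow> bool" where
  "discrete_source M X \<longleftrightarrow> prob_space M \<and> (\<forall>i. X i \<in> M \<rightarrow>\<^sub>M count_space UNIV)"

definition stationary :: "'w measure \<Rightarrow> (int \<Rightarrow> 'w \<Rightarrow> 'a) \<Rightarrow> bool" where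
  "stationary M X \<longleftrightarrow> distr (process_law M X) seq_space shift = process_law M X"

definition ergodic :: "'w measure \<Rightarrow> (int \<Rightarrow> 'w \<Rightarrow> 'a) \<Rightarrow> bool" where
  "ergodic M X \<longleftrightarrow>
    (\<forall>A \<in> sets seq_space. shift -` A = A \<longrightarrow> measure (process_law M X) A \<in> {0, 1})"

text \<open>\<open>window x a b\<close> is the block \<open>x\<^sub>a, \<dots>, x\<^sub>b\<close>, empty if \<open>b < a\<close>.\<close>

definition window :: "(int \<Rightarrow> 'a) \<Rightarrow> int \<Rightarrow> int \<Rightarrow> 'a list" where
  "window x a b = map x [a..b]"

definition source_block :: "(int \<Rightarrow> 'w \<Rightarrow> 'a) \<Rightarrow> nat \<Rightarrow> 'w \<Rightarrow> 'a list" where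
  "source_block X n \<omega> = window (\<lambda>i. X i \<omega>) 1 (int n)"

definition block_law :: "'w measure \<Rightarrow> (int \<Rightarrow> 'w \<Rightarrow> 'a) \<Rightarrow> nat \<Rightarrow> 'a list pmf" where
  "block_law M X n = embed_pmf (\<lambda>x. measure M {\<omega> \<in> space M. source_block X n \<omega> = x})"

lemma measurable_source_block:
  fixes X :: "int \<Rightarrow> 'w \<Rightarrow> 'a::finite"
  assumes "discrete_source M X"
  shows "source_block X n \<in> M \<rightarrow>\<^sub>M count_space UNIV"
proof -
  have X: "X i \<in> M \<rightarrow>\<^sub>M count_space UNIV" for i
    using assms by (simp add: discrete_source_def)
  have "(\<lambda>\<omega>. map (\<lambda>i. X i \<omega>) xs) \<in> M \<rightarrow>\<^sub>M count_space UNIV" for xs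
  proof (induction xs)
    case (Cons a xs)
    have "(\<lambda>\<omega>. (X a \<omega>, map (\<lambda>i. X i \<omega>) xs)) \<in> M \<rightarrow>\<^sub>M count_space UNIV \<Otimes>\<^sub>M count_space UNIV"
      by (intro measurable_Pair X Cons)
    then have "(\<lambda>\<omega>. (X a \<omega>, map (\<lambda>i. X i \<omega>) xs)) \<in> M \<rightarrow>\<^sub>M count_space UNIV"
      by (simp add: pair_measure_countable)
    from measurable_compose[OF this, of "\<lambda>p. fst p # snd p" "count_space UNIV"]
    show ?case by simp
  qed simp
  then show ?thesis
    unfolding source_block_def window_def by simp
qed

lemma pmf_block_law:
  fixes X :: "int \<Rightarrow> 'w \<Rightarrow> 'a::finite"
  assumes "discrete_source M X"
  shows "pmf (block_law M X n) x = measure M {\<omega> \<in> space M. source_block X n \<omega> = x}"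
  unfolding block_law_def
proof (rule pmf_embed_pmf)
  interpret prob_space M
    using assms by (simp add: discrete_source_def)
  let ?B = "source_block X n"
  let ?N = "distr M (count_space UNIV) ?B"
  note B[measurable] = measurable_source_block[OF assms, of n]
  have "(\<integral>\<^sup>+ x. ennreal (measure M {\<omega> \<in> space M. ?B \<omega> = x}) \<partial>count_space UNIV)
      = (\<integral>\<^sup>+ x. emeasure ?N {x} \<partial>count_space UNIV)"
    by (intro nn_integral_cong)
       (auto simp: emeasure_distr emeasure_eq_measure vimage_def Int_def conj_commute)
  also have "\<dots> = emeasure ?N UNIV"
    by (rule emeasure_countable_singleton[symmetric]) auto
  also have "\<dots> = 1"
    by (simp add: emeasure_distr emeasure_space_1)
  finally show "(\<integral>\<^sup>+ x. ennreal (measure M {\<omega> \<in> space M. ?B \<omega> = x}) \<partial>count_space UNIV) = 1" .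
qed simp

section \<open>Distortion\<close>

text \<open>
  \<open>\<rho>\<close> is the per-letter distortion \<open>d(x\<^sub>i\<^sub>-\<^sub>m, \<dots>, x\<^sub>i; y\<^sub>i)\<close>. Reconstructions are lists, so the letter
  at time \<open>i\<close> is \<open>y ! (i - 1)\<close>.
\<close>

definition distortion ::
    "('a list \<Rightarrow> 'b \<Rightarrow> real) \<Rightarrow> nat \<Rightarrow> nat \<Rightarrow> (int \<Rightarrow> 'a) \<Rightarrow> 'b list \<Rightarrow> real" where
  "distortion \<rho> m n x y =
    (1 / real n) * (\<Sum>i = 1..n. \<rho> (window x (int i - int m) (int i)) (y ! (i - 1)))"

section \<open>Directed information and the feed-forward rate function\<close>

text \<open>\<open>\<Sum>i = 1..n. I(Y\<^sup>i; X\<^sub>i | X\<^sup>i\<^sup>-\<^sup>1)\<close> in bits, for \<open>(X\<^sup>n, Y\<^sup>n)\<close> distributed according to \<open>J\<close>.\<close>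

definition directed_information :: "nat \<Rightarrow> ('a list \<times> 'b list) pmf \<Rightarrow> real" where
  "directed_information n J =
    (\<Sum>i = 1..n.
      let Yi = (\<lambda>(x, y). take i y); Xi = (\<lambda>(x, y). x ! (i - 1)); Xpast = (\<lambda>(x, y). take (i - 1) x)
      in prob_space.conditional_mutual_information (measure_pmf J) 2
          (count_space (range Yi)) (count_space (range Xi)) (count_space (range Xpast)) Yi Xi Xpast)"

text \<open>Conditional pmfs \<open>p(y\<^sup>n | x\<^sup>n)\<close>; the values of \<open>W\<close> on lists of other lengths are irrelevant.\<close>

definition test_channel :: "nat \<Rightarrow> ('a list \<Rightarrow> 'b list pmf) \<Rightarrow> bool" where
  "test_channel n W \<longleftrightarrow> (\<forall>x. length x = n \<longrightarrow> (\<forall>y \<in> set_pmf (W x). length y = n))"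

definition joint_law :: "'a list pmf \<Rightarrow> ('a list \<Rightarrow> 'b list pmf) \<Rightarrow> ('a list \<times> 'b list) pmf" where
  "joint_law P W = bind_pmf P (\<lambda>x. map_pmf (Pair x) (W x))"

text \<open>
  \<open>E[d(X\<^sup>n, Y\<^sup>n)]\<close> when \<open>Y\<^sup>n\<close> is drawn from \<open>W\<close> given \<open>X\<^sup>n\<close>, i.e. given \<open>X\<^sup>n\<close> it is independent of
  the source letters before time \<open>1\<close>.
\<close>

definition channel_distortion :: "'w measure \<Rightarrow> (int \<Rightarrow> 'w \<Rightarrow> 'a) \<Rightarrow> ('a list \<Rightarrow> 'b \<Rightarrow> real) \<Rightarrow>
    nat \<Rightarrow> nat \<Rightarrow> ('a list \<Rightarrow> 'b list pmf) \<Rightarrow> real" where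
  "channel_distortion M X \<rho> m n W =
    (\<integral>\<omega>. measure_pmf.expectation (W (source_block X n \<omega>))
            (\<lambda>y. distortion \<rho> m n (\<lambda>i. X i \<omega>) y) \<partial>M)"

text \<open>Extended-real valued: \<open>R\<^sub>n(D) = \<infinity>\<close> if no test channel meets the distortion constraint.\<close>

definition feedforward_rate :: "'w measure \<Rightarrow> (int \<Rightarrow> 'w \<Rightarrow> 'a) \<Rightarrow> ('a list \<Rightarrow> 'b \<Rightarrow> real) \<Rightarrow>
    nat \<Rightarrow> nat \<Rightarrow> real \<Rightarrow> ereal" where
  "feedforward_rate M X \<rho> m n D =
    (INF W \<in> {W. test_channel n W \<and> channel_distortion M X \<rho> m n W \<le> D}.
      ereal (1 / real n * directed_information n (joint_law (block_law M X n) W)))"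

section \<open>Codes with feed-forward of delay 1\<close>

text \<open>The message set is \<open>{1, \<dots>, \<lfloor>2\<^sup>N\<^sup>R\<rfloor>}\<close>.\<close>

definition code_encoder :: "nat \<Rightarrow> real \<Rightarrow> ('a list \<Rightarrow> nat) \<Rightarrow> bool" where
  "code_encoder N R f \<longleftrightarrow>
    (\<forall>x. length x = N \<longrightarrow> 1 \<le> f x \<and> real (f x) \<le> 2 powr (real N * R))"

text \<open>The letter at time \<open>i\<close> is \<open>g\<^sub>i(f(x\<^sup>N), x\<^sup>i\<^sup>-\<^sup>1)\<close>.\<close>

definition reconstruction ::
    "nat \<Rightarrow> ('a list \<Rightarrow> nat) \<Rightarrow> (nat \<Rightarrow> nat \<Rightarrow> 'a list \<Rightarrow> 'b) \<Rightarrow> 'a list \<Rightarrow> 'b list" where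
  "reconstruction N f g x = map (\<lambda>i. g i (f x) (take (i - 1) x)) [1..<N + 1]"

definition code_distortion :: "'w measure \<Rightarrow> (int \<Rightarrow> 'w \<Rightarrow> 'a) \<Rightarrow> ('a list \<Rightarrow> 'b \<Rightarrow> real) \<Rightarrow>
    nat \<Rightarrow> nat \<Rightarrow> ('a list \<Rightarrow> nat) \<Rightarrow> (nat \<Rightarrow> nat \<Rightarrow> 'a list \<Rightarrow> 'b) \<Rightarrow> real" where
  "code_distortion M X \<rho> m N f g =
    (\<integral>\<omega>. distortion \<rho> m N (\<lambda>i. X i \<omega>) (reconstruction N f g (source_block X N \<omega>)) \<partial>M)"

definition achievable :: "'w measure \<Rightarrow> (int \<Rightarrow> 'w \<Rightarrow> 'a) \<Rightarrow> ('a list \<Rightarrow> 'b \<Rightarrow> real) \<Rightarrow>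
    nat \<Rightarrow> real \<Rightarrow> real \<Rightarrow> bool" where
  "achievable M X \<rho> m R D \<longleftrightarrow>
    (\<exists>N f g l. filterlim N at_top sequentially \<and>
      (\<forall>k. code_encoder (N k) R (f k)) \<and>
      (\<lambda>k. code_distortion M X \<rho> m (N k) (f k) (g k)) \<longlonglongrightarrow> l \<and> l \<le> D)"

end

theory Submission
  imports Defs
begin

text \<open>
  Fix a test channel \<open>W\<close> with distortion at most \<open>D\<close> and directed information close to \<open>n R\<^sub>n(D)\<close>, and
  let \<open>q\<close> be the causal channel \<open>\<Prod> p(y\<^sub>i | x\<^sup>i\<^sup>-\<^sup>1, y\<^sup>i\<^sup>-\<^sup>1)\<close> read off from the joint law. By the chain rule the
  directed information is the mean of \<open>log\<^sub>2 (W / q)\<close>. Letters drawn from \<open>q\<close> are produced by random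
  strategies which look at the past of the block only, so feed-forward lets the decoder follow them,
  and a change of measure from \<open>W\<close> to \<open>q\<close> shows that about \<open>2\<close> to the power \<open>I\<close> strategies per block
  suffice to find one which behaves as if it came from \<open>W\<close>.

  The source need not be ergodic under the \<open>n\<close>-fold shift. One letter is therefore dropped between
  superblocks so that all phases modulo \<open>n\<close> are visited equally often. If the rate is positive, a small
  excess of messages is absorbed by lengthening the block with uncoded letters; if it is zero, \<open>W\<close> is
  close to \<open>q\<close> in total variation, and a single strategy is good enough.
\<close>

section \<open>Ergodic averages\<close>

text \<open>Given the source word, the outputs of the test channel in different blocks are
  independent, so Hoeffding's inequality controls their fluctuations. Ergodicity enters only through
  averages of two functions of the source, the conditional means of the log-likelihood ratio and of
  the distortion. No limit of the averages along a single phase modulo \<open>n\<close> is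
  identified: it is enough that averages over adjacent stretches of the same phase come together in
  mean, since the average over all phases then has the same limit as the ordinary ergodic average.

  Achievability asks for the rate \<open>R_n(D)\<close> exactly, without slack. Covering
  \<open>P\<close> blocks takes about \<open>P (I + 2 epsilon)\<close> bits, and raising the length
  until \<open>N R\<close> exceeds this adds a fraction of letters proportional to
  \<open>1 / R\<close>; hence rate zero is a case of its own. The first \<open>m\<close> letters
  stay uncoded as well, because the distortion of a block looks \<open>m\<close> letters back and
  the encoder sees only times from 1 on.\<close>

locale measure_preserving_system = prob_space M for M :: "'x measure" +
  fixes T :: "'x \<Rightarrow> 'x"
  assumes measurable_T [measurable]: "T \<in> M \<rightarrow>\<^sub>M M"
    and distr_T: "distr M M T = M"
begin

lemma measurable_T_pow [measurable]: "T ^^ k \<in> M \<rightarrow>\<^sub>M M"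
  by (induction k) (auto intro: measurable_comp)

lemma distr_T_pow: "distr M M (T ^^ k) = M"
proof (induction k)
  case 0
  then show ?case by (simp add: id_def)
next
  case (Suc k)
  have "distr M M (T ^^ Suc k) = distr (distr M M (T ^^ k)) M T"
    by (simp add: distr_distr)
  then show ?case by (simp only: Suc distr_T)
qed

lemma integral_T_pow:
  fixes f :: "'x \<Rightarrow> real"
  assumes "f \<in> borel_measurable M"
  shows "(\<integral>x. f ((T ^^ k) x) \<partial>M) = (\<integral>x. f x \<partial>M)"
  using integral_distr[of "T ^^ k" M M f] assms by (simp add: distr_T_pow)

definition birkhoff_sum :: "('x \<Rightarrow> real) \<Rightarrow> nat \<Rightarrow> 'x \<Rightarrow> real" where
  "birkhoff_sum f N x = (\<Sum>k<N. f ((T ^^ k) x))"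

lemma birkhoff_sum_Suc: "birkhoff_sum f (Suc N) x = f x + birkhoff_sum f N (T x)"
  unfolding birkhoff_sum_def
  by (subst sum.lessThan_Suc_shift) (simp add: funpow_swap1)

lemma measurable_birkhoff_sum [measurable]:
  assumes [measurable]: "f \<in> borel_measurable M"
  shows "birkhoff_sum f N \<in> borel_measurable M"
  unfolding birkhoff_sum_def by measurable

text \<open>The empty sum takes part in the maximum, so the maximum is nonnegative, and it is
  positive exactly when some partial sum up to \<open>N\<close> is.\<close>

primrec birkhoff_max :: "('x \<Rightarrow> real) \<Rightarrow> nat \<Rightarrow> 'x \<Rightarrow> real" where
  "birkhoff_max f 0 x = 0"
| "birkhoff_max f (Suc N) x = max (birkhoff_max f N x) (birkhoff_sum f (Suc N) x)"

lemma birkhoff_max_nonneg: "0 \<le> birkhoff_max f N x"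
  by (induction N) auto

lemma birkhoff_sum_le_max: "k \<le> N \<Longrightarrow> birkhoff_sum f k x \<le> birkhoff_max f N x"
proof (induction N)
  case 0
  then show ?case by (simp add: birkhoff_sum_def)
next
  case (Suc N)
  then show ?case by (cases "k = Suc N") auto
qed

lemma birkhoff_max_cases: "\<exists>k\<le>N. birkhoff_max f N x = birkhoff_sum f k x"
proof (induction N)
  case 0
  then show ?case by (simp add: birkhoff_sum_def)
next
  case (Suc N)
  then obtain k where "k \<le> N" "birkhoff_max f N x = birkhoff_sum f k x" by blast
  then show ?case
    by (cases "birkhoff_max f N x \<le> birkhoff_sum f (Suc N) x")
       (auto simp: max_def intro: exI[of _ k] exI[of _ "Suc N"])
qed

text \<open>Garsia's observation: a positive maximum is attained by a nonempty sum, and splitting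
  off its first term leaves a partial sum along the orbit of \<open>T x\<close>.\<close>

lemma birkhoff_max_step:
  assumes "birkhoff_max f N x > 0"
  shows "birkhoff_max f N x \<le> f x + birkhoff_max f N (T x)"
proof -
  obtain k where k: "k \<le> N" "birkhoff_max f N x = birkhoff_sum f k x"
    using birkhoff_max_cases by blast
  with assms obtain j where j: "k = Suc j" by (cases k) (auto simp: birkhoff_sum_def)
  have "birkhoff_sum f j (T x) \<le> birkhoff_max f N (T x)"
    using k(1) j by (intro birkhoff_sum_le_max) simp
  then show ?thesis using k(2) j by (simp add: birkhoff_sum_Suc)
qed

lemma measurable_birkhoff_max [measurable]:
  assumes [measurable]: "f \<in> borel_measurable M"
  shows "birkhoff_max f N \<in> borel_measurable M"
proof (induction N)
  case (Suc N)
  note [measurable] = Suc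
  show ?case by simp
qed simp

lemma bounded_integrable:
  fixes f :: "'x \<Rightarrow> real"
  assumes "f \<in> borel_measurable M" and "\<And>x. \<bar>f x\<bar> \<le> B"
  shows "integrable M f"
  using assms by (intro integrable_const_bound[where B = B]) auto

lemma abs_birkhoff_sum_le:
  assumes "\<And>x. \<bar>f x\<bar> \<le> B"
  shows "\<bar>birkhoff_sum f N x\<bar> \<le> real N * B"
proof -
  have "\<bar>birkhoff_sum f N x\<bar> \<le> (\<Sum>k<N. B)"
    unfolding birkhoff_sum_def by (intro order.trans[OF sum_abs] sum_mono assms)
  then show ?thesis by simp
qed

text \<open>Let \<open>F\<close> be the maximum. Then \<open>F - F o T\<close> has integral zero by
  invariance. It is at most \<open>f\<close> where \<open>F > 0\<close>, and at most 0 elsewhere,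
  because there \<open>F\<close> vanishes while \<open>F o T\<close> is nonnegative.\<close>

lemma maximal_ergodic_finite:
  assumes [measurable]: "f \<in> borel_measurable M" and B: "\<And>x. \<bar>f x\<bar> \<le> B"
  shows "0 \<le> (\<integral>x. f x * indicator {x. birkhoff_max f N x > 0} x \<partial>M)"
proof -
  let ?F = "birkhoff_max f N"
  have "B \<ge> 0" using B[of undefined] by simp
  have F: "\<bar>?F x\<bar> \<le> real N * B" for x
  proof -
    obtain k where k: "k \<le> N" "?F x = birkhoff_sum f k x"
      using birkhoff_max_cases by blast
    have "\<bar>?F x\<bar> \<le> real k * B" unfolding k(2) by (rule abs_birkhoff_sum_le[OF B])
    also have "\<dots> \<le> real N * B" using k(1) \<open>B \<ge> 0\<close> by (intro mult_right_mono) auto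
    finally show ?thesis .
  qed
  have iF: "integrable M ?F" using F by (intro bounded_integrable) auto
  have iFT: "integrable M (\<lambda>x. ?F (T x))" using F by (intro bounded_integrable) auto
  have "(\<integral>x. ?F (T x) \<partial>M) = (\<integral>x. ?F x \<partial>M)"
    using integral_T_pow[of ?F 1] by simp
  then have "0 = (\<integral>x. ?F x - ?F (T x) \<partial>M)"
    using iF iFT by simp
  also have "\<dots> \<le> (\<integral>x. f x * indicator {x. birkhoff_max f N x > 0} x \<partial>M)"
  proof (rule integral_mono)
    show "integrable M (\<lambda>x. f x * indicator {x. birkhoff_max f N x > 0} x)"
    proof (rule bounded_integrable)
      show "(\<lambda>x. f x * indicator {x. birkhoff_max f N x > 0} x) \<in> borel_measurable M"
        unfolding indicator_def by measurable
      show "\<bar>f x * indicator {x. birkhoff_max f N x > 0} x\<bar> \<le> B" for x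
        using B[of x] \<open>B \<ge> 0\<close> by (auto simp: indicator_def)
    qed
    show "?F x - ?F (T x) \<le> f x * indicator {x. birkhoff_max f N x > 0} x" for x
      using birkhoff_max_step[of f N x] birkhoff_max_nonneg[of f N x]
        birkhoff_max_nonneg[of f N "T x"]
      by (cases "?F x > 0") auto
  qed (use iF iFT in auto)
  finally show ?thesis .
qed

text \<open>The sets on which the maximum is positive grow with \<open>N\<close> to almost the whole
  space, so the finite version passes to the limit by dominated convergence.\<close>

lemma maximal_ergodic:
  assumes [measurable]: "f \<in> borel_measurable M" and B: "\<And>x. \<bar>f x\<bar> \<le> B"
    and pos: "AE x in M. \<exists>N. birkhoff_sum f N x > 0"
  shows "0 \<le> (\<integral>x. f x \<partial>M)"
proof -
  let ?g = "\<lambda>N x. f x * indicator {x. birkhoff_max f N x > 0} x"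
  have "B \<ge> 0" using B[of undefined] by simp
  have "(\<lambda>N. \<integral>x. ?g N x \<partial>M) \<longlonglongrightarrow> (\<integral>x. f x \<partial>M)"
  proof (rule integral_dominated_convergence[where w = "\<lambda>_. B"])
    show "?g N \<in> borel_measurable M" for N
      unfolding indicator_def by measurable
    show "AE x in M. (\<lambda>N. ?g N x) \<longlonglongrightarrow> f x"
      using pos
    proof eventually_elim
      case (elim x)
      then obtain N where N: "birkhoff_sum f N x > 0" by blast
      have "?g N' x = f x" if "N' \<ge> N" for N'
        using N birkhoff_sum_le_max[OF that, of f x] by (auto simp: indicator_def)
      then show ?case
        by (intro tendsto_eventually) (auto simp: eventually_sequentially)
    qed
    show "AE x in M. norm (?g N x) \<le> B" for N
      using B \<open>B \<ge> 0\<close> by (auto simp: indicator_def)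
  qed auto
  then show ?thesis
    by (rule LIMSEQ_le_const) (use maximal_ergodic_finite[OF assms(1) B] in blast)
qed

end

section \<open>Birkhoff averages in an ergodic system\<close>

locale ergodic_system = measure_preserving_system +
  assumes invariant_trivial: "A \<in> sets M \<Longrightarrow> T -` A \<inter> space M = A \<Longrightarrow> prob A \<in> {0, 1}"
begin

text \<open>Unboundedness of the partial sums is an invariant event, since going from
  \<open>x\<close> to \<open>T x\<close> changes them by one bounded term. If it had probability 1,
  the maximal inequality would make the mean nonnegative.\<close>

lemma birkhoff_sum_bounded_above:
  assumes [measurable]: "f \<in> borel_measurable M" and B: "\<And>x. \<bar>f x\<bar> \<le> B"
    and neg: "(\<integral>x. f x \<partial>M) < 0"
  shows "AE x in M. \<exists>C. \<forall>N. birkhoff_sum f N x \<le> C"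
proof -
  define A where "A = {x \<in> space M. \<forall>i::nat. \<exists>N. birkhoff_sum f N x > real i}"
  have A [measurable]: "A \<in> sets M" unfolding A_def by measurable
  have unb: "(\<forall>i::nat. \<exists>N. birkhoff_sum f N (T x) > real i) \<longleftrightarrow>
      (\<forall>i::nat. \<exists>N. birkhoff_sum f N x > real i)" for x
  proof safe
    fix i :: nat
    assume *: "\<forall>i::nat. \<exists>N. birkhoff_sum f N (T x) > real i"
    \<comment> \<open>The surplus \<open>nat \<lceil>B\<rceil>\<close> pays for the term
      \<open>f x\<close> by which the two sums differ.\<close>
    obtain N where "birkhoff_sum f N (T x) > real (i + nat \<lceil>B\<rceil>)" using * by blast
    moreover have "real (nat \<lceil>B\<rceil>) \<ge> B" by linarith
    ultimately have "birkhoff_sum f (Suc N) x > real i"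
      using abs_le_D2[OF B[of x]] by (simp add: birkhoff_sum_Suc)
    then show "\<exists>N. birkhoff_sum f N x > real i" by blast
  next
    fix i :: nat
    assume *: "\<forall>i::nat. \<exists>N. birkhoff_sum f N x > real i"
    obtain N where N: "birkhoff_sum f N x > real (i + nat \<lceil>B\<rceil>)" using * by blast
    have c: "real (nat \<lceil>B\<rceil>) \<ge> B" by linarith
    show "\<exists>N. birkhoff_sum f N (T x) > real i"
    proof (cases N)
      case 0
      then show ?thesis using N by (simp add: birkhoff_sum_def)
    next
      case (Suc N')
      then show ?thesis using N c abs_le_D1[OF B[of x]]
        by (intro exI[of _ N']) (simp add: birkhoff_sum_Suc)
    qed
  qed
  have "T -` A \<inter> space M = A"
    using unb measurable_space[OF measurable_T] by (auto simp: A_def)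
  then have "prob A \<in> {0, 1}" by (rule invariant_trivial[OF A])
  moreover have "prob A \<noteq> 1"
  proof
    assume "prob A = 1"
    then have "AE x in M. x \<in> A" by (simp add: AE_in_set_eq_1)
    then have "AE x in M. \<exists>N. birkhoff_sum f N x > 0"
    proof eventually_elim
      case (elim x)
      then have "\<forall>i::nat. \<exists>N. birkhoff_sum f N x > real i" unfolding A_def by blast
      then obtain N where "birkhoff_sum f N x > real 0" by blast
      then show ?case by (intro exI[of _ N]) simp
    qed
    from maximal_ergodic[OF assms(1) B this] neg show False by simp
  qed
  ultimately have "prob A = 0" by simp
  then have "AE x in M. x \<notin> A"
    by (intro AE_not_in null_setsI A) (simp add: emeasure_eq_measure)
  then show ?thesis
    using AE_space
  proof eventually_elim
    case (elim x)
    then obtain i :: nat where "\<not> (\<exists>N. birkhoff_sum f N x > real i)" by (auto simp: A_def)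
    then show ?case by (intro exI[of _ "real i"]) (auto simp: not_less)
  qed
qed

text \<open>The centred function \<open>?f\<close> has mean \<open>- e / 2\<close>, so its partial
  sums stay below some \<open>C\<close>; the other half of \<open>e\<close> beats
  \<open>C / N\<close> for large \<open>N\<close>.\<close>

lemma birkhoff_upper:
  assumes [measurable]: "f \<in> borel_measurable M" and B: "\<And>x. \<bar>f x\<bar> \<le> B" and "e > 0"
  shows "AE x in M. eventually (\<lambda>N. birkhoff_sum f N x / N < (\<integral>x. f x \<partial>M) + e) sequentially"
proof -
  let ?E = "\<integral>x. f x \<partial>M"
  let ?f = "\<lambda>x. f x - ?E - e / 2"
  have i: "integrable M f" using B by (intro bounded_integrable) auto
  have "AE x in M. \<exists>C. \<forall>N. birkhoff_sum ?f N x \<le> C"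
  proof (rule birkhoff_sum_bounded_above)
    show "\<bar>?f x\<bar> \<le> B + \<bar>?E\<bar> + e / 2" for x
      using B[of x] \<open>e > 0\<close> by linarith
    show "(\<integral>x. ?f x \<partial>M) < 0" using i \<open>e > 0\<close> by (simp add: prob_space)
  qed simp
  then show ?thesis
  proof eventually_elim
    case (elim x)
    then obtain C where C: "birkhoff_sum ?f N x \<le> C" for N by blast
    have eq: "birkhoff_sum ?f N x = birkhoff_sum f N x - real N * (?E + e / 2)" for N
      by (simp add: birkhoff_sum_def sum_subtractf algebra_simps)
    have "eventually (\<lambda>N. N > 0 \<and> real N > 2 * C / e) sequentially"
      by (intro eventually_conj eventually_gt_at_top filterlim_real_sequentially[THEN
          filterlim_at_top_dense[THEN iffD1], rule_format])
    then show ?case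
    proof eventually_elim
      case (elim N)
      then have "C < real N * e / 2" using \<open>e > 0\<close> by (simp add: field_simps)
      moreover have "real N * (?E + e / 2) = real N * (?E + e) - real N * e / 2"
        by (simp add: algebra_simps)
      ultimately have "birkhoff_sum f N x < real N * (?E + e)"
        using C[of N] eq[of N] by linarith
      then show ?case using elim by (simp add: field_simps)
    qed
  qed
qed

text \<open>The upper bound for \<open>f\<close> and for \<open>- f\<close> gives almost sure
  convergence, and boundedness of the averages turns it into convergence in mean.\<close>

lemma birkhoff_L1:
  assumes [measurable]: "f \<in> borel_measurable M" and B: "\<And>x. \<bar>f x\<bar> \<le> B"
  shows "(\<lambda>N. \<integral>x. \<bar>birkhoff_sum f N x / N - (\<integral>x. f x \<partial>M)\<bar> \<partial>M) \<longlonglongrightarrow> 0"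
proof -
  let ?E = "\<integral>x. f x \<partial>M"
  have "B \<ge> 0" using B[of undefined] by simp
  have neg: "birkhoff_sum (\<lambda>x. - f x) N x = - birkhoff_sum f N x" for N x
    by (simp add: birkhoff_sum_def sum_negf)
  have "AE x in M. \<forall>i::nat. eventually (\<lambda>N. birkhoff_sum f N x / N < ?E + 1 / Suc i) sequentially"
    unfolding AE_all_countable by (intro allI birkhoff_upper[OF assms]) auto
  moreover have "AE x in M. \<forall>i::nat. eventually (\<lambda>N. birkhoff_sum (\<lambda>x. - f x) N x / N
      < (\<integral>x. - f x \<partial>M) + 1 / Suc i) sequentially"
    unfolding AE_all_countable by (intro allI birkhoff_upper[where B = B]) (auto simp: B)
  ultimately have lim: "AE x in M. (\<lambda>N. birkhoff_sum f N x / N) \<longlonglongrightarrow> ?E"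
  proof eventually_elim
    case (elim x)
    show ?case
    proof (rule tendstoI)
      fix e :: real assume "e > 0"
      then obtain i :: nat where i: "1 / Suc i < e"
        using nat_approx_posE by blast
      show "eventually (\<lambda>N. dist (birkhoff_sum f N x / N) ?E < e) sequentially"
        using elim(1)[rule_format, of i] elim(2)[rule_format, of i]
        by eventually_elim (use i in \<open>auto simp: neg dist_real_def abs_less_iff\<close>)
    qed
  qed
  have "(\<lambda>N. \<integral>x. \<bar>birkhoff_sum f N x / N - ?E\<bar> \<partial>M) \<longlonglongrightarrow> (\<integral>x. 0 \<partial>M)"
  proof (rule integral_dominated_convergence[where w = "\<lambda>_. B + \<bar>?E\<bar>"])
    show "AE x in M. (\<lambda>N. \<bar>birkhoff_sum f N x / N - ?E\<bar>) \<longlonglongrightarrow> 0"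
      using lim by eventually_elim (simp add: LIM_zero tendsto_rabs_zero)
    have "\<bar>birkhoff_sum f N x / N - ?E\<bar> \<le> B + \<bar>?E\<bar>" for N x
    proof (cases "N = 0")
      case False
      have "\<bar>birkhoff_sum f N x / N\<bar> \<le> B"
        using abs_birkhoff_sum_le[of f B N x, OF B] False by (simp add: field_simps)
      then show ?thesis by linarith
    qed (use \<open>B \<ge> 0\<close> in \<open>auto simp: birkhoff_sum_def\<close>)
    then show "AE x in M. norm \<bar>birkhoff_sum f N x / N - ?E\<bar> \<le> B + \<bar>?E\<bar>" for N
      by simp
  qed auto
  then show ?thesis by simp
qed

end

section \<open>Averages over blocks of length \<open>n\<close>\<close>

lemma sum_lessThan_add:
  fixes f :: "nat \<Rightarrow> real"
  shows "(\<Sum>j<k + m. f j) = (\<Sum>j<k. f j) + (\<Sum>j<m. f (k + j))"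
  by (induction m) auto

lemma sum_lessThan_mult:
  fixes f :: "nat \<Rightarrow> real"
  shows "(\<Sum>p<n * k. f p) = (\<Sum>r<n. \<Sum>j<k. f (r * k + j))"
proof (induction n)
  case (Suc n)
  have "(\<Sum>p<Suc n * k. f p) = (\<Sum>p<n * k + k. f p)" by (simp add: add.commute)
  then show ?case by (simp add: sum_lessThan_add Suc)
qed simp

text \<open>Before block \<open>p\<close>, \<open>p div K\<close> letters have been skipped, so its
  start is congruent to \<open>p div K\<close> modulo \<open>n\<close>. For \<open>p < n * K\<close>
  each of the \<open>n\<close> residues therefore occurs exactly \<open>K\<close> times.\<close>

definition interleaved_pos :: "nat \<Rightarrow> nat \<Rightarrow> nat \<Rightarrow> nat" where
  "interleaved_pos n K p = n * p + p div K"

lemma abs_diff_triangle_ineq':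
  fixes a b c :: real
  shows "\<bar>a - c\<bar> \<le> \<bar>a - b\<bar> + \<bar>b - c\<bar>"
  by linarith

lemma abs_abs_diff_le:
  fixes a b :: real
  assumes "\<bar>a\<bar> \<le> B" and "\<bar>b\<bar> \<le> C"
  shows "\<bar>\<bar>a - b\<bar>\<bar> \<le> B + C"
  using assms by linarith

context measure_preserving_system
begin

definition spaced_avg :: "nat \<Rightarrow> ('x \<Rightarrow> real) \<Rightarrow> nat \<Rightarrow> 'x \<Rightarrow> real" where
  "spaced_avg n h K x = (\<Sum>j<K. h ((T ^^ (n * j)) x)) / real K"

lemma measurable_spaced_avg [measurable]:
  assumes [measurable]: "h \<in> borel_measurable M"
  shows "spaced_avg n h K \<in> borel_measurable M"
  unfolding spaced_avg_def by measurable

lemma abs_spaced_avg_le: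
  assumes "\<And>x. \<bar>h x\<bar> \<le> B"
  shows "\<bar>spaced_avg n h K x\<bar> \<le> B"
proof (cases "K = 0")
  case False
  have "\<bar>\<Sum>j<K. h ((T ^^ (n * j)) x)\<bar> \<le> (\<Sum>j<K. B)"
    by (intro order.trans[OF sum_abs] sum_mono assms)
  with False show ?thesis by (simp add: spaced_avg_def field_simps)
next
  case True
  then show ?thesis using assms[of x] by (simp add: spaced_avg_def)
qed

lemma spaced_avg_double:
  "spaced_avg n h (2 * K) x = (spaced_avg n h K x + spaced_avg n h K ((T ^^ (n * K)) x)) / 2"
proof -
  have "(\<Sum>j<2 * K. h ((T ^^ (n * j)) x)) =
      (\<Sum>j<K. h ((T ^^ (n * j)) x)) + (\<Sum>j<K. h ((T ^^ (n * j)) ((T ^^ (n * K)) x)))"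
    unfolding mult_2 sum_lessThan_add
    by (simp add: algebra_simps funpow_add[unfolded o_def fun_eq_iff, rule_format, symmetric])
  then show ?thesis by (cases "K = 0") (auto simp: spaced_avg_def field_simps)
qed

text \<open>
  The squared norms of the averages decrease along powers of two, and the parallelogram law turns
  their differences into the distance between the averages over two adjacent stretches of time.
\<close>

lemma adjacent_averages_L2:
  assumes [measurable]: "h \<in> borel_measurable M" and B: "\<And>x. \<bar>h x\<bar> \<le> B"
  shows "(\<integral>x. (spaced_avg n h K x - spaced_avg n h K ((T ^^ (n * K)) x))\<^sup>2 \<partial>M)
    = 4 * (\<integral>x. (spaced_avg n h K x)\<^sup>2 \<partial>M) - 4 * (\<integral>x. (spaced_avg n h (2 * K) x)\<^sup>2 \<partial>M)"
proof -
  let ?A = "spaced_avg n h K" and ?S = "T ^^ (n * K)"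
  have sq: "\<bar>(spaced_avg n h K' x)\<^sup>2\<bar> \<le> B\<^sup>2" for K' x
    using power_mono[OF abs_spaced_avg_le[of h B n K' x, OF B], of 2] by simp
  have i: "integrable M (\<lambda>x. (?A x)\<^sup>2)" "integrable M (\<lambda>x. (?A (?S x))\<^sup>2)"
    "integrable M (\<lambda>x. (spaced_avg n h (2 * K) x)\<^sup>2)"
    using sq by (auto intro!: bounded_integrable[where B = "B\<^sup>2"])
  have "(\<integral>x. (?A x - ?A (?S x))\<^sup>2 \<partial>M) =
      (\<integral>x. 2 * (?A x)\<^sup>2 + 2 * (?A (?S x))\<^sup>2 - 4 * (spaced_avg n h (2 * K) x)\<^sup>2 \<partial>M)"
    unfolding spaced_avg_double
    by (intro Bochner_Integration.integral_cong refl) (simp add: power2_eq_square field_simps)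
  also have "\<dots> = 2 * (\<integral>x. (?A x)\<^sup>2 \<partial>M) + 2 * (\<integral>x. (?A (?S x))\<^sup>2 \<partial>M)
      - 4 * (\<integral>x. (spaced_avg n h (2 * K) x)\<^sup>2 \<partial>M)"
    using i by simp
  also have "(\<integral>x. (?A (?S x))\<^sup>2 \<partial>M) = (\<integral>x. (?A x)\<^sup>2 \<partial>M)"
    by (rule integral_T_pow) measurable
  finally show ?thesis by simp
qed

text \<open>The identity for the squares does double duty: its left side is nonnegative, so the
  squared norms \<open>a k\<close> decrease, and being bounded below they converge, so their
  differences tend to zero. The limit itself is never computed.\<close>

lemma adjacent_averages_L1:
  assumes [measurable]: "h \<in> borel_measurable M" and B: "\<And>x. \<bar>h x\<bar> \<le> B"
  shows "(\<lambda>k. \<integral>x. \<bar>spaced_avg n h (2 ^ k) x - spaced_avg n h (2 ^ k) ((T ^^ (n * 2 ^ k)) x)\<bar> \<partial>M)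
    \<longlonglongrightarrow> 0"
proof -
  define D where "D k x = spaced_avg n h (2 ^ k) x - spaced_avg n h (2 ^ k) ((T ^^ (n * 2 ^ k)) x)"
    for k x
  define a where "a k = (\<integral>x. (spaced_avg n h (2 ^ k) x)\<^sup>2 \<partial>M)" for k :: nat
  have [measurable]: "D k \<in> borel_measurable M" for k unfolding D_def by measurable
  have D2: "(\<integral>x. (D k x)\<^sup>2 \<partial>M) = 4 * a k - 4 * a (Suc k)" for k
    using adjacent_averages_L2[OF assms, of n "2 ^ k"] by (simp add: D_def a_def)
  have "a (Suc k) \<le> a k" for k
  proof -
    have "0 \<le> (\<integral>x. (D k x)\<^sup>2 \<partial>M)" by simp
    then show ?thesis using D2[of k] by simp
  qed
  then have "decseq a" by (rule decseq_SucI)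
  moreover have "0 \<le> a k" for k by (simp add: a_def)
  ultimately obtain L where L: "a \<longlonglongrightarrow> L"
    using decseq_convergent by blast
  have "(\<lambda>k. 4 * a k - 4 * a (Suc k)) \<longlonglongrightarrow> 4 * L - 4 * L"
    using L by (intro tendsto_intros LIMSEQ_Suc)
  then have lim: "(\<lambda>k. sqrt (\<integral>x. (D k x)\<^sup>2 \<partial>M)) \<longlonglongrightarrow> sqrt 0"
    unfolding D2 by (intro tendsto_real_sqrt) simp
  have bD: "\<bar>D k x\<bar> \<le> 2 * B" for k x
    using abs_abs_diff_le[OF abs_spaced_avg_le[of h B, OF B] abs_spaced_avg_le[of h B, OF B]]
    by (simp add: D_def)
  \<comment> \<open>The mean is at most the root mean square, because the variance of
    \<open>\<bar>D k x\<bar>\<close> is nonnegative.\<close>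
  have le: "(\<integral>x. \<bar>D k x\<bar> \<partial>M) \<le> sqrt (\<integral>x. (D k x)\<^sup>2 \<partial>M)" for k
  proof (rule real_le_rsqrt)
    have sq: "\<bar>(D k x)\<^sup>2\<bar> \<le> (2 * B)\<^sup>2" for x using power_mono[OF bD[of k x], of 2] by simp
    have "integrable M (\<lambda>x. \<bar>D k x\<bar>)" using bD by (intro bounded_integrable[where B = "2 * B"]) auto
    moreover have "integrable M (\<lambda>x. (\<bar>D k x\<bar>)\<^sup>2)"
      using sq by (intro bounded_integrable[where B = "(2 * B)\<^sup>2"]) auto
    ultimately have "variance (\<lambda>x. \<bar>D k x\<bar>) = (\<integral>x. (\<bar>D k x\<bar>)\<^sup>2 \<partial>M) - (\<integral>x. \<bar>D k x\<bar> \<partial>M)\<^sup>2"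
      by (rule variance_eq)
    then show "(\<integral>x. \<bar>D k x\<bar> \<partial>M)\<^sup>2 \<le> (\<integral>x. (D k x)\<^sup>2 \<partial>M)"
      using variance_positive[of "\<lambda>x. \<bar>D k x\<bar>"] by simp
  qed
  have "(\<lambda>k. \<integral>x. \<bar>D k x\<bar> \<partial>M) \<longlonglongrightarrow> 0"
    by (rule tendsto_sandwich[OF _ _ tendsto_const lim[simplified]]) (use le in auto)
  then show ?thesis by (simp add: D_def)
qed

text \<open>Triangle inequality over \<open>r\<close> adjacent stretches; by invariance each of the
  \<open>r\<close> steps contributes the same integral.\<close>

lemma distant_averages_L1:
  assumes [measurable]: "h \<in> borel_measurable M" and B: "\<And>x. \<bar>h x\<bar> \<le> B"
  shows "(\<integral>x. \<bar>spaced_avg n h K ((T ^^ (r * (n * K))) x) - spaced_avg n h K x\<bar> \<partial>M)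
    \<le> real r * (\<integral>x. \<bar>spaced_avg n h K x - spaced_avg n h K ((T ^^ (n * K)) x)\<bar> \<partial>M)"
proof (induction r)
  case (Suc r)
  let ?A = "spaced_avg n h K" and ?S = "T ^^ (n * K)" and ?R = "T ^^ (r * (n * K))"
  have A: "\<bar>?A x\<bar> \<le> B" for x using abs_spaced_avg_le[of h B, OF B] .
  have b: "\<bar>\<bar>?A x - ?A y\<bar>\<bar> \<le> 2 * B" for x y using A[of x] A[of y] by linarith
  have i: "integrable M (\<lambda>x. \<bar>?A (?R x) - ?A x\<bar>)" "integrable M (\<lambda>x. \<bar>?A (?R x) - ?A (?S (?R x))\<bar>)"
    using b by (auto intro!: bounded_integrable[where B = "2 * B"] simp del: abs_abs)
  have S: "(T ^^ (Suc r * (n * K))) x = ?S (?R x)" for x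
    by (simp add: funpow_add)
  have "(\<integral>x. \<bar>?A ((T ^^ (Suc r * (n * K))) x) - ?A x\<bar> \<partial>M)
      \<le> (\<integral>x. \<bar>?A (?R x) - ?A x\<bar> + \<bar>?A (?R x) - ?A (?S (?R x))\<bar> \<partial>M)"
    unfolding S using i b
    by (intro integral_mono) (auto intro!: bounded_integrable[where B = "2 * B"] simp del: abs_abs)
  also have "\<dots> = (\<integral>x. \<bar>?A (?R x) - ?A x\<bar> \<partial>M) + (\<integral>x. \<bar>?A (?R x) - ?A (?S (?R x))\<bar> \<partial>M)"
    using i by simp
  also have "(\<integral>x. \<bar>?A (?R x) - ?A (?S (?R x))\<bar> \<partial>M) = (\<integral>x. \<bar>?A x - ?A (?S x)\<bar> \<partial>M)"
    by (rule integral_T_pow) measurable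
  finally show ?case using Suc by (simp add: algebra_simps)
qed simp

text \<open>Both sums are split by phase \<open>r < n\<close>. Phase \<open>r\<close> of the
  interleaved blocks occupies the stretch starting at \<open>r * (n * K) + r\<close>, and phase
  \<open>r\<close> of the ordinary average the one starting at \<open>r\<close>, so the two are
  \<open>r\<close> stretches apart. Each phase costs at most \<open>n\<close> adjacent distances,
  and so does their mean.\<close>

lemma interleaved_average_L1:
  assumes [measurable]: "h \<in> borel_measurable M" and B: "\<And>x. \<bar>h x\<bar> \<le> B"
    and "K > 0" "n > 0"
  shows "(\<integral>x. \<bar>(\<Sum>p<n * K. h ((T ^^ interleaved_pos n K p) x)) / real (n * K)
        - birkhoff_sum h (n * K) x / real (n * K)\<bar> \<partial>M)
    \<le> real n * (\<integral>x. \<bar>spaced_avg n h K x - spaced_avg n h K ((T ^^ (n * K)) x)\<bar> \<partial>M)"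
proof -
  let ?A = "spaced_avg n h K"
  let ?D = "\<integral>x. \<bar>?A x - ?A ((T ^^ (n * K)) x)\<bar> \<partial>M"
  define E where "E r x = ?A ((T ^^ (r * (n * K))) x) - ?A x" for r x
  have [measurable]: "E r \<in> borel_measurable M" for r unfolding E_def by measurable
  have A: "\<bar>?A x\<bar> \<le> B" for x using abs_spaced_avg_le[of h B, OF B] .
  have bE: "\<bar>\<bar>E r x\<bar>\<bar> \<le> 2 * B" for r x
    unfolding E_def using A[of x] A[of "(T ^^ (r * (n * K))) x"] by linarith
  have iE: "integrable M (\<lambda>x. \<bar>E r ((T ^^ r) x)\<bar>)" for r
    using bE by (intro bounded_integrable[where B = "2 * B"]) (auto simp del: abs_abs)
  have DE: "(\<integral>x. \<bar>E r ((T ^^ r) x)\<bar> \<partial>M) \<le> real r * ?D" for r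
  proof -
    have "(\<integral>x. \<bar>E r ((T ^^ r) x)\<bar> \<partial>M) = (\<integral>x. \<bar>E r x\<bar> \<partial>M)"
      by (rule integral_T_pow) measurable
    then show ?thesis using distant_averages_L1[OF assms(1) B, of n K r] by (simp add: E_def)
  qed
  have pos: "interleaved_pos n K (r * K + j) = n * j + (r * (n * K) + r)" if "j < K" for r j
    using that by (simp add: interleaved_pos_def algebra_simps)
  have s1: "(\<Sum>p<n * K. h ((T ^^ interleaved_pos n K p) x))
      = (\<Sum>r<n. real K * ?A ((T ^^ (r * (n * K))) ((T ^^ r) x)))" for x
    unfolding sum_lessThan_mult using \<open>K > 0\<close>
    by (simp add: spaced_avg_def pos funpow_add)
  \<comment> \<open>An index below \<open>K * n\<close> is written as \<open>j * n + r\<close>, and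
    the sums are swapped to collect equal residues.\<close>
  have s2: "birkhoff_sum h (n * K) x = (\<Sum>r<n. real K * ?A ((T ^^ r) x))" for x
  proof -
    have "birkhoff_sum h (n * K) x = (\<Sum>j<K. \<Sum>r<n. h ((T ^^ (j * n + r)) x))"
      unfolding birkhoff_sum_def mult.commute[of n K] sum_lessThan_mult ..
    also have "\<dots> = (\<Sum>r<n. \<Sum>j<K. h ((T ^^ (j * n + r)) x))" by (rule sum.swap)
    also have "\<dots> = (\<Sum>r<n. real K * ?A ((T ^^ r) x))"
      using \<open>K > 0\<close> by (simp add: spaced_avg_def funpow_add mult.commute)
    finally show ?thesis .
  qed
  have diff: "(\<Sum>p<n * K. h ((T ^^ interleaved_pos n K p) x)) / real (n * K)
      - birkhoff_sum h (n * K) x / real (n * K) = (\<Sum>r<n. E r ((T ^^ r) x)) / real n" for x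
    unfolding s1 s2 E_def using \<open>K > 0\<close> \<open>n > 0\<close>
    by (simp add: sum_subtractf sum_distrib_left[symmetric] diff_divide_distrib)
  have "(\<integral>x. \<bar>(\<Sum>r<n. E r ((T ^^ r) x)) / real n\<bar> \<partial>M)
      \<le> (\<integral>x. (\<Sum>r<n. \<bar>E r ((T ^^ r) x)\<bar>) / real n \<partial>M)"
  proof (rule integral_mono)
    show le: "\<bar>(\<Sum>r<n. E r ((T ^^ r) x)) / real n\<bar> \<le> (\<Sum>r<n. \<bar>E r ((T ^^ r) x)\<bar>) / real n" for x
      by (simp add: divide_right_mono)
    have *: "\<bar>\<bar>(\<Sum>r<n. E r ((T ^^ r) x)) / real n\<bar>\<bar> \<le> (\<Sum>r<n. 2 * B) / real n" for x
    proof -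
      have "(\<Sum>r<n. \<bar>E r ((T ^^ r) x)\<bar>) / real n \<le> (\<Sum>r<n. 2 * B) / real n"
        by (intro divide_right_mono sum_mono bE[simplified]) simp
      then show ?thesis using le[of x] by (simp only: abs_abs)
    qed
    show "integrable M (\<lambda>x. \<bar>(\<Sum>r<n. E r ((T ^^ r) x)) / real n\<bar>)"
      using * by (intro bounded_integrable) (auto simp del: abs_abs)
    show "integrable M (\<lambda>x. (\<Sum>r<n. \<bar>E r ((T ^^ r) x)\<bar>) / real n)"
      using iE by auto
  qed
  also have "\<dots> = (\<Sum>r<n. \<integral>x. \<bar>E r ((T ^^ r) x)\<bar> \<partial>M) / real n"
    using iE by simp
  also have "\<dots> \<le> (\<Sum>r<n. real n * ?D) / real n"
  proof (intro divide_right_mono sum_mono)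
    fix r assume "r \<in> {..<n}"
    then have "real r * ?D \<le> real n * ?D" by (intro mult_right_mono integral_nonneg) auto
    then show "(\<integral>x. \<bar>E r ((T ^^ r) x)\<bar> \<partial>M) \<le> real n * ?D" using DE[of r] by linarith
  qed simp
  also have "\<dots> = real n * ?D" using \<open>n > 0\<close> by simp
  finally show ?thesis unfolding diff .
qed

end

context ergodic_system
begin

text \<open>
  The power \<open>T ^^ n\<close> need not be ergodic, so the averages over disjoint blocks of length \<open>n\<close> may
  depend on the phase modulo \<open>n\<close>. Dropping one letter after every \<open>K\<close> blocks visits all phases.
\<close>

theorem interleaved_ergodic:
  assumes [measurable]: "h \<in> borel_measurable M" and B: "\<And>x. \<bar>h x\<bar> \<le> B" and "n > 0"
  shows "(\<lambda>k. \<integral>x. \<bar>(\<Sum>p<n * 2 ^ k. h ((T ^^ interleaved_pos n (2 ^ k) p) x)) / real (n * 2 ^ k)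
      - (\<integral>x. h x \<partial>M)\<bar> \<partial>M) \<longlonglongrightarrow> 0"
proof -
  let ?I = "\<lambda>k x. (\<Sum>p<n * 2 ^ k. h ((T ^^ interleaved_pos n (2 ^ k) p) x)) / real (n * 2 ^ k)"
  let ?B = "\<lambda>N x. birkhoff_sum h N x / real N"
  let ?E = "\<integral>x. h x \<partial>M"
  let ?D = "\<lambda>k. \<integral>x. \<bar>spaced_avg n h (2 ^ k) x - spaced_avg n h (2 ^ k) ((T ^^ (n * 2 ^ k)) x)\<bar> \<partial>M"
  have lim: "(\<lambda>k. real n * ?D k + (\<integral>x. \<bar>?B (n * 2 ^ k) x - ?E\<bar> \<partial>M)) \<longlonglongrightarrow> real n * 0 + 0"
  proof (intro tendsto_add tendsto_mult tendsto_const adjacent_averages_L1[OF assms(1) B])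
    have "filterlim (\<lambda>k. n * 2 ^ k) at_top sequentially"
      using \<open>n > 0\<close>
      by (intro filterlim_subseq) (auto simp: strict_mono_def)
    from filterlim_compose[OF birkhoff_L1[OF assms(1) B] this]
    show "(\<lambda>k. \<integral>x. \<bar>?B (n * 2 ^ k) x - ?E\<bar> \<partial>M) \<longlonglongrightarrow> 0" .
  qed
  have bB: "\<bar>?B N x\<bar> \<le> B" for N x
    using abs_birkhoff_sum_le[of h B N x, OF B] B[of x]
    by (cases "N = 0") (auto simp: field_simps)
  have bI: "\<bar>?I k x\<bar> \<le> B" for k x
  proof -
    have "\<bar>\<Sum>p<n * 2 ^ k. h ((T ^^ interleaved_pos n (2 ^ k) p) x)\<bar> \<le> (\<Sum>p<n * 2 ^ k. B)"
      by (intro order.trans[OF sum_abs] sum_mono B)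
    then show ?thesis using \<open>n > 0\<close> by (simp add: field_simps)
  qed
  have le: "(\<integral>x. \<bar>?I k x - ?E\<bar> \<partial>M) \<le> real n * ?D k + (\<integral>x. \<bar>?B (n * 2 ^ k) x - ?E\<bar> \<partial>M)" for k
  proof -
    have b1: "\<bar>\<bar>?I k x - ?B (n * 2 ^ k) x\<bar>\<bar> \<le> B + B" for x
      by (intro abs_abs_diff_le bI bB)
    have b2: "\<bar>\<bar>?B (n * 2 ^ k) x - ?E\<bar>\<bar> \<le> B + \<bar>?E\<bar>" for x
      by (intro abs_abs_diff_le bB order.refl)
    have b3: "\<bar>\<bar>?I k x - ?E\<bar>\<bar> \<le> B + \<bar>?E\<bar>" for x
      by (intro abs_abs_diff_le bI order.refl)
    have m [measurable]: "?I k \<in> borel_measurable M" "?B (n * 2 ^ k) \<in> borel_measurable M"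
      by measurable
    have i: "integrable M (\<lambda>x. \<bar>?I k x - ?B (n * 2 ^ k) x\<bar>)"
      "integrable M (\<lambda>x. \<bar>?B (n * 2 ^ k) x - ?E\<bar>)" "integrable M (\<lambda>x. \<bar>?I k x - ?E\<bar>)"
      by (rule bounded_integrable[OF _ b1] bounded_integrable[OF _ b2] bounded_integrable[OF _ b3],
          intro borel_measurable_abs borel_measurable_diff m borel_measurable_const)+
    have "(\<integral>x. \<bar>?I k x - ?E\<bar> \<partial>M)
        \<le> (\<integral>x. \<bar>?I k x - ?B (n * 2 ^ k) x\<bar> + \<bar>?B (n * 2 ^ k) x - ?E\<bar> \<partial>M)"
      by (intro integral_mono Bochner_Integration.integrable_add i abs_diff_triangle_ineq')
    also have "\<dots> = (\<integral>x. \<bar>?I k x - ?B (n * 2 ^ k) x\<bar> \<partial>M) + (\<integral>x. \<bar>?B (n * 2 ^ k) x - ?E\<bar> \<partial>M)"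
      by (intro Bochner_Integration.integral_add i)
    finally show ?thesis
      using interleaved_average_L1[OF assms(1) B, of "2 ^ k" n] \<open>n > 0\<close> by simp
  qed
  show ?thesis
    by (rule tendsto_sandwich[OF _ _ tendsto_const lim[simplified]]) (use le in auto)
qed

end

section \<open>Random strategies and directed information\<close>

text \<open>A Shannon strategy. One function on lists serves all times, since the length of the past
  tells the time; output \<open>i\<close>, counted from 0, sees only the first \<open>i\<close>
  inputs.\<close>

definition strategy_path :: "nat \<Rightarrow> ('a list \<Rightarrow> 'b) \<Rightarrow> 'a list \<Rightarrow> 'b list" where
  "strategy_path n \<phi> x = map (\<lambda>i. \<phi> (take i x)) [0..<n]"

lemma length_strategy_path [simp]: "length (strategy_path n \<phi> x) = n"
  by (simp add: strategy_path_def)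

lemma nth_strategy_path [simp]: "i < n \<Longrightarrow> strategy_path n \<phi> x ! i = \<phi> (take i x)"
  by (simp add: strategy_path_def)

lemma finite_lists_length: "finite {xs :: 'a::finite list. length xs = n}"
  using finite_lists_length_eq[of "UNIV :: 'a set" n] by simp

lemma finite_lists_length_less: "finite {xs :: 'a::finite list. length xs < n}"
proof -
  have "{xs :: 'a list. length xs < n} = (\<Union>k<n. {xs. length xs = k})" by auto
  then show ?thesis by (simp add: finite_lists_length)
qed

primrec adaptive_path :: "('a list \<times> 'b list \<Rightarrow> 'b) \<Rightarrow> 'a list \<Rightarrow> nat \<Rightarrow> 'b list" where
  "adaptive_path \<psi> x 0 = []"
| "adaptive_path \<psi> x (Suc i) = adaptive_path \<psi> x i @ [\<psi> (take i x, adaptive_path \<psi> x i)]"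

lemma length_adaptive_path [simp]: "length (adaptive_path \<psi> x i) = i"
  by (induction i) auto

lemma adaptive_path_take: "j \<le> i \<Longrightarrow> adaptive_path \<psi> (take i x) j = adaptive_path \<psi> x j"
  by (induction j) (auto simp: min_def)

text \<open>Turns the event that the path equals \<open>y\<close> into conditions on single values
  of \<open>\<psi>\<close>, that is, into a product event when these values are drawn
  independently.\<close>

lemma adaptive_path_eq_iff:
  assumes "length y = n"
  shows "adaptive_path \<psi> x n = y \<longleftrightarrow> (\<forall>i<n. \<psi> (take i x, take i y) = y ! i)"
  using assms
proof (induction n arbitrary: y)
  case (Suc n)
  obtain z b where y: "y = z @ [b]" using Suc.prems by (cases y rule: rev_cases) auto
  then have z: "length z = n" using Suc.prems by simp
  have "adaptive_path \<psi> x (Suc n) = y \<longleftrightarrow>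
      adaptive_path \<psi> x n = z \<and> \<psi> (take n x, z) = b"
    by (auto simp: y)
  also have "\<dots> \<longleftrightarrow> (\<forall>i<n. \<psi> (take i x, take i z) = z ! i) \<and> \<psi> (take n x, z) = b"
    by (simp add: Suc.IH[OF z])
  also have "\<dots> \<longleftrightarrow> (\<forall>i<Suc n. \<psi> (take i x, take i y) = y ! i)"
    using z by (auto simp: y less_Suc_eq nth_append)
  finally show ?case .
qed simp

text \<open>Past outputs are determined by \<open>\<psi>\<close> and the past inputs, so they can be
  recomputed: a rule that also looks at its own outputs is a strategy on inputs alone.\<close>

lemma strategy_path_adaptive:
  "strategy_path n (\<lambda>xs. \<psi> (xs, adaptive_path \<psi> xs (length xs))) x = adaptive_path \<psi> x n"
  if "length x = n"
proof -
  have "strategy_path m (\<lambda>xs. \<psi> (xs, adaptive_path \<psi> xs (length xs))) x = adaptive_path \<psi> x m"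
    if "m \<le> n" for m
    using that
  proof (induction m)
    case (Suc m)
    then show ?case using \<open>length x = n\<close>
      by (simp add: strategy_path_def min_def adaptive_path_take)
  qed (simp add: strategy_path_def)
  then show ?thesis by simp
qed

text \<open>Draw one letter from \<open>q xs ys\<close> for every pair of pasts, all independently.
  Along given \<open>x\<close> and \<open>y\<close> the pairs consulted have different lengths,
  hence are distinct coordinates, and the probability of following \<open>y\<close> is the product.
  How the paths for different \<open>x\<close> depend on each other does not matter.\<close>

lemma exists_random_strategy:
  fixes q :: "'a::finite list \<Rightarrow> 'b::finite list \<Rightarrow> 'b pmf"
  shows "\<exists>\<Phi>. finite (set_pmf \<Phi>) \<and> (\<forall>x y. length x = n \<longrightarrow> length y = n \<longrightarrow>
    pmf (map_pmf (\<lambda>\<phi>. strategy_path n \<phi> x) \<Phi>) y = (\<Prod>i<n. pmf (q (take i x) (take i y)) (y ! i)))"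
proof -
  define A :: "('a list \<times> 'b list) set" where "A = {xs. length xs < n} \<times> {ys. length ys < n}"
  have A: "finite A" unfolding A_def by (intro finite_cartesian_product finite_lists_length_less)
  define \<Psi> where "\<Psi> = Pi_pmf A undefined (\<lambda>(xs, ys). q xs ys)"
  let ?str = "\<lambda>\<psi> xs. \<psi> (xs, adaptive_path \<psi> xs (length xs))"
  have "finite (set_pmf \<Psi>)"
    unfolding \<Psi>_def by (rule finite_subset[OF set_Pi_pmf_subset'[OF A]]) (use A in auto)
  moreover have "pmf (map_pmf (\<lambda>\<phi>. strategy_path n \<phi> x) (map_pmf ?str \<Psi>)) y
      = (\<Prod>i<n. pmf (q (take i x) (take i y)) (y ! i))"
    if x: "length x = n" and y: "length y = n" for x y
  proof -
    define c where "c i = (take i x, take i y)" for i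
    have inj: "inj_on c {..<n}"
      using x by (auto simp: inj_on_def c_def dest!: arg_cong[of "take _ x" _ length])
    have cA: "c ` {..<n} \<subseteq> A" using x y by (auto simp: A_def c_def)
    \<comment> \<open>A coordinate on the trajectory is prescribed, its time being read off from the
      length of the past; all other coordinates are free.\<close>
    define B where "B p = (if p \<in> c ` {..<n} then {y ! length (fst p)} else UNIV)" for p
    have "pmf (map_pmf (\<lambda>\<phi>. strategy_path n \<phi> x) (map_pmf ?str \<Psi>)) y
        = measure_pmf.prob \<Psi> {\<psi>. adaptive_path \<psi> x n = y}"
      by (simp add: map_pmf_comp pmf_map strategy_path_adaptive x vimage_def)
    also have "{\<psi>. adaptive_path \<psi> x n = y} = Pi A B"
    proof -
      have "(\<forall>i<n. \<psi> (c i) = y ! i) \<longleftrightarrow> \<psi> \<in> Pi A B" for \<psi>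
        using cA x by (fastforce simp: B_def Pi_def c_def)
      then show ?thesis by (auto simp: adaptive_path_eq_iff[OF y] c_def)
    qed
    also have "measure_pmf.prob \<Psi> (Pi A B) = (\<Prod>p\<in>A. measure_pmf.prob (case p of (xs, ys) \<Rightarrow> q xs ys) (B p))"
      unfolding \<Psi>_def by (rule measure_Pi_pmf_Pi[OF A])
    also have "\<dots> = (\<Prod>p\<in>c ` {..<n}. measure_pmf.prob (case p of (xs, ys) \<Rightarrow> q xs ys) (B p))"
      by (rule prod.mono_neutral_right) (use A cA in \<open>auto simp: B_def\<close>)
    also have "\<dots> = (\<Prod>i<n. pmf (q (take i x) (take i y)) (y ! i))"
      unfolding prod.reindex[OF inj] o_def
      by (intro prod.cong refl) (use x in \<open>auto simp: B_def c_def measure_pmf_single\<close>)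
    finally show ?thesis .
  qed
  ultimately show ?thesis
    by (intro exI[of _ "map_pmf ?str \<Psi>"]) auto
qed

section \<open>Directed information as a divergence\<close>

text \<open>Written as an expectation over the common sample space, the terms for different times
  can be added under one expectation, where the chain rule is a pointwise telescoping sum.\<close>

lemma conditional_mutual_information_pmf:
  fixes J :: "'s pmf" and F :: "'s \<Rightarrow> 'f" and G :: "'s \<Rightarrow> 'g" and H :: "'s \<Rightarrow> 'h"
  assumes "finite (range F)" "finite (range G)" "finite (range H)"
  defines "p \<equiv> \<lambda>E. measure_pmf.prob J E"
  shows "prob_space.conditional_mutual_information (measure_pmf J) 2
      (count_space (range F)) (count_space (range G)) (count_space (range H)) F G H
    = measure_pmf.expectation J (\<lambda>s. log 2
        (p {t. F t = F s \<and> G t = G s \<and> H t = H s}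
         / (p {t. F t = F s \<and> H t = H s} * (p {t. G t = G s \<and> H t = H s} / p {t. H t = H s}))))"
proof -
  interpret information_space "measure_pmf J" 2
    by unfold_locales simp
  have sf: "simple_function (measure_pmf J) F" "simple_function (measure_pmf J) G"
    "simple_function (measure_pmf J) H"
    using assms by (auto simp: simple_function_def)
  note sd = measure_pmf.simple_distributedI[OF _ measure_nonneg refl, simplified]
  let ?FGH = "\<lambda>s. (F s, G s, H s)"
  let ?g = "\<lambda>(f, g, h). log 2 (p (?FGH -` {(f, g, h)})
    / (p ((\<lambda>s. (F s, H s)) -` {(f, h)}) * (p ((\<lambda>s. (G s, H s)) -` {(g, h)}) / p (H -` {h}))))"
  have fin: "finite (range ?FGH)"
    by (rule finite_subset[of _ "range F \<times> range G \<times> range H"]) (use assms in auto)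
  have "prob_space.conditional_mutual_information (measure_pmf J) 2 (count_space (range F)) (count_space (range G))
      (count_space (range H)) F G H
    = (\<Sum>(f, g, h)\<in>range ?FGH. p (?FGH -` {(f, g, h)}) * ?g (f, g, h))"
    using conditional_mutual_information_eq[OF sd[OF sf(3)]
        sd[OF simple_function_Pair[OF sf(2,3)]] sd[OF simple_function_Pair[OF sf(1,3)]]
        sd[OF simple_function_Pair[OF sf(1) simple_function_Pair[OF sf(2,3)]]]]
    by (simp add: p_def)
  also have "\<dots> = (\<Sum>t\<in>range ?FGH. ?g t * pmf (map_pmf ?FGH J) t)"
    by (intro sum.cong refl) (auto simp: pmf_map p_def)
  also have "\<dots> = measure_pmf.expectation (map_pmf ?FGH J) ?g"
    by (rule integral_measure_pmf_real[symmetric]) (use fin in auto)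
  also have "\<dots> = measure_pmf.expectation J (\<lambda>s. ?g (?FGH s))"
    by simp
  finally show ?thesis by (simp add: vimage_def)
qed

text \<open>Both sides are compared with the squared Hellinger distance.\<close>

lemma total_variation_le_divergence:
  fixes p q :: "'s \<Rightarrow> real"
  assumes S: "finite S" and p: "\<And>s. s \<in> S \<Longrightarrow> 0 \<le> p s" and q: "\<And>s. s \<in> S \<Longrightarrow> 0 \<le> q s"
    and ac: "\<And>s. s \<in> S \<Longrightarrow> p s > 0 \<Longrightarrow> q s > 0"
    and sp: "(\<Sum>s\<in>S. p s) = 1" and sq: "(\<Sum>s\<in>S. q s) \<le> 1"
  shows "(\<Sum>s\<in>S. \<bar>p s - q s\<bar>)\<^sup>2 \<le> 4 * (\<Sum>s\<in>S. p s * log 2 (p s / q s))"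
proof -
  let ?H = "\<Sum>s\<in>S. (sqrt (p s) - sqrt (q s))\<^sup>2"
  \<comment> \<open>This is \<open>ln t \<le> t - 1\<close> at \<open>t = sqrt (q s / p s)\<close>,
    rearranged and multiplied by \<open>2 * p s\<close>.\<close>
  have pt: "2 * p s - 2 * sqrt (p s) * sqrt (q s) \<le> p s * ln (p s / q s)" if s: "s \<in> S" for s
  proof (cases "p s = 0")
    case False
    then have pos: "p s > 0" "q s > 0" using p[OF s] ac[OF s] by auto
    have "ln (sqrt (q s) / sqrt (p s)) \<le> sqrt (q s) / sqrt (p s) - 1"
      using pos by (intro ln_le_minus_one) auto
    moreover have "ln (sqrt (q s) / sqrt (p s)) = - ln (p s / q s) / 2"
      using pos by (simp add: ln_div ln_sqrt)
    ultimately have "2 - 2 * (sqrt (q s) / sqrt (p s)) \<le> ln (p s / q s)"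
      by simp
    then have "p s * (2 - 2 * (sqrt (q s) / sqrt (p s))) \<le> p s * ln (p s / q s)"
      using pos by (intro mult_left_mono) auto
    moreover have "p s * (sqrt (q s) / sqrt (p s)) = sqrt (p s) * sqrt (q s)"
      using pos by (simp add: field_simps)
    moreover have "p s * (2 - 2 * (sqrt (q s) / sqrt (p s)))
        = 2 * p s - 2 * (p s * (sqrt (q s) / sqrt (p s)))"
      by (simp only: right_diff_distrib mult.left_commute mult.commute)
    ultimately show ?thesis by simp
  qed simp
  have "?H = (\<Sum>s\<in>S. p s + q s - 2 * sqrt (p s) * sqrt (q s))"
    using p q by (intro sum.cong refl) (simp add: power2_diff)
  also have "\<dots> \<le> 2 * (\<Sum>s\<in>S. p s) - (\<Sum>s\<in>S. 2 * sqrt (p s) * sqrt (q s))"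
    using sp sq by (simp add: sum.distrib sum_subtractf)
  also have "\<dots> = (\<Sum>s\<in>S. 2 * p s - 2 * sqrt (p s) * sqrt (q s))"
    by (simp add: sum_subtractf sum_distrib_left)
  also have "\<dots> \<le> (\<Sum>s\<in>S. p s * ln (p s / q s))"
    by (intro sum_mono pt)
  finally have HK: "?H \<le> (\<Sum>s\<in>S. p s * ln (p s / q s))" .
  have "0 \<le> ?H" by (intro sum_nonneg) auto
  with HK have nn: "0 \<le> (\<Sum>s\<in>S. p s * ln (p s / q s))" by linarith
  \<comment> \<open>Passing to base 2 gains a factor \<open>1 / ln 2\<close>, which may be dropped
    because the sum is nonnegative and \<open>ln 2 \<le> 1\<close>.\<close>
  have "(\<Sum>s\<in>S. p s * ln (p s / q s)) = ln 2 * (\<Sum>s\<in>S. p s * log 2 (p s / q s))"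
    by (simp add: log_def sum_distrib_left)
  also have "\<dots> \<le> 1 * (\<Sum>s\<in>S. p s * log 2 (p s / q s))"
  proof (rule mult_right_mono)
    show "ln 2 \<le> (1::real)" using ln_le_minus_one[of "2::real"] by simp
    show "0 \<le> (\<Sum>s\<in>S. p s * log 2 (p s / q s))"
      using nn by (simp add: log_def sum_divide_distrib[symmetric] zero_le_divide_iff)
  qed
  finally have HK2: "?H \<le> (\<Sum>s\<in>S. p s * log 2 (p s / q s))" using HK by simp
  have "(\<Sum>s\<in>S. \<bar>p s - q s\<bar>)\<^sup>2 = (\<Sum>s\<in>S. \<bar>sqrt (p s) - sqrt (q s)\<bar> * (sqrt (p s) + sqrt (q s)))\<^sup>2"
  proof -
    have "\<bar>p s - q s\<bar> = \<bar>sqrt (p s) - sqrt (q s)\<bar> * (sqrt (p s) + sqrt (q s))" if "s \<in> S" for s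
    proof -
      have "p s - q s = (sqrt (p s) - sqrt (q s)) * (sqrt (p s) + sqrt (q s))"
        using p[OF that] q[OF that] by (simp add: algebra_simps)
      then show ?thesis using p[OF that] q[OF that] by (simp add: abs_mult)
    qed
    then show ?thesis by simp
  qed
  \<comment> \<open>The second factor is at most 4, from
    \<open>(a + b)^2 \<le> 2 a^2 + 2 b^2\<close> and the two total masses.\<close>
  also have "\<dots> \<le> (\<Sum>s\<in>S. \<bar>sqrt (p s) - sqrt (q s)\<bar>\<^sup>2) * (\<Sum>s\<in>S. (sqrt (p s) + sqrt (q s))\<^sup>2)"
    by (rule Cauchy_Schwarz_ineq_sum)
  also have "\<dots> \<le> ?H * 4"
  proof -
    have "(sqrt (p s) + sqrt (q s))\<^sup>2 \<le> 2 * p s + 2 * q s" if "s \<in> S" for s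
    proof -
      have "0 \<le> (sqrt (p s) - sqrt (q s))\<^sup>2" by simp
      then show ?thesis using p[OF that] q[OF that] by (simp add: power2_sum power2_diff)
    qed
    then have "(\<Sum>s\<in>S. (sqrt (p s) + sqrt (q s))\<^sup>2) \<le> (\<Sum>s\<in>S. 2 * p s + 2 * q s)"
      by (rule sum_mono)
    also have "\<dots> \<le> 4" using sp sq by (simp add: sum.distrib sum_distrib_left[symmetric])
    finally have "(\<Sum>s\<in>S. (sqrt (p s) + sqrt (q s))\<^sup>2) \<le> 4" .
    then show ?thesis using \<open>0 \<le> ?H\<close> by (simp add: mult_left_mono)
  qed
  finally show ?thesis using HK2 by linarith
qed

lemma pmf_joint_law: "pmf (joint_law P W) (x, y) = pmf P x * pmf (W x) y"
proof -
  have "pmf (map_pmf (Pair x') (W x')) (x, y) = (if x' = x then pmf (W x) y else 0)" for x'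
  proof (cases "x' = x")
    case True
    then show ?thesis using pmf_map_inj'[of "Pair x" "W x" y] by (simp add: inj_on_def)
  next
    case False
    then show ?thesis by (auto simp: pmf_eq_0_set_pmf)
  qed
  then have "pmf (joint_law P W) (x, y) = (\<integral>x'. (if x' = x then pmf (W x) y else 0) \<partial>P)"
    by (simp add: joint_law_def pmf_bind)
  also have "\<dots> = (\<Sum>a\<in>{x}. (if a = x then pmf (W x) y else 0) * pmf P a)"
    by (rule integral_measure_pmf_real) (auto split: if_splits)
  finally show ?thesis by simp
qed

lemma set_pmf_joint_law: "set_pmf (joint_law P W) = (SIGMA x:set_pmf P. set_pmf (W x))"
  by (auto simp: joint_law_def)

text \<open>Events about prefixes and letters often coincide only for lists of length
  \<open>n\<close>, which is what the support guarantees.\<close>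

lemma prob_eq_on_support:
  assumes "\<And>s. s \<in> set_pmf p \<Longrightarrow> s \<in> A \<longleftrightarrow> s \<in> B"
  shows "measure_pmf.prob p A = measure_pmf.prob p B"
proof -
  have "A \<inter> set_pmf p = B \<inter> set_pmf p" using assms by blast
  then show ?thesis by (metis measure_Int_set_pmf)
qed

lemma prob_pos_of_support: "s \<in> set_pmf p \<Longrightarrow> s \<in> A \<Longrightarrow> measure_pmf.prob p A > 0"
  using measure_pmf_zero_iff[of p A] measure_nonneg[of p A] by (auto simp: less_le)

lemma take_Suc_eq_iff:
  assumes "i < length x" "i < length y"
  shows "take (Suc i) x = take (Suc i) y \<longleftrightarrow> take i x = take i y \<and> x ! i = y ! i"
  using assms by (simp add: take_Suc_conv_app_nth)

lemma prob_cond_pmf: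
  assumes "set_pmf p \<inter> E \<noteq> {}"
  shows "measure_pmf.prob (cond_pmf p E) A = measure_pmf.prob p (E \<inter> A) / measure_pmf.prob p E"
proof -
  have "measure_pmf.prob p E \<noteq> 0" using assms by (simp add: measure_pmf_zero_iff)
  then have "emeasure (measure_pmf p) E \<noteq> 0" by (simp add: measure_pmf.emeasure_eq_measure)
  then show ?thesis
    unfolding cond_pmf.rep_eq[OF assms]
    by (subst measure_uniform_measure) (auto simp: measure_pmf.emeasure_eq_measure)
qed

text \<open>
  The causal channel \<open>q(y\<^sub>i | x\<^sup>i\<^sup>-\<^sup>1, y\<^sup>i\<^sup>-\<^sup>1)\<close> with probabilities taken from the joint law; by the
  chain rule the divergence of the test channel from it is the directed information.
\<close>

lemma directed_information_eq_divergence: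
  fixes P :: "'a::finite list pmf" and W :: "'a list \<Rightarrow> 'b::finite list pmf"
  assumes P: "\<And>x. x \<in> set_pmf P \<Longrightarrow> length x = n" and W: "test_channel n W"
  shows "\<exists>q. (\<forall>x y. x \<in> set_pmf P \<longrightarrow> y \<in> set_pmf (W x) \<longrightarrow>
        (\<Prod>i<n. pmf (q (take i x) (take i y)) (y ! i)) > 0) \<and>
      directed_information n (joint_law P W) = measure_pmf.expectation (joint_law P W)
        (\<lambda>(x, y). log 2 (pmf (W x) y / (\<Prod>i<n. pmf (q (take i x) (take i y)) (y ! i))))"
proof -
  define J where "J = joint_law P W"
  have len: "length x = n" "length y = n" if "(x, y) \<in> set_pmf J" for x y
    using that P W by (auto simp: J_def set_pmf_joint_law test_channel_def)
  define E :: "'a list \<Rightarrow> 'b list \<Rightarrow> ('a list \<times> 'b list) set" where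
    "E xs ys = {(x, y). take (length xs) x = xs \<and> take (length xs) y = ys}" for xs ys
  \<comment> \<open>The default value is taken only at pasts of probability zero, which never occur
    on the support.\<close>
  define q where "q xs ys = (if set_pmf J \<inter> E xs ys \<noteq> {}
      then map_pmf (\<lambda>(x, y). y ! length xs) (cond_pmf J (E xs ys)) else return_pmf undefined)"
    for xs ys
  \<comment> \<open>With times counted from 0, \<open>a i\<close>, \<open>b i\<close> and
    \<open>c i\<close> are the probabilities of \<open>(x^i, y^i)\<close>,
    \<open>(x^i, y^(i+1))\<close> and \<open>x^i\<close>. Thus \<open>b i / a i\<close> is the
    causal conditional probability, and the information density at step \<open>i\<close> is the
    logarithm of \<open>a (i+1) c i / (b i c (i+1))\<close>.\<close>
  define a where "a i = (\<lambda>(x, y). measure_pmf.prob J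
      {(x', y'). take i x' = take i x \<and> take i y' = take i y})" for i
  define b where "b i = (\<lambda>(x, y). measure_pmf.prob J
      {(x', y'). take i x' = take i x \<and> take (Suc i) y' = take (Suc i) y})" for i
  define c where "c i = (\<lambda>(x, y :: 'b list). measure_pmf.prob J {(x', y'). take i x' = take i x})"
    for i
  have pos: "a i s > 0" "b i s > 0" "c i s > 0" if "s \<in> set_pmf J" for i s
    unfolding a_def b_def c_def
    by (cases s; auto intro!: prob_pos_of_support[OF that])+
  have q: "pmf (q (take i x) (take i y)) (y ! i) = b i (x, y) / a i (x, y)"
    if s: "(x, y) \<in> set_pmf J" and i: "i < n" for x y i
  proof -
    have li: "length (take i x) = i" using len[OF s] i by simp
    have ne: "set_pmf J \<inter> E (take i x) (take i y) \<noteq> {}"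
      using s len[OF s] i by (auto simp: E_def min_def)
    have "pmf (q (take i x) (take i y)) (y ! i) =
        measure_pmf.prob J (E (take i x) (take i y) \<inter> (\<lambda>(x, y). y ! i) -` {y ! i})
        / measure_pmf.prob J (E (take i x) (take i y))"
      using ne li by (simp add: q_def pmf_map prob_cond_pmf)
    also have "measure_pmf.prob J (E (take i x) (take i y)) = a i (x, y)"
      using li by (simp add: E_def a_def)
    also have "measure_pmf.prob J (E (take i x) (take i y) \<inter> (\<lambda>(x, y). y ! i) -` {y ! i})
        = b i (x, y)"
      unfolding b_def prod.case using li len[OF s] len i
      by (intro prob_eq_on_support) (auto simp: E_def take_Suc_eq_iff)
    finally show ?thesis .
  qed
  have qpos: "(\<Prod>i<n. pmf (q (take i x) (take i y)) (y ! i)) > 0" if "(x, y) \<in> set_pmf J" for x y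
    using q[OF that] pos[OF that] by (intro prod_pos) auto
  let ?Y = "\<lambda>i (x :: 'a list, y :: 'b list). take (Suc i) y"
    and ?X = "\<lambda>i (x :: 'a list, y :: 'b list). x ! i"
    and ?Z = "\<lambda>i (x :: 'a list, y :: 'b list). take i x"
  have fin_take: "finite (range (\<lambda>s. take k (f s)))" for k and f :: "'s \<Rightarrow> 'c::finite list"
    by (rule finite_subset[OF _ finite_lists_length_less[of "Suc k"]]) auto
  have fin: "finite (range (?Y i))" "finite (range (?X i))" "finite (range (?Z i))" for i
    using fin_take[of "Suc i" "snd :: 'a list \<times> 'b list \<Rightarrow> _"]
      fin_take[of i "fst :: 'a list \<times> 'b list \<Rightarrow> _"]
    by (auto simp: case_prod_unfold)
  let ?t = "\<lambda>i s. log 2 (a (Suc i) s / (b i s * (c (Suc i) s / c i s)))"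
  have cmi: "prob_space.conditional_mutual_information (measure_pmf J) 2
      (count_space (range (?Y i))) (count_space (range (?X i))) (count_space (range (?Z i)))
      (?Y i) (?X i) (?Z i) = measure_pmf.expectation J (?t i)" if i: "i < n" for i
  proof -
    have "measure_pmf.prob J {t. ?Y i t = ?Y i s \<and> ?X i t = ?X i s \<and> ?Z i t = ?Z i s} = a (Suc i) s"
      "measure_pmf.prob J {t. ?Y i t = ?Y i s \<and> ?Z i t = ?Z i s} = b i s"
      "measure_pmf.prob J {t. ?X i t = ?X i s \<and> ?Z i t = ?Z i s} = c (Suc i) s"
      "measure_pmf.prob J {t. ?Z i t = ?Z i s} = c i s" if s: "s \<in> set_pmf J" for s
    proof -
      obtain x y where sxy: "s = (x, y)" by (cases s)
      note l = len[OF s[unfolded sxy]]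
      show "measure_pmf.prob J {t. ?Y i t = ?Y i s \<and> ?X i t = ?X i s \<and> ?Z i t = ?Z i s} = a (Suc i) s"
        unfolding a_def sxy prod.case using l len i
        by (intro prob_eq_on_support) (auto simp: take_Suc_eq_iff)
      show "measure_pmf.prob J {t. ?X i t = ?X i s \<and> ?Z i t = ?Z i s} = c (Suc i) s"
        unfolding c_def sxy prod.case using l len i
        by (intro prob_eq_on_support) (auto simp: take_Suc_eq_iff)
      show "measure_pmf.prob J {t. ?Y i t = ?Y i s \<and> ?Z i t = ?Z i s} = b i s"
        unfolding b_def sxy prod.case by (intro prob_eq_on_support) auto
      show "measure_pmf.prob J {t. ?Z i t = ?Z i s} = c i s"
        unfolding c_def sxy prod.case by (intro prob_eq_on_support) auto
    qed
    then show ?thesis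
      unfolding conditional_mutual_information_pmf[OF fin]
      by (intro integral_cong_AE) (auto simp: AE_measure_pmf_iff)
  qed
  have finJ: "finite (set_pmf J)"
    by (rule finite_subset[of _ "{x. length x = n} \<times> {y. length y = n}"])
       (use len in \<open>auto intro!: finite_lists_length\<close>)
  have tele: "(\<Sum>i<n. ?t i (x, y)) = log 2 (pmf (W x) y / (\<Prod>i<n. pmf (q (take i x) (take i y)) (y ! i)))"
    if s: "(x, y) \<in> set_pmf J" for x y
  proof -
    let ?s = "(x, y)"
    note p = pos[OF s]
    \<comment> \<open>Once \<open>b i / a i\<close> is split off, the terms with \<open>a\<close>
      and \<open>c\<close> telescope to \<open>log (P(x) W(y|x)) - log P(x)\<close>, and the factors
      \<open>b i / a i\<close> multiply to the causal channel.\<close>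
    have "(\<Sum>i<n. ?t i ?s) = (\<Sum>i<n. (log 2 (a (Suc i) ?s) - log 2 (a i ?s))
        - (log 2 (c (Suc i) ?s) - log 2 (c i ?s)) - log 2 (b i ?s / a i ?s))"
      using p by (intro sum.cong refl) (simp add: log_divide_pos log_mult_pos)
    also have "\<dots> = (log 2 (a n ?s) - log 2 (a 0 ?s)) - (log 2 (c n ?s) - log 2 (c 0 ?s))
        - (\<Sum>i<n. log 2 (b i ?s / a i ?s))"
      using sum_lessThan_telescope[of "\<lambda>i. log 2 (a i ?s)" n]
        sum_lessThan_telescope[of "\<lambda>i. log 2 (c i ?s)" n]
      unfolding sum_subtractf by linarith
    also have "a 0 ?s = 1" by (simp add: a_def case_prod_unfold)
    also have "c 0 ?s = 1" by (simp add: c_def case_prod_unfold)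
    also have "a n ?s = pmf P x * pmf (W x) y"
    proof -
      have "a n ?s = measure_pmf.prob J {?s}"
        unfolding a_def prod.case using len[OF s] by (intro prob_eq_on_support) (auto dest: len)
      then show ?thesis by (simp add: measure_pmf_single J_def pmf_joint_law)
    qed
    also have "c n ?s = pmf P x"
    proof -
      have "c n ?s = measure_pmf.prob J (fst -` {x})"
        unfolding c_def prod.case using len[OF s] by (intro prob_eq_on_support) (auto dest: len)
      also have "\<dots> = pmf (map_pmf fst J) x" by (simp add: pmf_map)
      also have "map_pmf fst J = P"
        by (simp add: J_def joint_law_def map_bind_pmf map_pmf_comp map_pmf_const bind_return_pmf')
      finally show ?thesis .
    qed
    also have "(\<Sum>i<n. log 2 (b i ?s / a i ?s))
        = log 2 (\<Prod>i<n. pmf (q (take i x) (take i y)) (y ! i))"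
    proof -
      have "b i ?s \<noteq> 0" "a i ?s \<noteq> 0" for i
        using p(1)[of i] p(2)[of i] by auto
      then have "ln (\<Prod>i<n. b i ?s / a i ?s) = (\<Sum>i<n. ln (b i ?s / a i ?s))"
        by (intro ln_prod) auto
      then show ?thesis using q[OF s] by (simp add: log_def sum_divide_distrib)
    qed
    finally have eq: "(\<Sum>i<n. ?t i ?s) = log 2 (pmf P x * pmf (W x) y) - log 2 1
        - (log 2 (pmf P x) - log 2 1) - log 2 (\<Prod>i<n. pmf (q (take i x) (take i y)) (y ! i))" .
    have "pmf P x > 0" "pmf (W x) y > 0"
      using s by (auto simp: J_def set_pmf_joint_law pmf_positive)
    then show ?thesis
      using qpos[OF s] unfolding eq by (simp add: log_divide_pos log_mult_pos del: prod_pos_nat_iff)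
  qed
  have "directed_information n J = (\<Sum>i<n. prob_space.conditional_mutual_information (measure_pmf J) 2
      (count_space (range (?Y i))) (count_space (range (?X i))) (count_space (range (?Z i)))
      (?Y i) (?X i) (?Z i))"
    unfolding directed_information_def Let_def
    by (rule sum.reindex_bij_witness[of _ Suc "\<lambda>i. i - 1"]) auto
  also have "\<dots> = (\<Sum>i<n. measure_pmf.expectation J (?t i))"
    by (intro sum.cong refl cmi) auto
  also have "\<dots> = measure_pmf.expectation J (\<lambda>s. \<Sum>i<n. ?t i s)"
    by (rule Bochner_Integration.integral_sum[symmetric]) (intro integrable_measure_pmf_finite finJ)
  also have "\<dots> = measure_pmf.expectation J
        (\<lambda>(x, y). log 2 (pmf (W x) y / (\<Prod>i<n. pmf (q (take i x) (take i y)) (y ! i))))"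
  proof (rule integral_cong_AE)
    show "AE s in J. (\<Sum>i<n. ?t i s) = (case s of (x, y) \<Rightarrow>
        log 2 (pmf (W x) y / (\<Prod>i<n. pmf (q (take i x) (take i y)) (y ! i))))"
      unfolding AE_measure_pmf_iff
    proof
      fix s assume "s \<in> set_pmf J"
      then show "(\<Sum>i<n. ?t i s) = (case s of (x, y) \<Rightarrow>
          log 2 (pmf (W x) y / (\<Prod>i<n. pmf (q (take i x) (take i y)) (y ! i))))"
        by (cases s) (simp only: tele prod.case)
    qed
  qed simp_all
  finally show ?thesis
    using qpos by (intro exI[of _ q]) (auto simp: J_def set_pmf_joint_law)
qed

section \<open>Random covering\<close>

text \<open>On \<open>G\<close> the product of the likelihood ratios is at most
  \<open>2 powr B\<close>, so the first product law is dominated there point by point. Read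
  backwards, this bounds the probability of \<open>G\<close> under \<open>V\<close> from
  below.\<close>

lemma Pi_pmf_change_of_measure:
  fixes U V :: "'i \<Rightarrow> 'y pmf" and l :: "'i \<Rightarrow> 'y \<Rightarrow> real"
  assumes A: "finite A" and fin: "\<And>p. p \<in> A \<Longrightarrow> finite (set_pmf (U p))"
    and le: "\<And>p y. p \<in> A \<Longrightarrow> y \<in> set_pmf (U p) \<Longrightarrow> pmf (U p) y \<le> pmf (V p) y * 2 powr l p y"
    and G: "\<And>y. y \<in> G \<Longrightarrow> (\<Sum>p\<in>A. l p (y p)) \<le> B"
  shows "measure_pmf.prob (Pi_pmf A d U) G \<le> 2 powr B * measure_pmf.prob (Pi_pmf A d V) G"
proof -
  let ?S = "G \<inter> set_pmf (Pi_pmf A d U)"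
  have finS: "finite ?S"
    by (rule finite_subset[OF Int_lower2], rule finite_subset[OF set_Pi_pmf_subset'[OF A]])
       (use A fin in auto)
  have pt: "pmf (Pi_pmf A d U) y \<le> 2 powr B * pmf (Pi_pmf A d V) y" if y: "y \<in> ?S" for y
  proof -
    have yU: "y p \<in> set_pmf (U p)" if "p \<in> A" for p
      using y that A by (auto simp: set_Pi_pmf PiE_dflt_def)
    have yd: "y p = d" if "p \<notin> A" for p
      using y that A by (auto simp: set_Pi_pmf PiE_dflt_def)
    have "pmf (Pi_pmf A d U) y = (\<Prod>p\<in>A. pmf (U p) (y p))"
      by (rule pmf_Pi'[OF A yd])
    also have "\<dots> \<le> (\<Prod>p\<in>A. pmf (V p) (y p) * 2 powr l p (y p))"
      by (intro prod_mono conjI le yU) auto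
    also have "\<dots> = (\<Prod>p\<in>A. pmf (V p) (y p)) * 2 powr (\<Sum>p\<in>A. l p (y p))"
      by (simp add: prod.distrib powr_sum A)
    also have "\<dots> \<le> (\<Prod>p\<in>A. pmf (V p) (y p)) * 2 powr B"
      using G y by (intro mult_left_mono powr_mono prod_nonneg) auto
    also have "(\<Prod>p\<in>A. pmf (V p) (y p)) = pmf (Pi_pmf A d V) y"
      by (rule pmf_Pi'[OF A yd, symmetric])
    finally show ?thesis by (simp add: mult.commute)
  qed
  have "measure_pmf.prob (Pi_pmf A d U) G = measure_pmf.prob (Pi_pmf A d U) ?S"
    by (simp add: measure_Int_set_pmf)
  also have "\<dots> = (\<Sum>y\<in>?S. pmf (Pi_pmf A d U) y)"
    by (rule measure_measure_pmf_finite[OF finS])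
  also have "\<dots> \<le> (\<Sum>y\<in>?S. 2 powr B * pmf (Pi_pmf A d V) y)"
    by (intro sum_mono pt)
  also have "\<dots> = 2 powr B * measure_pmf.prob (Pi_pmf A d V) ?S"
    by (simp add: sum_distrib_left measure_measure_pmf_finite[OF finS])
  also have "\<dots> \<le> 2 powr B * measure_pmf.prob (Pi_pmf A d V) G"
    by (intro mult_left_mono measure_pmf.finite_measure_mono) auto
  finally show ?thesis .
qed

text \<open>The laws may vary with \<open>p\<close>, since they will be the conditional laws given
  different source blocks. Each variable ranges over an interval of width
  \<open>2 * B\<close>.\<close>

lemma Pi_pmf_Hoeffding:
  fixes U :: "nat \<Rightarrow> 'y pmf" and h :: "nat \<Rightarrow> 'y \<Rightarrow> real"
  assumes "N > 0" and "B > 0" and "\<epsilon> \<ge> 0" and h: "\<And>p y. \<bar>h p y\<bar> \<le> B"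
  shows "measure_pmf.prob (Pi_pmf {..<N} d U)
      {y. (\<Sum>p<N. h p (y p)) \<ge> (\<Sum>p<N. measure_pmf.expectation (U p) (h p)) + real N * \<epsilon>}
    \<le> exp (- (real N * \<epsilon>\<^sup>2 / (2 * B\<^sup>2)))"
proof -
  let ?M = "Pi_pmf {..<N} d U"
  interpret Hoeffding_ineq "measure_pmf ?M" "{..<N}" "\<lambda>p y. h p (y p)" "\<lambda>_. - B" "\<lambda>_. B"
    "\<Sum>p<N. measure_pmf.expectation ?M (\<lambda>y. h p (y p))"
  proof unfold_locales
    show "prob_space.indep_vars (measure_pmf ?M) (\<lambda>_. borel) (\<lambda>p y. h p (y p)) {..<N}"
      by (rule prob_space.indep_vars_compose2[OF measure_pmf.prob_space_axioms indep_vars_Pi_pmf]) auto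
    show "AE y in ?M. h p (y p) \<in> {- B..B}" for p
      using h[of p] by (auto simp: abs_le_iff minus_le_iff)
  qed simp_all
  have E: "measure_pmf.expectation ?M (\<lambda>y. h p (y p)) = measure_pmf.expectation (U p) (h p)"
    if "p < N" for p
  proof -
    have "measure_pmf.expectation ?M (\<lambda>y. h p (y p))
        = measure_pmf.expectation (map_pmf (\<lambda>y. y p) ?M) (h p)" by simp
    then show ?thesis using that by (simp add: Pi_pmf_component)
  qed
  have s: "(\<Sum>i<N. (B - (- B))\<^sup>2) = real N * (4 * B\<^sup>2)"
    by (simp add: power2_eq_square)
  have "measure_pmf.prob ?M {y \<in> space ?M. (\<Sum>p<N. h p (y p))
        \<ge> (\<Sum>p<N. measure_pmf.expectation ?M (\<lambda>y. h p (y p))) + real N * \<epsilon>}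
      \<le> exp (- 2 * (real N * \<epsilon>)\<^sup>2 / (\<Sum>i<N. (B - (- B))\<^sup>2))"
    by (rule Hoeffding_ineq_ge) (use assms s in auto)
  also have "- 2 * (real N * \<epsilon>)\<^sup>2 / (\<Sum>i<N. (B - (- B))\<^sup>2) = - (real N * \<epsilon>\<^sup>2 / (2 * B\<^sup>2))"
    unfolding s using assms by (simp add: power2_eq_square field_simps)
  finally show ?thesis using E by simp
qed

text \<open>Averaging the number of uncovered words over a random codebook.\<close>

lemma exists_covering_codebook:
  fixes Q :: "'s pmf" and F :: "'x \<Rightarrow> nat \<Rightarrow> 's \<Rightarrow> 'y" and G :: "'x \<Rightarrow> (nat \<Rightarrow> 'y) set"
    and w :: "'x \<Rightarrow> real"
  assumes X: "finite X" and w: "\<And>x. x \<in> X \<Longrightarrow> 0 \<le> w x"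
  shows "\<exists>C. (\<Sum>x\<in>X. w x * (if \<exists>k<K. (\<lambda>p. if p < N then F x p (C k p) else d) \<in> G x then 0 else 1))
    \<le> (\<Sum>x\<in>X. w x * (1 - measure_pmf.prob (Pi_pmf {..<N} d (\<lambda>p. map_pmf (F x p) Q)) (G x)) ^ K)"
proof (rule ccontr)
  \<comment> \<open>\<open>T\<close> draws one codeword, an independent strategy per block, and
    \<open>R\<close> draws \<open>K\<close> independent codewords; \<open>x\<close> is left
    uncovered exactly when all of them lie in \<open>bad x\<close>.\<close>
  define T where "T = Pi_pmf {..<N} undefined (\<lambda>_. Q)"
  define R where "R = Pi_pmf {..<K} undefined (\<lambda>_. T)"
  define bad where "bad x = {c. (\<lambda>p. if p < N then F x p (c p) else d) \<notin> G x}" for x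
  let ?f = "\<lambda>C. \<Sum>x\<in>X. w x * indicator (Pi {..<K} (\<lambda>_. bad x)) C :: real"
  let ?v = "\<Sum>x\<in>X. w x * (1 - measure_pmf.prob (Pi_pmf {..<N} d (\<lambda>p. map_pmf (F x p) Q)) (G x)) ^ K"
  assume neg: "\<not> ?thesis"
  have gt: "?v < ?f C" for C
  proof -
    have eq: "(if \<exists>k<K. (\<lambda>p. if p < N then F x p (C k p) else d) \<in> G x then 0 else 1 :: real)
        = indicator (Pi {..<K} (\<lambda>_. bad x)) C" for x
      by (auto simp: bad_def indicator_def)
    from neg have "?v < (\<Sum>x\<in>X. w x *
        (if \<exists>k<K. (\<lambda>p. if p < N then F x p (C k p) else d) \<in> G x then 0 else 1))"
      by (simp only: not_ex not_le)
    then show ?thesis by (simp only: eq)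
  qed
  have int: "integrable (measure_pmf R) (\<lambda>C. w x * indicator (Pi {..<K} (\<lambda>_. bad x)) C)" for x
    by (intro integrable_mult_right measure_pmf.integrable_const_bound[where B = 1])
       (auto simp: indicator_def)
  have "?v < measure_pmf.expectation R ?f"
    by (rule measure_pmf.expectation_greater) (use int gt in auto)
  also have "\<dots> = (\<Sum>x\<in>X. w x * measure_pmf.prob R (Pi {..<K} (\<lambda>_. bad x)))"
    using int by (subst Bochner_Integration.integral_sum) auto
  also have "\<dots> = ?v"
  proof (intro sum.cong refl arg_cong2[where f = "(*)"])
    fix x
    let ?g = "\<lambda>c p. if p < N then F x p (c p) else d"
    have "Pi_pmf {..<N} d (\<lambda>p. map_pmf (F x p) Q) = map_pmf ?g T"
      unfolding map_pmf_def T_def by (subst Pi_pmf_bind[where d' = undefined]) auto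
    then have "measure_pmf.prob (Pi_pmf {..<N} d (\<lambda>p. map_pmf (F x p) Q)) (G x)
        = measure_pmf.prob T (- bad x)"
      by (simp add: bad_def vimage_def Compl_eq)
    also have "\<dots> = 1 - measure_pmf.prob T (bad x)"
      using measure_pmf.prob_compl[of "bad x" T] by (simp add: Compl_eq_Diff_UNIV)
    finally show "measure_pmf.prob R (Pi {..<K} (\<lambda>_. bad x)) =
        (1 - measure_pmf.prob (Pi_pmf {..<N} d (\<lambda>p. map_pmf (F x p) Q)) (G x)) ^ K"
      unfolding R_def by (simp add: measure_Pi_pmf_Pi)
  qed
  finally show False by simp
qed

text \<open>Under \<open>U\<close> each condition fails with probability at most 1/4, so both hold
  with probability at least 1/2; the change of measure to \<open>V\<close> costs the exponent
  \<open>N * (I + \<epsilon>)\<close>. Half of \<open>\<epsilon>\<close> is allowed to the means,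
  the other half to Hoeffding's inequality, whence the constant 8.\<close>

lemma covering_probability:
  fixes U V :: "nat \<Rightarrow> 'y pmf" and l h :: "nat \<Rightarrow> 'y \<Rightarrow> real"
  assumes fin: "\<And>p. p < N \<Longrightarrow> finite (set_pmf (U p))"
    and le: "\<And>p y. p < N \<Longrightarrow> y \<in> set_pmf (U p) \<Longrightarrow> pmf (U p) y \<le> pmf (V p) y * 2 powr l p y"
    and "N > 0" "B > 0" "\<epsilon> > 0" and l: "\<And>p y. \<bar>l p y\<bar> \<le> B" and h: "\<And>p y. \<bar>h p y\<bar> \<le> B"
    and El: "(\<Sum>p<N. measure_pmf.expectation (U p) (l p)) \<le> real N * (I + \<epsilon> / 2)"
    and Eh: "(\<Sum>p<N. measure_pmf.expectation (U p) (h p)) \<le> real N * (H + \<epsilon> / 2)"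
    and small: "exp (- (real N * \<epsilon>\<^sup>2 / (8 * B\<^sup>2))) \<le> 1 / 4"
  shows "measure_pmf.prob (Pi_pmf {..<N} d V)
      {y. (\<Sum>p<N. l p (y p)) \<le> real N * (I + \<epsilon>) \<and> (\<Sum>p<N. h p (y p)) \<le> real N * (H + \<epsilon>)}
    \<ge> 2 powr (- (real N * (I + \<epsilon>))) / 2"
proof -
  let ?U = "Pi_pmf {..<N} d U"
  let ?G = "{y. (\<Sum>p<N. l p (y p)) \<le> real N * (I + \<epsilon>) \<and> (\<Sum>p<N. h p (y p)) \<le> real N * (H + \<epsilon>)}"
  let ?A = "\<lambda>k :: nat \<Rightarrow> 'y \<Rightarrow> real. {y. (\<Sum>p<N. k p (y p))
    \<ge> (\<Sum>p<N. measure_pmf.expectation (U p) (k p)) + real N * (\<epsilon> / 2)}"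
  have s: "exp (- (real N * (\<epsilon> / 2)\<^sup>2 / (2 * B\<^sup>2))) \<le> 1 / 4"
    using small by (simp add: power_divide)
  have A: "measure_pmf.prob ?U (?A l) \<le> 1 / 4" "measure_pmf.prob ?U (?A h) \<le> 1 / 4"
    using Pi_pmf_Hoeffding[of N B "\<epsilon> / 2" l d U] Pi_pmf_Hoeffding[of N B "\<epsilon> / 2" h d U]
      assms(3-7) s by auto
  have "- ?G \<subseteq> ?A l \<union> ?A h"
    using El Eh by (auto simp: algebra_simps)
  then have "measure_pmf.prob ?U (- ?G) \<le> measure_pmf.prob ?U (?A l \<union> ?A h)"
    by (intro measure_pmf.finite_measure_mono) auto
  also have "\<dots> \<le> measure_pmf.prob ?U (?A l) + measure_pmf.prob ?U (?A h)"
    by (intro measure_Un_le) auto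
  also have "\<dots> \<le> 1 / 2" using A by linarith
  finally have "1 / 2 \<le> measure_pmf.prob ?U ?G"
    using measure_pmf.prob_compl[of ?G ?U] by (simp add: Compl_eq_Diff_UNIV)
  also have "\<dots> \<le> 2 powr (real N * (I + \<epsilon>)) * measure_pmf.prob (Pi_pmf {..<N} d V) ?G"
    by (rule Pi_pmf_change_of_measure[where l = l]) (use fin le in auto)
  finally have "1 / 2 \<le> measure_pmf.prob (Pi_pmf {..<N} d V) ?G * 2 powr (real N * (I + \<epsilon>))"
    by (simp only: mult.commute)
  then have "1 / 2 / 2 powr (real N * (I + \<epsilon>)) \<le> measure_pmf.prob (Pi_pmf {..<N} d V) ?G"
    by (simp only: pos_divide_le_eq powr_gt_zero)
  moreover have "1 / 2 / 2 powr (real N * (I + \<epsilon>)) = 2 powr (- (real N * (I + \<epsilon>))) / 2"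
    by (simp only: powr_minus divide_inverse mult_1 mult.commute)
  ultimately show ?thesis by simp
qed

section \<open>Finite windows of the source and block codes\<close>

lemma space_seq_space [simp]: "space seq_space = UNIV"
  by (simp add: seq_space_def space_PiM)

lemma measurable_seq_space_coord [measurable]: "(\<lambda>x. x i) \<in> seq_space \<rightarrow>\<^sub>M count_space UNIV"
  unfolding seq_space_def by (rule measurable_component_singleton) simp

lemma measurable_seq_spaceI:
  assumes "\<And>i. f i \<in> N \<rightarrow>\<^sub>M count_space UNIV"
  shows "(\<lambda>\<omega> i. f i \<omega>) \<in> N \<rightarrow>\<^sub>M seq_space"
  unfolding seq_space_def by (rule measurable_PiM_single') (use assms in auto)

lemma measurable_shift [measurable]: "shift \<in> seq_space \<rightarrow>\<^sub>M seq_space"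
proof -
  have "(\<lambda>x i. x (i + 1)) \<in> seq_space \<rightarrow>\<^sub>M seq_space"
    by (rule measurable_seq_spaceI) measurable
  then show ?thesis by (simp add: shift_def[abs_def])
qed

lemma shift_pow: "(shift ^^ k) x = (\<lambda>i. x (i + int k))"
  by (induction k) (auto simp: shift_def fun_eq_iff algebra_simps)

lemma nth_window: "j < nat (b - a + 1) \<Longrightarrow> window x a b ! j = x (a + int j)"
  by (simp add: window_def nth_upto)

lemma length_window [simp]: "length (window x a b) = nat (b - a + 1)"
  by (simp add: window_def)

lemma window_eq_iff: "window x a b = window x' a b \<longleftrightarrow> (\<forall>i\<in>{a..b}. x i = x' i)"
  by (auto simp: window_def)

lemma window_shift: "window ((shift ^^ k) x) a b = window x (a + int k) (b + int k)"
  by (rule nth_equalityI) (auto simp: nth_window shift_pow algebra_simps)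

lemma drop_window:
  "take k (drop s (window x 1 (int N))) = take k (window ((shift ^^ s) x) 1 (int n))"
  if "k \<le> n" "s + n \<le> N"
  by (rule nth_equalityI) (use that in \<open>auto simp: nth_window shift_pow algebra_simps\<close>)

text \<open>Over a finite alphabet this one property yields measurability, boundedness and
  integrability at once. The interval may reach back to nonpositive times, as the distortion
  does.\<close>

definition finitely_determined :: "((int \<Rightarrow> 'a) \<Rightarrow> 'c) \<Rightarrow> bool" where
  "finitely_determined F \<longleftrightarrow> (\<exists>a b. \<forall>x x'. (\<forall>i\<in>{a..b}. x i = x' i) \<longrightarrow> F x = F x')"

lemma finitely_determined_window: "finitely_determined (\<lambda>x. window x a b)"
  unfolding finitely_determined_def by (intro exI[of _ a] exI[of _ b]) (simp add: window_eq_iff)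

lemma finitely_determined_comp:
  "finitely_determined F \<Longrightarrow> finitely_determined (\<lambda>x. g (F x))"
  unfolding finitely_determined_def by metis

lemma finitely_determined_comp2:
  assumes "finitely_determined F" and "finitely_determined G"
  shows "finitely_determined (\<lambda>x. g (F x) (G x))"
proof -
  obtain a b where F: "(\<forall>i\<in>{a..b}. x i = x' i) \<Longrightarrow> F x = F x'" for x x'
    using assms(1) unfolding finitely_determined_def by blast
  obtain c d where G: "(\<forall>i\<in>{c..d}. x i = x' i) \<Longrightarrow> G x = G x'" for x x'
    using assms(2) unfolding finitely_determined_def by blast
  have "F x = F x'" "G x = G x'" if agree: "\<forall>i\<in>{min a c..max b d}. x i = x' i" for x x'
  proof -
    have "x i = x' i" if "i \<in> {a..b} \<or> i \<in> {c..d}" for i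
      by (rule bspec[OF agree]) (use that in auto)
    then show "F x = F x'" "G x = G x'" by (auto intro!: F G)
  qed
  then show ?thesis unfolding finitely_determined_def by metis
qed

lemma finitely_determined_const: "finitely_determined (\<lambda>_. c)"
  by (simp add: finitely_determined_def)

lemma finitely_determined_sum:
  fixes F :: "nat \<Rightarrow> (int \<Rightarrow> 'a) \<Rightarrow> real"
  assumes "\<And>i. i < n \<Longrightarrow> finitely_determined (F i)"
  shows "finitely_determined (\<lambda>x. \<Sum>i<n. F i x)"
  using assms
proof (induction n)
  case (Suc n)
  then have "finitely_determined (\<lambda>x. (\<Sum>i<n. F i x) + F n x)"
    by (intro finitely_determined_comp2[where g = "(+)"]) auto
  then show ?case by simp
qed (simp add: finitely_determined_const)

lemma finitely_determined_shift:
  assumes "finitely_determined F"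
  shows "finitely_determined (\<lambda>x. F ((shift ^^ k) x))"
proof -
  obtain a b where F: "(\<forall>i\<in>{a..b}. x i = x' i) \<Longrightarrow> F x = F x'" for x x'
    using assms unfolding finitely_determined_def by blast
  have "F ((shift ^^ k) x) = F ((shift ^^ k) x')"
    if "\<forall>i\<in>{a + int k..b + int k}. x i = x' i" for x x'
    using that by (intro F) (auto simp: shift_pow)
  then show ?thesis unfolding finitely_determined_def by blast
qed

lemma finitely_determined_factor:
  assumes "finitely_determined F"
  obtains G a b where "F = (\<lambda>x. G (window x a b))"
proof -
  obtain a b where F: "(\<forall>i\<in>{a..b}. x i = x' i) \<Longrightarrow> F x = F x'" for x x'
    using assms unfolding finitely_determined_def by blast
  \<comment> \<open>Any sequence with window \<open>l\<close> will do, because \<open>F\<close> does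
    not distinguish between them.\<close>
  define G where "G l = F (SOME x. window x a b = l)" for l
  have "F x = G (window x a b)" for x
    unfolding G_def by (rule F) (metis (mono_tags, lifting) someI window_eq_iff)
  then show ?thesis using that by blast
qed

lemma measurable_window [measurable]:
  "(\<lambda>x. window x a b :: 'a::finite list) \<in> seq_space \<rightarrow>\<^sub>M count_space UNIV"
proof -
  have "(\<lambda>x. map x js :: 'a list) \<in> seq_space \<rightarrow>\<^sub>M count_space UNIV" for js :: "int list"
  proof (induction js)
    case (Cons i js)
    have "(\<lambda>x :: int \<Rightarrow> 'a. (x i, map x js)) \<in> seq_space \<rightarrow>\<^sub>M count_space UNIV \<Otimes>\<^sub>M count_space UNIV"
      by (intro measurable_Pair measurable_seq_space_coord Cons)
    then have "(\<lambda>x :: int \<Rightarrow> 'a. (x i, map x js)) \<in> seq_space \<rightarrow>\<^sub>M count_space UNIV"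
      by (simp add: pair_measure_countable)
    from measurable_compose[OF this, of "\<lambda>p. fst p # snd p" "count_space UNIV"]
    show ?case by simp
  qed simp
  then show ?thesis by (simp add: window_def)
qed

lemma finitely_determined_measurable:
  fixes F :: "(int \<Rightarrow> 'a::finite) \<Rightarrow> 'c"
  assumes "finitely_determined F" and "space N = UNIV"
  shows "F \<in> seq_space \<rightarrow>\<^sub>M N"
proof -
  obtain G a b where "F = (\<lambda>x. G (window x a b))"
    using finitely_determined_factor[OF assms(1)] by blast
  then show ?thesis
    using measurable_compose[OF measurable_window[of a b], of G N] assms(2) by simp
qed

lemma finitely_determined_bounded:
  fixes F :: "(int \<Rightarrow> 'a::finite) \<Rightarrow> real"
  assumes "finitely_determined F"
  shows "\<exists>B>0. \<forall>x. \<bar>F x\<bar> \<le> B"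
proof -
  obtain G a b where F: "F = (\<lambda>x. G (window x a b))"
    using finitely_determined_factor[OF assms] by blast
  have "finite ((\<lambda>u. \<bar>G u\<bar>) ` {u. length u = nat (b - a + 1)})"
    by (intro finite_imageI finite_lists_length)
  then obtain B where "\<forall>v\<in>(\<lambda>u. \<bar>G u\<bar>) ` {u. length u = nat (b - a + 1)}. v \<le> B"
    using bdd_above_finite unfolding bdd_above_def by blast
  then have "\<bar>F x\<bar> \<le> max B 1" for x
    by (auto simp: F intro!: max.coboundedI1)
  then show ?thesis by (intro exI[of _ "max B 1"]) auto
qed

section \<open>Block codes and their distortion\<close>

definition block_distortion ::
    "('a list \<Rightarrow> 'b \<Rightarrow> real) \<Rightarrow> nat \<Rightarrow> nat \<Rightarrow> (int \<Rightarrow> 'a) \<Rightarrow> 'b list \<Rightarrow> real" where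
  "block_distortion \<rho> m n x y =
    (\<Sum>i<n. \<rho> (window x (int i + 1 - int m) (int i + 1)) (y ! i))"

lemma distortion_eq: "distortion \<rho> m n x y = block_distortion \<rho> m n x y / real n"
proof -
  have "(\<Sum>i = 1..n. \<rho> (window x (int i - int m) (int i)) (y ! (i - 1))) = block_distortion \<rho> m n x y"
    unfolding block_distortion_def
    by (rule sum.reindex_bij_witness[of _ Suc "\<lambda>i. i - 1"])
       (auto simp: of_nat_diff algebra_simps)
  then show ?thesis by (simp add: distortion_def)
qed

lemma finitely_determined_block_distortion:
  "finitely_determined (block_distortion \<rho> m n :: (int \<Rightarrow> 'a) \<Rightarrow> _)"
  unfolding finitely_determined_def
proof (intro exI allI impI ext)
  fix x x' :: "int \<Rightarrow> 'a" and y
  assume *: "\<forall>i\<in>{1 - int m..int n}. x i = x' i"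
  have "window x (int i + 1 - int m) (int i + 1) = window x' (int i + 1 - int m) (int i + 1)"
    if "i < n" for i
    unfolding window_eq_iff using * that by auto
  then show "block_distortion \<rho> m n x y = block_distortion \<rho> m n x' y"
    unfolding block_distortion_def by (intro sum.cong refl) auto
qed

lemma abs_block_distortion_le:
  assumes "\<And>u y. length u = m + 1 \<Longrightarrow> \<bar>\<rho> u y\<bar> \<le> c"
  shows "\<bar>block_distortion \<rho> m n x y\<bar> \<le> real n * c"
proof -
  have "\<bar>block_distortion \<rho> m n x y\<bar> \<le> (\<Sum>i<n. c)"
    unfolding block_distortion_def
    by (intro order.trans[OF sum_abs] sum_mono assms) (simp add: nat_add_distrib)
  then show ?thesis by simp
qed

text \<open>
  Block \<open>p\<close> occupies the times \<open>s p + 1, \<dots>, s p + n\<close>; at such a time the decoder applies the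
  strategy of block \<open>p\<close> to the letters of that block which have already been fed back.
\<close>

definition block_decoder ::
    "nat \<Rightarrow> (nat \<Rightarrow> nat) \<Rightarrow> (nat \<Rightarrow> nat \<Rightarrow> 'a list \<Rightarrow> 'b) \<Rightarrow> nat \<Rightarrow> nat \<Rightarrow> 'a list \<Rightarrow> 'b" where
  "block_decoder n s C i w past = (let p = LEAST p. i \<le> s p + n in C w p (drop (s p) past))"

lemma block_positions_mono:
  assumes "\<And>p. s p + n \<le> s (Suc p)" and "p < q"
  shows "s p + n \<le> (s q :: nat)"
  using assms(2)
proof (induction q)
  case (Suc q)
  show ?case
  proof (cases "p = q")
    case False
    then have "s p + n \<le> s q" using Suc by simp
    then show ?thesis using assms(1)[of q] by linarith
  qed (simp add: assms(1))
qed simp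

text \<open>Every earlier block ends no later than \<open>s p\<close>, so the least index found by
  the decoder is \<open>p\<close>; dropping \<open>s p\<close> letters from what has been fed back
  leaves the past within the block.\<close>

lemma nth_reconstruction_block:
  assumes s: "\<And>p. s p + n \<le> s (Suc p)" and "s p + n \<le> N" and o: "i < n" and "length xs = N"
  shows "reconstruction N f (block_decoder n s C) xs ! (s p + i)
    = C (f xs) p (take i (drop (s p) xs))"
proof -
  have "(LEAST q. Suc (s p + i) \<le> s q + n) = p"
  proof (rule Least_equality)
    show "Suc (s p + i) \<le> s p + n" using o by simp
    show "p \<le> q" if "Suc (s p + i) \<le> s q + n" for q
    proof (rule ccontr)
      assume "\<not> p \<le> q"
      then have "s q + n \<le> s p" by (intro block_positions_mono[of s n, OF s]) simp
      with that show False by simp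
    qed
  qed
  moreover have "s p + i < N" using assms by linarith
  ultimately show ?thesis
    by (simp add: reconstruction_def block_decoder_def drop_take nth_append del: upt_Suc)
qed

text \<open>The block intervals are disjoint, and every time outside them is charged the maximum
  \<open>c\<close>. Block distortions are taken along the shifted sequence rather than a cut-out
  word, so the \<open>m\<close> letters looked back to may lie before the block.\<close>

lemma block_code_distortion:
  fixes x :: "int \<Rightarrow> 'a" and f :: "'a list \<Rightarrow> nat" and C :: "nat \<Rightarrow> nat \<Rightarrow> 'a list \<Rightarrow> 'b"
  assumes s: "\<And>p. s p + n \<le> s (Suc p)" and N: "\<And>p. p < P \<Longrightarrow> s p + n \<le> N"
    and c: "\<And>u y. length u = m + 1 \<Longrightarrow> \<bar>\<rho> u y\<bar> \<le> c"
  defines "xs \<equiv> window x 1 (int N)"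
  shows "n * P \<le> N"
    and "block_distortion \<rho> m N x (reconstruction N f (block_decoder n s C) xs)
    \<le> (\<Sum>p<P. block_distortion \<rho> m n ((shift ^^ s p) x)
          (strategy_path n (C (f xs) p) (window ((shift ^^ s p) x) 1 (int n))))
      + real (N - n * P) * c"
proof -
  let ?y = "reconstruction N f (block_decoder n s C) xs"
  let ?e = "\<lambda>j. \<rho> (window x (int j + 1 - int m) (int j + 1)) (?y ! j)"
  define I where "I p = {s p..<s p + n}" for p
  have disj: "I p \<inter> I q = {}" if "p \<noteq> q" for p q
    using block_positions_mono[of s n p q, OF s] block_positions_mono[of s n q p, OF s] that
    by (cases p q rule: linorder_cases) (auto simp: I_def)
  define U where "U = (\<Union>p\<in>{..<P}. I p)"
  have UN: "U \<subseteq> {..<N}" using N by (force simp: U_def I_def)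
  have cardU: "card U = n * P"
    unfolding U_def using disj by (subst card_UN_disjoint) (auto simp: I_def)
  show "n * P \<le> N"
    using card_mono[OF _ UN] by (simp add: cardU)
  have "block_distortion \<rho> m N x ?y = sum ?e U + sum ?e ({..<N} - U)"
    unfolding block_distortion_def using sum.subset_diff[OF UN, of ?e] by simp
  also have "sum ?e ({..<N} - U) \<le> (\<Sum>j\<in>{..<N} - U. c)"
  proof (rule sum_mono)
    show "?e j \<le> c" for j using c[of "window x (int j + 1 - int m) (int j + 1)" "?y ! j"]
      by (simp add: nat_add_distrib)
  qed
  also have "\<dots> = real (N - n * P) * c"
    using UN by (simp add: card_Diff_subset finite_subset[OF UN] cardU)
  also have "sum ?e U = (\<Sum>p<P. sum ?e (I p))"
    unfolding U_def using disj by (intro sum.UNION_disjoint) (auto simp: I_def)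
  also have "\<dots> = (\<Sum>p<P. block_distortion \<rho> m n ((shift ^^ s p) x)
          (strategy_path n (C (f xs) p) (window ((shift ^^ s p) x) 1 (int n))))"
  proof (intro sum.cong refl)
    fix p assume "p \<in> {..<P}"
    then have p: "s p + n \<le> N" using N by simp
    have "sum ?e (I p) = (\<Sum>i<n. ?e (s p + i))"
      unfolding I_def by (rule sum.reindex_bij_witness[of _ "\<lambda>i. s p + i" "\<lambda>j. j - s p"]) auto
    also have "\<dots> = block_distortion \<rho> m n ((shift ^^ s p) x)
          (strategy_path n (C (f xs) p) (window ((shift ^^ s p) x) 1 (int n)))"
      unfolding block_distortion_def
    proof (intro sum.cong refl arg_cong2[where f = \<rho>])
      fix i assume i: "i \<in> {..<n}"
      show "window x (int (s p + i) + 1 - int m) (int (s p + i) + 1) =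
          window ((shift ^^ s p) x) (int i + 1 - int m) (int i + 1)"
        by (simp add: window_shift algebra_simps)
      have "?y ! (s p + i) = C (f xs) p (take i (drop (s p) xs))"
        using i p by (intro nth_reconstruction_block s) (auto simp: xs_def)
      also have "take i (drop (s p) xs) = take i (window ((shift ^^ s p) x) 1 (int n))"
        unfolding xs_def using i p by (intro drop_window) auto
      finally show "?y ! (s p + i) =
          strategy_path n (C (f xs) p) (window ((shift ^^ s p) x) 1 (int n)) ! i"
        using i by simp
    qed
    finally show "sum ?e (I p) = block_distortion \<rho> m n ((shift ^^ s p) x)
          (strategy_path n (C (f xs) p) (window ((shift ^^ s p) x) 1 (int n)))" .
  qed
  finally show "block_distortion \<rho> m N x ?y
    \<le> (\<Sum>p<P. block_distortion \<rho> m n ((shift ^^ s p) x)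
          (strategy_path n (C (f xs) p) (window ((shift ^^ s p) x) 1 (int n))))
      + real (N - n * P) * c" by simp
qed

text \<open>Extends a word to a sequence with arbitrary values outside its times, so that the
  encoder can evaluate functions of sequences.\<close>

definition seq_of :: "'a list \<Rightarrow> int \<Rightarrow> 'a" where
  "seq_of xs i = xs ! nat (i - 1)"

lemma seq_of_window: "1 \<le> i \<Longrightarrow> i \<le> int N \<Longrightarrow> seq_of (window x 1 (int N)) i = x i"
  by (simp add: seq_of_def nth_window)

section \<open>The law of the source as an ergodic system\<close>

locale ergodic_source =
  fixes M :: "'w measure" and X :: "int \<Rightarrow> 'w \<Rightarrow> 'a::finite"
  assumes source: "discrete_source M X" and stationary: "stationary M X" and ergodic: "ergodic M X"
begin

abbreviation "\<mu> \<equiv> process_law M X"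

lemma measurable_process [measurable]: "(\<lambda>\<omega> i. X i \<omega>) \<in> M \<rightarrow>\<^sub>M seq_space"
  using source by (intro measurable_seq_spaceI) (simp add: discrete_source_def)

lemma sets_process_law [measurable_cong]: "sets \<mu> = sets seq_space"
  by (simp add: process_law_def)

lemma space_process_law [simp]: "space \<mu> = UNIV"
  by (simp add: process_law_def)

sublocale law: ergodic_system \<mu> shift
proof -
  have "prob_space M" using source by (simp add: discrete_source_def)
  then have "prob_space \<mu>"
    unfolding process_law_def by (rule prob_space.prob_space_distr) measurable
  moreover have "distr \<mu> \<mu> shift = distr \<mu> seq_space shift"
    by (rule distr_cong) (auto simp: sets_process_law)
  ultimately show "ergodic_system \<mu> shift"
    using stationary ergodic
    by (intro ergodic_system.intro measure_preserving_system.intro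
        measure_preserving_system_axioms.intro ergodic_system_axioms.intro)
       (auto simp: stationary_def ergodic_def sets_process_law cong: measurable_cong_sets)
qed

lemma integral_process:
  fixes F :: "(int \<Rightarrow> 'a) \<Rightarrow> real"
  assumes "finitely_determined F"
  shows "(\<integral>\<omega>. F (\<lambda>i. X i \<omega>) \<partial>M) = (\<integral>x. F x \<partial>\<mu>)"
  unfolding process_law_def
  by (rule integral_distr[symmetric]) (auto intro: finitely_determined_measurable assms)

lemma integral_window:
  fixes F :: "'a list \<Rightarrow> real"
  shows "(\<integral>x. F (window x 1 (int n)) \<partial>\<mu>) = measure_pmf.expectation (block_law M X n) F"
proof -
  interpret M: prob_space M using source by (simp add: discrete_source_def)
  note B [measurable] = measurable_source_block[OF source, of n]
  have eq: "measure_pmf (block_law M X n) = distr M (count_space UNIV) (source_block X n)"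
  proof (rule measure_eqI_countable[where A = UNIV])
    show "emeasure (measure_pmf (block_law M X n)) {x} = emeasure (distr M (count_space UNIV) (source_block X n)) {x}" for x
      by (simp add: emeasure_pmf_single pmf_block_law[OF source] emeasure_distr M.emeasure_eq_measure
          vimage_def Int_def conj_commute)
  qed auto
  have "(\<integral>x. F (window x 1 (int n)) \<partial>\<mu>) = (\<integral>\<omega>. F (source_block X n \<omega>) \<partial>M)"
    unfolding source_block_def
    by (rule integral_process[symmetric]) (rule finitely_determined_comp[OF finitely_determined_window])
  also have "\<dots> = measure_pmf.expectation (block_law M X n) F"
    unfolding eq by (rule integral_distr[symmetric]) auto
  finally show ?thesis .
qed

lemma length_block_law: "x \<in> set_pmf (block_law M X n) \<Longrightarrow> length x = n"
proof -
  assume "x \<in> set_pmf (block_law M X n)"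
  then have "measure M {\<omega> \<in> space M. source_block X n \<omega> = x} \<noteq> 0"
    by (simp add: set_pmf_eq pmf_block_law[OF source])
  then have "{\<omega> \<in> space M. source_block X n \<omega> = x} \<noteq> {}" by (metis measure_empty)
  then show ?thesis by (auto simp: source_block_def)
qed

end

section \<open>Test channels compared with mixtures of strategies\<close>

lemma pmf_expectation_finite:
  fixes f :: "'a \<Rightarrow> real"
  assumes "finite S" and "set_pmf p \<subseteq> S"
  shows "measure_pmf.expectation p f = (\<Sum>y\<in>S. pmf p y * f y)"
  using integral_measure_pmf[OF assms(1), of p f] assms(2) by auto

lemma finite_set_test_channel:
  fixes W :: "'a list \<Rightarrow> 'b::finite list pmf"
  assumes "test_channel n W" and "length x = n"
  shows "finite (set_pmf (W x))" "set_pmf (W x) \<subseteq> {y. length y = n}"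
proof -
  show *: "set_pmf (W x) \<subseteq> {y. length y = n}" using assms by (auto simp: test_channel_def)
  show "finite (set_pmf (W x))" by (rule finite_subset[OF * finite_lists_length])
qed

lemma expectation_joint_law:
  fixes W :: "'a::finite list \<Rightarrow> 'b::finite list pmf" and f :: "'a list \<times> 'b list \<Rightarrow> real"
  assumes P: "\<And>x. x \<in> set_pmf P \<Longrightarrow> length x = n" and W: "test_channel n W"
  shows "measure_pmf.expectation (joint_law P W) f
    = measure_pmf.expectation P (\<lambda>x. measure_pmf.expectation (W x) (\<lambda>y. f (x, y)))"
proof -
  have PS: "set_pmf P \<subseteq> {x. length x = n}" using P by auto
  have "measure_pmf.expectation (joint_law P W) f = (\<Sum>x\<in>{x. length x = n}.
      pmf P x *\<^sub>R measure_pmf.expectation (map_pmf (Pair x) (W x)) f)"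
    unfolding joint_law_def
    by (rule pmf_expectation_bind[OF finite_lists_length _ PS])
       (use finite_set_test_channel[OF W] in auto)
  also have "\<dots> = measure_pmf.expectation P (\<lambda>x. measure_pmf.expectation (W x) (\<lambda>y. f (x, y)))"
    by (subst pmf_expectation_finite[OF finite_lists_length PS]) simp
  finally show ?thesis .
qed

definition strategy_channel :: "nat \<Rightarrow> ('a list \<Rightarrow> 'b) pmf \<Rightarrow> 'a list \<Rightarrow> 'b list pmf" where
  "strategy_channel n \<Phi> x = map_pmf (\<lambda>\<phi>. strategy_path n \<phi> x) \<Phi>"

lemma test_channel_strategy_channel: "test_channel n (strategy_channel n \<Phi>)"
  by (auto simp: test_channel_def strategy_channel_def)

text \<open>The random strategies reproduce the causal channel on words of length \<open>n\<close>,
  so it may be replaced by \<open>strategy_channel n \<Phi>\<close> inside the divergence.\<close>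

lemma directed_information_strategies:
  fixes P :: "'a::finite list pmf" and W :: "'a list \<Rightarrow> 'b::finite list pmf"
  assumes P: "\<And>x. x \<in> set_pmf P \<Longrightarrow> length x = n" and W: "test_channel n W"
  obtains \<Phi> where "finite (set_pmf \<Phi>)"
    and "\<And>x y. x \<in> set_pmf P \<Longrightarrow> y \<in> set_pmf (W x) \<Longrightarrow> pmf (strategy_channel n \<Phi> x) y > 0"
    and "directed_information n (joint_law P W) = measure_pmf.expectation P (\<lambda>x.
      measure_pmf.expectation (W x) (\<lambda>y. log 2 (pmf (W x) y / pmf (strategy_channel n \<Phi> x) y)))"
proof -
  obtain q where q: "\<And>x y. x \<in> set_pmf P \<Longrightarrow> y \<in> set_pmf (W x) \<Longrightarrow>
        (\<Prod>i<n. pmf (q (take i x) (take i y)) (y ! i)) > 0"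
    and I: "directed_information n (joint_law P W) = measure_pmf.expectation (joint_law P W)
        (\<lambda>(x, y). log 2 (pmf (W x) y / (\<Prod>i<n. pmf (q (take i x) (take i y)) (y ! i))))"
    using directed_information_eq_divergence[OF assms] by blast
  obtain \<Phi> where fin: "finite (set_pmf \<Phi>)"
    and \<Phi>: "\<And>x y. length x = n \<Longrightarrow> length y = n \<Longrightarrow>
      pmf (strategy_channel n \<Phi> x) y = (\<Prod>i<n. pmf (q (take i x) (take i y)) (y ! i))"
    using exists_random_strategy[of n q] unfolding strategy_channel_def by blast
  have len: "length x = n" "length y = n" if "x \<in> set_pmf P" "y \<in> set_pmf (W x)" for x y
    using that P W by (auto simp: test_channel_def)
  show ?thesis
  proof (rule that[OF fin])
    show "pmf (strategy_channel n \<Phi> x) y > 0" if "x \<in> set_pmf P" "y \<in> set_pmf (W x)" for x y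
      using q[OF that] \<Phi>[OF len[OF that]] by simp
    have "directed_information n (joint_law P W) = measure_pmf.expectation (joint_law P W)
        (\<lambda>(x, y). log 2 (pmf (W x) y / pmf (strategy_channel n \<Phi> x) y))"
      unfolding I
    proof (rule integral_cong_AE)
      show "AE s in joint_law P W. (case s of (x, y) \<Rightarrow>
          log 2 (pmf (W x) y / (\<Prod>i<n. pmf (q (take i x) (take i y)) (y ! i))))
        = (case s of (x, y) \<Rightarrow> log 2 (pmf (W x) y / pmf (strategy_channel n \<Phi> x) y))"
        unfolding AE_measure_pmf_iff using \<Phi> len by (auto simp: set_pmf_joint_law)
    qed simp_all
    also have "\<dots> = measure_pmf.expectation P (\<lambda>x. measure_pmf.expectation (W x)
        (\<lambda>y. log 2 (pmf (W x) y / pmf (strategy_channel n \<Phi> x) y)))"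
      by (subst expectation_joint_law[OF assms]) simp_all
    finally show "directed_information n (joint_law P W) = measure_pmf.expectation P (\<lambda>x.
      measure_pmf.expectation (W x) (\<lambda>y. log 2 (pmf (W x) y / pmf (strategy_channel n \<Phi> x) y)))" .
  qed
qed

text \<open>The total variation bound for the two joint laws with input law \<open>P\<close>, whose
  common factor \<open>pmf P x\<close> cancels in the logarithm.\<close>

lemma channel_distance_le_divergence:
  fixes P :: "'a::finite list pmf" and V W :: "'a list \<Rightarrow> 'b::finite list pmf"
  assumes P: "\<And>x. x \<in> set_pmf P \<Longrightarrow> length x = n" and W: "test_channel n W"
    and V: "\<And>x y. x \<in> set_pmf P \<Longrightarrow> y \<in> set_pmf (W x) \<Longrightarrow> pmf (V x) y > 0"
  shows "(measure_pmf.expectation P (\<lambda>x. \<Sum>y | length y = n. \<bar>pmf (W x) y - pmf (V x) y\<bar>))\<^sup>2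
    \<le> 4 * measure_pmf.expectation P (\<lambda>x. measure_pmf.expectation (W x)
        (\<lambda>y. log 2 (pmf (W x) y / pmf (V x) y)))"
proof -
  let ?Y = "{y :: 'b list. length y = n}"
  let ?S = "SIGMA x:set_pmf P. ?Y"
  let ?w = "\<lambda>(x, y). pmf P x * pmf (W x) y" and ?v = "\<lambda>(x, y). pmf P x * pmf (V x) y"
  have finP: "finite (set_pmf P)"
    by (rule finite_subset[of _ "{x. length x = n}"]) (use P in \<open>auto intro: finite_lists_length\<close>)
  have sW: "set_pmf (W x) \<subseteq> ?Y" if "x \<in> set_pmf P" for x
    using finite_set_test_channel(2)[OF W P[OF that]] .
  have "(\<Sum>s\<in>?S. \<bar>?w s - ?v s\<bar>)\<^sup>2 \<le> 4 * (\<Sum>s\<in>?S. ?w s * log 2 (?w s / ?v s))"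
  proof (rule total_variation_le_divergence)
    show "finite ?S" using finP by (auto intro: finite_lists_length)
    show "?v s > 0" if "s \<in> ?S" "?w s > 0" for s
      using that V by (auto simp: zero_less_mult_iff set_pmf_iff pmf_positive_iff)
    have "(\<Sum>s\<in>?S. ?w s) = (\<Sum>x\<in>set_pmf P. pmf P x * (\<Sum>y\<in>?Y. pmf (W x) y))"
      by (subst sum.Sigma[symmetric]) (auto simp: finP finite_lists_length sum_distrib_left)
    also have "\<dots> = (\<Sum>x\<in>set_pmf P. pmf P x)"
      using sW by (intro sum.cong refl) (simp add: sum_pmf_eq_1 finite_lists_length)
    also have "\<dots> = 1" by (simp add: sum_pmf_eq_1 finP)
    finally show "(\<Sum>s\<in>?S. ?w s) = 1" .
    have "(\<Sum>s\<in>?S. ?v s) = (\<Sum>x\<in>set_pmf P. pmf P x * (\<Sum>y\<in>?Y. pmf (V x) y))"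
      by (subst sum.Sigma[symmetric]) (auto simp: finP finite_lists_length sum_distrib_left)
    also have "\<dots> \<le> (\<Sum>x\<in>set_pmf P. pmf P x * 1)"
    proof (intro sum_mono mult_left_mono)
      show "(\<Sum>y\<in>?Y. pmf (V x) y) \<le> 1" for x
        using measure_measure_pmf_finite[OF finite_lists_length, of "V x" n]
          measure_pmf.prob_le_1[of "V x" ?Y] by simp
    qed simp
    also have "\<dots> = 1" by (simp add: sum_pmf_eq_1 finP)
    finally show "(\<Sum>s\<in>?S. ?v s) \<le> 1" .
  qed auto
  also have "(\<Sum>s\<in>?S. ?w s * log 2 (?w s / ?v s))
      = (\<Sum>(x, y)\<in>?S. pmf P x * (pmf (W x) y * log 2 (pmf (W x) y / pmf (V x) y)))"
    by (intro sum.cong refl) (auto simp: set_pmf_iff)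
  also have "\<dots> = (\<Sum>x\<in>set_pmf P. \<Sum>y\<in>?Y. pmf P x * (pmf (W x) y * log 2 (pmf (W x) y / pmf (V x) y)))"
    by (rule sum.Sigma[symmetric]) (auto simp: finP finite_lists_length)
  also have "\<dots> = measure_pmf.expectation P (\<lambda>x. measure_pmf.expectation (W x)
        (\<lambda>y. log 2 (pmf (W x) y / pmf (V x) y)))"
    unfolding pmf_expectation_finite[OF finP order.refl]
    by (intro sum.cong refl)
       (simp add: pmf_expectation_finite[OF finite_lists_length sW] sum_distrib_left)
  also have "(\<Sum>s\<in>?S. \<bar>?w s - ?v s\<bar>)
      = (\<Sum>(x, y)\<in>?S. pmf P x * \<bar>pmf (W x) y - pmf (V x) y\<bar>)"
    by (intro sum.cong refl) (auto simp: abs_mult right_diff_distrib[symmetric])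
  also have "\<dots> = (\<Sum>x\<in>set_pmf P. \<Sum>y\<in>?Y. pmf P x * \<bar>pmf (W x) y - pmf (V x) y\<bar>)"
    by (rule sum.Sigma[symmetric]) (auto simp: finP finite_lists_length)
  also have "\<dots> = measure_pmf.expectation P (\<lambda>x. \<Sum>y | length y = n. \<bar>pmf (W x) y - pmf (V x) y\<bar>)"
    unfolding pmf_expectation_finite[OF finP order.refl] by (simp add: sum_distrib_left)
  finally show ?thesis .
qed

section \<open>Distortion in the coding problem\<close>

locale feedforward_setting = ergodic_source M X
  for M :: "'w measure" and X :: "int \<Rightarrow> 'w \<Rightarrow> 'a::finite" +
  fixes \<rho> :: "'a list \<Rightarrow> 'b::finite \<Rightarrow> real" and m n :: nat and c :: real
  assumes rho_nonneg: "\<And>u y. length u = m + 1 \<Longrightarrow> 0 \<le> \<rho> u y"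
    and rho_le: "\<And>u y. length u = m + 1 \<Longrightarrow> \<rho> u y \<le> c"
    and c_pos: "c > 0" and n_pos: "n \<ge> 1"
begin

abbreviation "P\<^sub>n \<equiv> block_law M X n"

lemma abs_rho_le: "length u = m + 1 \<Longrightarrow> \<bar>\<rho> u y\<bar> \<le> c"
  using rho_nonneg[of u y] rho_le[of u y] by simp

lemma block_distortion_nonneg: "0 \<le> block_distortion \<rho> m k x y"
  unfolding block_distortion_def by (intro sum_nonneg rho_nonneg) (simp add: nat_add_distrib)

lemma block_distortion_le: "\<bar>block_distortion \<rho> m k x y\<bar> \<le> real k * c"
  by (rule abs_block_distortion_le[OF abs_rho_le])

lemma finitely_determined_borel:
  fixes F :: "(int \<Rightarrow> 'a) \<Rightarrow> real"
  assumes "finitely_determined F"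
  shows "F \<in> borel_measurable \<mu>"
  using finitely_determined_measurable[OF assms, of borel]
  by (simp add: measurable_cong_sets[OF sets_process_law refl])

lemma finitely_determined_integrable:
  fixes F :: "(int \<Rightarrow> 'a) \<Rightarrow> real"
  assumes "finitely_determined F"
  shows "integrable \<mu> F"
proof -
  obtain B where "\<And>x. \<bar>F x\<bar> \<le> B" using finitely_determined_bounded[OF assms] by blast
  then show ?thesis
    by (intro law.bounded_integrable finitely_determined_borel assms)
qed

text \<open>Unnormalised conditional mean given the whole sequence, including the letters before the
  block; as a function of the source alone it can be fed to the ergodic theorem.\<close>

definition mean_distortion :: "('a list \<Rightarrow> 'b list pmf) \<Rightarrow> (int \<Rightarrow> 'a) \<Rightarrow> real" where
  "mean_distortion W x = measure_pmf.expectation (W (window x 1 (int n))) (block_distortion \<rho> m n x)"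

lemma finitely_determined_mean_distortion: "finitely_determined (mean_distortion W)"
  unfolding mean_distortion_def
  by (rule finitely_determined_comp2[OF finitely_determined_window finitely_determined_block_distortion])

lemma channel_distortion_eq:
  "real n * channel_distortion M X \<rho> m n W = (\<integral>x. mean_distortion W x \<partial>\<mu>)"
proof -
  have "channel_distortion M X \<rho> m n W = (\<integral>\<omega>. mean_distortion W (\<lambda>i. X i \<omega>) / real n \<partial>M)"
    by (simp add: channel_distortion_def mean_distortion_def distortion_eq source_block_def)
  also have "\<dots> = (\<integral>x. mean_distortion W x / real n \<partial>\<mu>)"
    by (rule integral_process)
       (rule finitely_determined_comp[OF finitely_determined_mean_distortion])
  finally show ?thesis using n_pos by simp
qed

lemma code_distortion_eq:
  "real N * code_distortion M X \<rho> m N f g =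
    (\<integral>x. block_distortion \<rho> m N x (reconstruction N f g (window x 1 (int N))) \<partial>\<mu>)"
proof -
  let ?F = "\<lambda>x. block_distortion \<rho> m N x (reconstruction N f g (window x 1 (int N)))"
  have F: "finitely_determined ?F"
    by (rule finitely_determined_comp2[OF finitely_determined_block_distortion
          finitely_determined_window, of "\<lambda>d u. d (reconstruction N f g u)"])
  have "code_distortion M X \<rho> m N f g = (\<integral>\<omega>. ?F (\<lambda>i. X i \<omega>) / real N \<partial>M)"
    by (simp add: code_distortion_def distortion_eq source_block_def)
  also have "\<dots> = (\<integral>x. ?F x / real N \<partial>\<mu>)"
    by (rule integral_process) (rule finitely_determined_comp[OF F])
  finally show ?thesis by (cases "N = 0") (auto simp: block_distortion_def)
qed

lemma finitely_determined_code:
  "finitely_determined (\<lambda>x. block_distortion \<rho> m N x (reconstruction N f g (window x 1 (int N))))"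
  by (rule finitely_determined_comp2[OF finitely_determined_block_distortion
        finitely_determined_window, of "\<lambda>d u. d (reconstruction N f g u)"])

lemma abs_code_distortion_le: "\<bar>code_distortion M X \<rho> m N f g\<bar> \<le> c"
proof (cases "N = 0")
  case True
  then show ?thesis using c_pos by (simp add: code_distortion_def distortion_def)
next
  case False
  let ?F = "\<lambda>x. block_distortion \<rho> m N x (reconstruction N f g (window x 1 (int N)))"
  have "\<bar>\<integral>x. ?F x \<partial>\<mu>\<bar> \<le> (\<integral>x. \<bar>?F x\<bar> \<partial>\<mu>)" by (rule integral_abs_bound)
  also have "\<dots> \<le> real N * c"
    by (rule law.integral_le_const)
       (auto intro: finitely_determined_integrable[OF finitely_determined_code, THEN integrable_abs]
          block_distortion_le)
  finally have "real N * \<bar>code_distortion M X \<rho> m N f g\<bar> \<le> real N * c"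
    by (simp add: code_distortion_eq[symmetric] abs_mult)
  then show ?thesis using False by simp
qed

text \<open>Four times the directed information bounds the square of an L1 distance.\<close>

lemma directed_information_nonneg:
  fixes W :: "'a list \<Rightarrow> 'b list pmf"
  assumes "test_channel n W"
  shows "0 \<le> directed_information n (joint_law P\<^sub>n W)"
proof -
  obtain \<Phi> where V: "\<And>x y. x \<in> set_pmf P\<^sub>n \<Longrightarrow> y \<in> set_pmf (W x) \<Longrightarrow> pmf (strategy_channel n \<Phi> x) y > 0"
    and I: "directed_information n (joint_law P\<^sub>n W) = measure_pmf.expectation P\<^sub>n (\<lambda>x.
      measure_pmf.expectation (W x) (\<lambda>y. log 2 (pmf (W x) y / pmf (strategy_channel n \<Phi> x) y)))"
    using directed_information_strategies[OF length_block_law assms] by blast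
  have "0 \<le> (measure_pmf.expectation P\<^sub>n (\<lambda>x. \<Sum>y | length y = n.
      \<bar>pmf (W x) y - pmf (strategy_channel n \<Phi> x) y\<bar>))\<^sup>2" by simp
  then show ?thesis
    using channel_distance_le_divergence[of P\<^sub>n n W "strategy_channel n \<Phi>",
        OF length_block_law assms V]
    unfolding I by linarith
qed

text \<open>Codes of accuracy \<open>1 / Suc k\<close> have bounded distortions, so a subsequence
  converges, as the definition of achievability demands.\<close>

lemma achievableI:
  assumes "\<And>\<eta> N\<^sub>0. \<eta> > 0 \<Longrightarrow> \<exists>N\<ge>N\<^sub>0. \<exists>f g. code_encoder N R f \<and> code_distortion M X \<rho> m N f g \<le> D + \<eta>"
  shows "achievable M X \<rho> m R D"
proof -
  have "\<exists>N f g. N \<ge> k \<and> code_encoder N R f \<and> code_distortion M X \<rho> m N f g \<le> D + 1 / Suc k" for k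
    using assms[of "1 / Suc k" k] by auto
  then obtain N f g where N: "\<And>k. N k \<ge> k" and f: "\<And>k. code_encoder (N k) R (f k)"
    and d: "\<And>k. code_distortion M X \<rho> m (N k) (f k) (g k) \<le> D + 1 / Suc k"
    by metis
  let ?d = "\<lambda>k. code_distortion M X \<rho> m (N k) (f k) (g k)"
  have "bounded (range ?d)"
    using abs_code_distortion_le by (auto simp: bounded_iff)
  then obtain l r where r: "strict_mono r" and l: "(?d \<circ> r) \<longlonglongrightarrow> l"
    using bounded_imp_convergent_subsequence by blast
  have "l \<le> D"
  proof (rule LIMSEQ_le[OF l])
    have "(\<lambda>k. D + 1 / Suc k) \<longlonglongrightarrow> D + 0"
      by (intro tendsto_intros LIMSEQ_inverse_real_of_nat[unfolded inverse_eq_divide])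
    then have "((\<lambda>k. D + 1 / Suc k) \<circ> r) \<longlonglongrightarrow> D"
      using LIMSEQ_subseq_LIMSEQ[OF _ r] by simp
    then show "(\<lambda>k. D + 1 / Suc (r k)) \<longlonglongrightarrow> D" by (simp add: o_def)
  qed (use d in auto)
  moreover have "filterlim (\<lambda>k. N (r k)) at_top sequentially"
    by (rule filterlim_at_top_mono[OF filterlim_ident])
       (use N seq_suble[OF r] in \<open>auto intro!: always_eventually intro: order_trans\<close>)
  ultimately show ?thesis
    unfolding achievable_def using f l
    by (intro exI[of _ "\<lambda>k. N (r k)"] exI[of _ "\<lambda>k. f (r k)"] exI[of _ "\<lambda>k. g (r k)"] exI[of _ l])
       (simp add: o_def)
qed

end

section \<open>Codes at zero and at positive rate\<close>

text \<open>Rounding the number of messages down to an integer costs at most a factor 2.\<close>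

lemma half_le_nat_floor: "z / 2 \<le> real (nat \<lfloor>z\<rfloor>)" if "1 \<le> z" for z :: real
proof -
  have "1 \<le> \<lfloor>z\<rfloor>" using that by (simp add: le_floor_iff)
  then have "real (nat \<lfloor>z\<rfloor>) = of_int \<lfloor>z\<rfloor>" "1 \<le> (of_int \<lfloor>z\<rfloor> :: real)" by auto
  moreover have "z < of_int \<lfloor>z\<rfloor> + 1" by (rule real_of_int_floor_add_one_gt)
  ultimately show ?thesis by linarith
qed

section \<open>Rate zero, and the covering code\<close>

context feedforward_setting
begin

lemma prob_process_UNIV: "measure \<mu> UNIV = 1"
  using law.prob_space by simp

lemma mean_distortion_strategy_channel:
  assumes "finite (set_pmf \<Phi>)"
  shows "mean_distortion (strategy_channel n \<Phi>) x = (\<Sum>\<phi>\<in>set_pmf \<Phi>.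
    pmf \<Phi> \<phi> * block_distortion \<rho> m n x (strategy_path n \<phi> (window x 1 (int n))))"
  unfolding mean_distortion_def strategy_channel_def
  by (simp add: pmf_expectation_finite[OF assms order.refl])

lemma finitely_determined_strategy:
  "finitely_determined (\<lambda>x. block_distortion \<rho> m n x (strategy_path n \<phi> (window x 1 (int n))))"
  by (rule finitely_determined_comp2[OF finitely_determined_block_distortion
        finitely_determined_window, of "\<lambda>d u. d (strategy_path n \<phi> u)"])

text \<open>The strategy channel is within \<open>2 * sqrt I\<close> of \<open>W\<close> in mean L1
  distance, \<open>I\<close> being the directed information, and a block distortion is at most
  \<open>n c\<close>, which bounds the extra distortion of the mixture. Its distortion is an average
  over strategies, so one of them does no worse.\<close>

lemma exists_good_strategy:
  fixes W :: "'a list \<Rightarrow> 'b list pmf"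
  assumes W: "test_channel n W"
  obtains \<phi> where "(\<integral>x. block_distortion \<rho> m n x (strategy_path n \<phi> (window x 1 (int n))) \<partial>\<mu>)
    \<le> (\<integral>x. mean_distortion W x \<partial>\<mu>)
      + real n * c * (2 * sqrt (directed_information n (joint_law P\<^sub>n W)))"
proof -
  let ?I = "directed_information n (joint_law P\<^sub>n W)"
  let ?A = "\<lambda>\<phi>. \<integral>x. block_distortion \<rho> m n x (strategy_path n \<phi> (window x 1 (int n))) \<partial>\<mu>"
  let ?Y = "{y :: 'b list. length y = n}"
  obtain \<Phi> where fin: "finite (set_pmf \<Phi>)"
    and V: "\<And>x y. x \<in> set_pmf P\<^sub>n \<Longrightarrow> y \<in> set_pmf (W x) \<Longrightarrow> pmf (strategy_channel n \<Phi> x) y > 0"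
    and I: "?I = measure_pmf.expectation P\<^sub>n (\<lambda>x.
      measure_pmf.expectation (W x) (\<lambda>y. log 2 (pmf (W x) y / pmf (strategy_channel n \<Phi> x) y)))"
    using directed_information_strategies[OF length_block_law W] by blast
  let ?V = "strategy_channel n \<Phi>"
  define tv where "tv u = (\<Sum>y\<in>?Y. \<bar>pmf (W u) y - pmf (?V u) y\<bar>)" for u
  have "(measure_pmf.expectation P\<^sub>n tv)\<^sup>2 \<le> 4 * ?I"
    unfolding tv_def I
    by (rule channel_distance_le_divergence[of P\<^sub>n n W ?V, OF length_block_law W V])
  then have "measure_pmf.expectation P\<^sub>n tv \<le> sqrt (4 * ?I)"
    by (rule real_le_rsqrt)
  then have tv: "measure_pmf.expectation P\<^sub>n tv \<le> 2 * sqrt ?I"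
    by (simp add: real_sqrt_mult)
  have le: "mean_distortion ?V x \<le> mean_distortion W x + real n * c * tv (window x 1 (int n))" for x
  proof -
    let ?u = "window x 1 (int n)" and ?d = "block_distortion \<rho> m n x"
    have E: "mean_distortion W' x = (\<Sum>y\<in>?Y. pmf (W' ?u) y * ?d y)"
      if "test_channel n W'" for W'
      unfolding mean_distortion_def
      using finite_set_test_channel(2)[OF that, of ?u]
      by (intro pmf_expectation_finite finite_lists_length) simp
    have "mean_distortion ?V x - mean_distortion W x = (\<Sum>y\<in>?Y. (pmf (?V ?u) y - pmf (W ?u) y) * ?d y)"
      unfolding E[OF W] E[OF test_channel_strategy_channel]
      by (simp add: sum_subtractf left_diff_distrib)
    also have "\<dots> \<le> (\<Sum>y\<in>?Y. \<bar>pmf (W ?u) y - pmf (?V ?u) y\<bar> * (real n * c))"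
    proof (rule sum_mono)
      fix y
      have "(pmf (?V ?u) y - pmf (W ?u) y) * ?d y \<le> \<bar>pmf (?V ?u) y - pmf (W ?u) y\<bar> * \<bar>?d y\<bar>"
        by (metis abs_ge_self abs_mult)
      also have "\<dots> \<le> \<bar>pmf (W ?u) y - pmf (?V ?u) y\<bar> * (real n * c)"
        unfolding abs_minus_commute[of "pmf (?V ?u) y"]
        by (intro mult_left_mono block_distortion_le) simp
      finally show "(pmf (?V ?u) y - pmf (W ?u) y) * ?d y
        \<le> \<bar>pmf (W ?u) y - pmf (?V ?u) y\<bar> * (real n * c)" .
    qed
    also have "\<dots> = tv ?u * (real n * c)" by (simp only: tv_def sum_distrib_right)
    finally show ?thesis by (simp add: algebra_simps)
  qed
  have ftv: "finitely_determined (\<lambda>x. tv (window x 1 (int n)))"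
    by (rule finitely_determined_comp[OF finitely_determined_window])
  note int = finitely_determined_integrable[OF finitely_determined_mean_distortion]
    finitely_determined_integrable[OF ftv]
  have "(\<integral>x. mean_distortion ?V x \<partial>\<mu>)
      \<le> (\<integral>x. mean_distortion W x + real n * c * tv (window x 1 (int n)) \<partial>\<mu>)"
    using int le by (intro integral_mono) auto
  also have "\<dots> = (\<integral>x. mean_distortion W x \<partial>\<mu>) + real n * c * measure_pmf.expectation P\<^sub>n tv"
    using int by (simp add: integral_window)
  also have "\<dots> \<le> (\<integral>x. mean_distortion W x \<partial>\<mu>) + real n * c * (2 * sqrt ?I)"
    using tv c_pos by (intro add_left_mono mult_left_mono) auto
  finally have V_le: "(\<integral>x. mean_distortion ?V x \<partial>\<mu>)
    \<le> (\<integral>x. mean_distortion W x \<partial>\<mu>) + real n * c * (2 * sqrt ?I)" .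
  have "(\<integral>x. mean_distortion ?V x \<partial>\<mu>) = (\<Sum>\<phi>\<in>set_pmf \<Phi>. pmf \<Phi> \<phi> * ?A \<phi>)"
    unfolding mean_distortion_strategy_channel[OF fin]
    using finitely_determined_integrable[OF finitely_determined_strategy]
    by (subst Bochner_Integration.integral_sum) auto
  also have "\<dots> = measure_pmf.expectation \<Phi> ?A"
    by (simp add: pmf_expectation_finite[OF fin order.refl])
  finally have A: "measure_pmf.expectation \<Phi> ?A = (\<integral>x. mean_distortion ?V x \<partial>\<mu>)" by simp
  have "\<exists>\<phi>. ?A \<phi> \<le> (\<integral>x. mean_distortion ?V x \<partial>\<mu>)"
  proof (rule ccontr)
    assume "\<not> ?thesis"
    then have "(\<integral>x. mean_distortion ?V x \<partial>\<mu>) < measure_pmf.expectation \<Phi> ?A"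
      by (intro measure_pmf.expectation_greater integrable_measure_pmf_finite fin) (auto simp: not_le)
    with A show False by simp
  qed
  then obtain \<phi> where "?A \<phi> \<le> (\<integral>x. mean_distortion ?V x \<partial>\<mu>)" by blast
  with V_le have "?A \<phi> \<le> (\<integral>x. mean_distortion W x \<partial>\<mu>) + real n * c * (2 * sqrt ?I)" by linarith
  then show ?thesis by (rule that)
qed

text \<open>By stationarity all blocks have the same mean distortion; they are contiguous and fill
  the whole length, so no uncoded letter remains.\<close>

lemma repeated_strategy_distortion:
  assumes "K \<ge> 1"
  shows "code_distortion M X \<rho> m (n * K) (\<lambda>_. 1) (block_decoder n (\<lambda>p. n * p) (\<lambda>_ _. \<phi>))
    \<le> (\<integral>x. block_distortion \<rho> m n x (strategy_path n \<phi> (window x 1 (int n))) \<partial>\<mu>) / real n"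
proof -
  let ?N = "n * K" and ?g = "block_decoder n (\<lambda>p. n * p) (\<lambda>_ _. \<phi>)"
  let ?d = "\<lambda>x. block_distortion \<rho> m n x (strategy_path n \<phi> (window x 1 (int n)))"
  have le: "block_distortion \<rho> m ?N x (reconstruction ?N (\<lambda>_. 1) ?g (window x 1 (int ?N)))
      \<le> (\<Sum>p<K. ?d ((shift ^^ (n * p)) x))" for x
  proof -
    have end_le: "n * p + n \<le> n * K" if "p < K" for p
      using mult_le_mono2[of "Suc p" K n] that by simp
    show ?thesis
      using block_code_distortion(2)[of "\<lambda>p. n * p" n K ?N m \<rho> c x "\<lambda>_. 1" "\<lambda>_ _. \<phi>",
          OF _ end_le abs_rho_le]
      by simp
  qed
  note fd = finitely_determined_strategy[of \<phi>]
  have "real ?N * code_distortion M X \<rho> m ?N (\<lambda>_. 1) ?g \<le> (\<integral>x. (\<Sum>p<K. ?d ((shift ^^ (n * p)) x)) \<partial>\<mu>)"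
    unfolding code_distortion_eq
    by (intro integral_mono finitely_determined_integrable finitely_determined_code
        finitely_determined_sum finitely_determined_shift[OF fd] le)
  also have "\<dots> = (\<Sum>p<K. \<integral>x. ?d ((shift ^^ (n * p)) x) \<partial>\<mu>)"
    by (intro Bochner_Integration.integral_sum finitely_determined_integrable
        finitely_determined_shift[OF fd])
  also have "\<dots> = real K * (\<integral>x. ?d x \<partial>\<mu>)"
    using law.integral_T_pow[OF finitely_determined_borel[OF fd]] by simp
  finally show ?thesis
    using assms n_pos by (simp add: field_simps)
qed

lemma zero_rate_codes:
  fixes W :: "'a list \<Rightarrow> 'b list pmf"
  assumes W: "test_channel n W" and D: "channel_distortion M X \<rho> m n W \<le> D"
  shows "\<exists>N\<ge>N\<^sub>0. \<exists>f g. code_encoder N 0 f \<and> code_distortion M X \<rho> m N f g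
    \<le> D + c * (2 * sqrt (directed_information n (joint_law P\<^sub>n W)))"
proof -
  let ?s = "2 * sqrt (directed_information n (joint_law P\<^sub>n W))"
  obtain \<phi> where \<phi>: "(\<integral>x. block_distortion \<rho> m n x (strategy_path n \<phi> (window x 1 (int n))) \<partial>\<mu>)
    \<le> (\<integral>x. mean_distortion W x \<partial>\<mu>) + real n * c * ?s"
    using exists_good_strategy[OF W] by blast
  let ?K = "Suc N\<^sub>0"
  have "code_distortion M X \<rho> m (n * ?K) (\<lambda>_. 1) (block_decoder n (\<lambda>p. n * p) (\<lambda>_ _. \<phi>))
      \<le> (\<integral>x. block_distortion \<rho> m n x (strategy_path n \<phi> (window x 1 (int n))) \<partial>\<mu>) / real n"
    by (rule repeated_strategy_distortion) simp
  also have "\<dots> \<le> (real n * channel_distortion M X \<rho> m n W + real n * c * ?s) / real n"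
    using \<phi> by (intro divide_right_mono) (auto simp: channel_distortion_eq)
  also have "\<dots> = channel_distortion M X \<rho> m n W + c * ?s"
    using n_pos by (simp add: field_simps)
  finally have "code_distortion M X \<rho> m (n * ?K) (\<lambda>_. 1) (block_decoder n (\<lambda>p. n * p) (\<lambda>_ _. \<phi>))
      \<le> D + c * ?s" using D by linarith
  moreover have "N\<^sub>0 \<le> n * ?K"
    using mult_le_mono1[OF n_pos, of ?K] by simp
  moreover have "code_encoder (n * ?K) 0 (\<lambda>_. 1)"
    by (simp add: code_encoder_def)
  ultimately show ?thesis by blast
qed

text \<open>
  The encoder covers a source word if some message produces a reconstruction with typical
  log-likelihood ratio and typical distortion; a failure costs at most \<open>n c\<close> per block.
\<close>

lemma covering_code:
  fixes W :: "'a list \<Rightarrow> 'b list pmf" and \<Phi> :: "('a list \<Rightarrow> 'b) pmf" and s :: "nat \<Rightarrow> nat"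
    and P N :: nat and H I \<epsilon> B :: real
  defines "V \<equiv> strategy_channel n \<Phi>"
  defines "l \<equiv> \<lambda>u y. log 2 (pmf (W u) y / pmf (V u) y)"
  defines "T \<equiv> \<lambda>x. (\<Sum>p<P. measure_pmf.expectation (W (window ((shift ^^ s p) x) 1 (int n)))
          (l (window ((shift ^^ s p) x) 1 (int n)))) \<le> real P * (I + \<epsilon> / 2)
      \<and> (\<Sum>p<P. mean_distortion W ((shift ^^ s p) x)) \<le> real P * (H + \<epsilon> / 2)
      \<and> (\<forall>p<P. window ((shift ^^ s p) x) 1 (int n) \<in> set_pmf P\<^sub>n)"
  assumes W: "test_channel n W"
    and V: "\<And>x y. x \<in> set_pmf P\<^sub>n \<Longrightarrow> y \<in> set_pmf (W x) \<Longrightarrow> pmf (V x) y > 0"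
    and s: "\<And>p. s p + n \<le> s (Suc p)" and sN: "\<And>p. p < P \<Longrightarrow> s p + n \<le> N" and sm: "\<And>p. m \<le> s p"
    and "P > 0" "B > 0" "\<epsilon> > 0" "I \<ge> 0" "H \<ge> 0"
    and lB: "\<And>u y. length u = n \<Longrightarrow> \<bar>l u y\<bar> \<le> B" and dB: "real n * c \<le> B"
    and typical: "measure \<mu> {x. \<not> T x} \<le> \<epsilon> / 2"
    and small1: "exp (- (real P * \<epsilon>\<^sup>2 / (8 * B\<^sup>2))) \<le> 1 / 4"
    and small2: "exp (- (2 powr (real P * \<epsilon>) / 4)) \<le> \<epsilon> / 2"
  shows "\<exists>f g. (\<forall>xs. 1 \<le> f xs \<and> real (f xs) \<le> 2 powr (real P * (I + 2 * \<epsilon>))) \<and>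
    real N * code_distortion M X \<rho> m N f g
    \<le> real P * (H + \<epsilon>) + real P * (real n * c) * \<epsilon> + real (N - n * P) * c"
proof -
  \<comment> \<open>Source blocks and their distortions are expressed through the word
    \<open>xs\<close>, which is all that the encoder knows.\<close>
  define b where "b xs p = window ((shift ^^ s p) (seq_of xs)) 1 (int n)" for xs :: "'a list" and p
  define dd where "dd xs p = block_distortion \<rho> m n ((shift ^^ s p) (seq_of xs))"
    for xs :: "'a list" and p
  define G where "G xs = {y. (\<Sum>p<P. l (b xs p) (y p)) \<le> real P * (I + \<epsilon>)
      \<and> (\<Sum>p<P. dd xs p (y p)) \<le> real P * (H + \<epsilon>)}" for xs
  \<comment> \<open>The exponent exceeds the log-likelihood threshold in \<open>G\<close> by another
    \<open>\<epsilon>\<close> per block, so that the expected number of covering messages for a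
    typical word is large.\<close>
  define K where "K = nat \<lfloor>2 powr (real P * (I + 2 * \<epsilon>))\<rfloor>"
  define w where "w xs = pmf (block_law M X N) xs" for xs
  let ?XS = "{xs :: 'a list. length xs = N}"
  let ?pr = "\<lambda>xs. measure_pmf.prob (Pi_pmf {..<P} [] (\<lambda>p. map_pmf (\<lambda>\<phi>. strategy_path n \<phi> (b xs p)) \<Phi>)) (G xs)"
  let ?q = "2 powr (- (real P * (I + \<epsilon>))) / 2"
  obtain C where C: "(\<Sum>xs\<in>?XS. w xs * (if \<exists>k<K. (\<lambda>p. if p < P then strategy_path n (C k p) (b xs p) else []) \<in> G xs then 0 else 1))
      \<le> (\<Sum>xs\<in>?XS. w xs * (1 - ?pr xs) ^ K)"
    using exists_covering_codebook[OF finite_lists_length, of N w K P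
        "\<lambda>xs p \<phi>. strategy_path n \<phi> (b xs p)" "[]" G \<Phi>] by (auto simp: w_def)
  \<comment> \<open>Since \<open>m \<le> s p\<close> and \<open>s p + n \<le> N\<close>, every
    letter that the distortion of block \<open>p\<close> looks at has a time between 1 and
    \<open>N\<close>, where \<open>seq_of\<close> is faithful.\<close>
  have agree: "b (window x 1 (int N)) p = window ((shift ^^ s p) x) 1 (int n)"
    "dd (window x 1 (int N)) p = block_distortion \<rho> m n ((shift ^^ s p) x)"
    if p: "p < P" for x p
  proof -
    have "seq_of (window x 1 (int N)) i = x i" if "1 + int (s p) - int m \<le> i" "i \<le> int n + int (s p)" for i
      using that sN[OF p] sm[of p] by (intro seq_of_window) auto
    then have a: "(shift ^^ s p) (seq_of (window x 1 (int N))) i = (shift ^^ s p) x i"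
      if "1 - int m \<le> i" "i \<le> int n" for i
      using that by (simp add: shift_pow)
    show "b (window x 1 (int N)) p = window ((shift ^^ s p) x) 1 (int n)"
      unfolding b_def window_eq_iff using a by auto
    have "window ((shift ^^ s p) (seq_of (window x 1 (int N)))) (int i + 1 - int m) (int i + 1)
        = window ((shift ^^ s p) x) (int i + 1 - int m) (int i + 1)" if "i < n" for i
      unfolding window_eq_iff using a that by auto
    then show "dd (window x 1 (int N)) p = block_distortion \<rho> m n ((shift ^^ s p) x)"
      unfolding dd_def block_distortion_def by (auto intro!: ext sum.cong)
  qed
  \<comment> \<open>Typicality as a property of the word, because the covering probability is
    estimated word by word.\<close>
  define T' where "T' xs \<longleftrightarrow> (\<Sum>p<P. measure_pmf.expectation (W (b xs p)) (l (b xs p))) \<le> real P * (I + \<epsilon> / 2)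
      \<and> (\<Sum>p<P. measure_pmf.expectation (W (b xs p)) (dd xs p)) \<le> real P * (H + \<epsilon> / 2)
      \<and> (\<forall>p<P. b xs p \<in> set_pmf P\<^sub>n)" for xs
  have T': "T' (window x 1 (int N)) \<longleftrightarrow> T x" for x
    by (simp add: T'_def T_def agree mean_distortion_def)
  have Kge: "2 powr (real P * (I + 2 * \<epsilon>)) / 2 \<le> real K"
  proof -
    have "(1::real) \<le> 2 powr (real P * (I + 2 * \<epsilon>))"
      using \<open>I \<ge> 0\<close> \<open>\<epsilon> > 0\<close> by (intro ge_one_powr_ge_zero) auto
    then show ?thesis unfolding K_def by (rule half_le_nat_floor)
  qed
  have Kpos: "K \<ge> 1"
  proof -
    have "0 < 2 powr (real P * (I + 2 * \<epsilon>)) / 2" by simp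
    with Kge have "0 < real K" by linarith
    then show ?thesis by simp
  qed
  have Kle: "real K \<le> 2 powr (real P * (I + 2 * \<epsilon>))"
    unfolding K_def by (simp add: of_nat_nat)
  have pr: "?q \<le> ?pr xs" if T: "T' xs" for xs
  proof -
    have "?q \<le> measure_pmf.prob (Pi_pmf {..<P} [] (\<lambda>p. V (b xs p)))
      {y. (\<Sum>p<P. l (b xs p) (y p)) \<le> real P * (I + \<epsilon>) \<and> (\<Sum>p<P. dd xs p (y p)) \<le> real P * (H + \<epsilon>)}"
    proof (rule covering_probability[where U = "\<lambda>p. W (b xs p)" and B = B])
      have lb: "length (b xs p) = n" for p by (simp add: b_def)
      show "finite (set_pmf (W (b xs p)))" for p
        by (rule finite_set_test_channel[OF W lb])
      show "pmf (W (b xs p)) y \<le> pmf (V (b xs p)) y * 2 powr l (b xs p) y"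
        if "p < P" "y \<in> set_pmf (W (b xs p))" for p y
      proof -
        have "pmf (W (b xs p)) y > 0" "pmf (V (b xs p)) y > 0"
          using that T V by (auto simp: T'_def pmf_positive)
        then show ?thesis by (simp add: l_def)
      qed
      show "\<bar>l (b xs p) y\<bar> \<le> B" for p y by (rule lB[OF lb])
      show "\<bar>dd xs p y\<bar> \<le> B" for p y
        unfolding dd_def using block_distortion_le dB by (rule order.trans)
    qed (use assms T in \<open>auto simp: T'_def\<close>)
    then show ?thesis by (simp add: G_def V_def strategy_channel_def)
  qed
  have pow: "(1 - ?pr xs) ^ K \<le> (if T' xs then 0 else 1) + \<epsilon> / 2" for xs
  proof (cases "T' xs")
    case True
    have "(1 - ?pr xs) ^ K \<le> exp (- ?q) ^ K"
    proof (rule power_mono)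
      have "1 - ?pr xs \<le> 1 + (- ?q)" using pr[OF True] by simp
      also have "\<dots> \<le> exp (- ?q)" by (rule exp_ge_add_one_self)
      finally show "1 - ?pr xs \<le> exp (- ?q)" .
    qed simp
    also have "\<dots> = exp (- (?q * real K))" by (simp add: exp_of_nat_mult[symmetric])
    also have "\<dots> \<le> exp (- (2 powr (real P * \<epsilon>) / 4))"
    proof -
      \<comment> \<open>One half comes from \<open>?q\<close>, the other from the rounding in
        \<open>K\<close>.\<close>
      have "2 powr (real P * \<epsilon>) / 4 = ?q * (2 powr (real P * (I + 2 * \<epsilon>)) / 2)"
        by (simp add: powr_add[symmetric] algebra_simps)
      also have "\<dots> \<le> ?q * real K" by (intro mult_left_mono Kge) simp
      finally show ?thesis by simp
    qed
    finally show ?thesis using True small2 by simp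
  next
    case False
    have "(1 - ?pr xs) ^ K \<le> 1" by (intro power_le_one) auto
    with False \<open>\<epsilon> > 0\<close> show ?thesis by simp
  qed
  define cov where "cov xs k \<longleftrightarrow> (\<lambda>p. if p < P then strategy_path n (C k p) (b xs p) else []) \<in> G xs" for xs k
  define bad where "bad xs = (if \<exists>k<K. cov xs k then 0 else 1 :: real)" for xs
  have sub: "set_pmf (block_law M X N) \<subseteq> ?XS" using length_block_law by auto
  have w: "(\<Sum>xs\<in>?XS. w xs * h xs) = (\<integral>x. h (window x 1 (int N)) \<partial>\<mu>)" for h :: "'a list \<Rightarrow> real"
    unfolding integral_window w_def by (rule pmf_expectation_finite[OF finite_lists_length sub, symmetric])
  have "(\<integral>x. bad (window x 1 (int N)) \<partial>\<mu>) = (\<Sum>xs\<in>?XS. w xs * bad xs)"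
    by (rule w[symmetric])
  also have "\<dots> \<le> (\<Sum>xs\<in>?XS. w xs * (1 - ?pr xs) ^ K)"
    using C unfolding bad_def cov_def .
  also have "\<dots> \<le> (\<Sum>xs\<in>?XS. w xs * ((if T' xs then 0 else 1) + \<epsilon> / 2))"
    by (intro sum_mono mult_left_mono pow) (simp add: w_def)
  also have "\<dots> = (\<integral>x. indicator {x. \<not> T x} x + \<epsilon> / 2 \<partial>\<mu>)"
    unfolding w T' by (intro Bochner_Integration.integral_cong) (auto simp: indicator_def)
  also have "\<dots> = measure \<mu> {x. \<not> T x} + \<epsilon> / 2"
  proof -
    have "finitely_determined (\<lambda>x. if T' (window x 1 (int N)) then 0 else 1 :: real)"
      by (rule finitely_determined_comp[OF finitely_determined_window])
    then have "integrable \<mu> (\<lambda>x. if T x then 0 else 1 :: real)"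
      unfolding T' by (rule finitely_determined_integrable)
    also have "(\<lambda>x. if T x then 0 else 1 :: real) = indicator {x. \<not> T x}"
      by (auto simp: indicator_def)
    finally show ?thesis by (simp add: prob_process_UNIV)
  qed
  also have "\<dots> \<le> \<epsilon>" using typical by simp
  finally have bad_le: "(\<integral>x. bad (window x 1 (int N)) \<partial>\<mu>) \<le> \<epsilon>" .
  \<comment> \<open>Messages are numbered from 1, hence \<open>Suc\<close> here and
    \<open>w - 1\<close> in the decoder; an uncovered word is sent as message 1.\<close>
  define f where "f xs = (if \<exists>k<K. cov xs k then Suc (SOME k. k < K \<and> cov xs k) else 1)" for xs
  have f_cov: "f xs - 1 < K \<and> cov xs (f xs - 1)" if "\<exists>k<K. cov xs k" for xs
    using that someI_ex[of "\<lambda>k. k < K \<and> cov xs k"] by (simp add: f_def)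
  have f_le: "1 \<le> f xs \<and> f xs \<le> K" for xs
    using f_cov[of xs] Kpos by (cases "\<exists>k<K. cov xs k") (auto simp: f_def)
  let ?C = "\<lambda>w. C (w - 1)"
  let ?g = "block_decoder n s ?C"
  have pt: "block_distortion \<rho> m N x (reconstruction N f ?g (window x 1 (int N)))
      \<le> real P * (H + \<epsilon>) + real P * (real n * c) * bad (window x 1 (int N)) + real (N - n * P) * c" for x
  proof -
    let ?xs = "window x 1 (int N)"
    let ?S = "\<Sum>p<P. block_distortion \<rho> m n ((shift ^^ s p) x)
          (strategy_path n (?C (f ?xs) p) (window ((shift ^^ s p) x) 1 (int n)))"
    have "?S \<le> real P * (H + \<epsilon>) + real P * (real n * c) * bad ?xs"
    proof (cases "\<exists>k<K. cov ?xs k")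
      case True
      then have "(\<Sum>p<P. dd ?xs p (strategy_path n (C (f ?xs - 1) p) (b ?xs p))) \<le> real P * (H + \<epsilon>)"
        using f_cov[OF True] by (auto simp: cov_def G_def)
      then show ?thesis using True by (simp add: agree bad_def)
    next
      case False
      \<comment> \<open>An uncovered word pays the maximum in every block;
        \<open>H + \<epsilon>\<close> is nonnegative, so the bound has the same form in both
        cases.\<close>
      have "?S \<le> (\<Sum>p<P. real n * c)"
        using block_distortion_le by (intro sum_mono) (auto simp: abs_le_iff)
      moreover have "0 \<le> real P * (H + \<epsilon>)" using \<open>H \<ge> 0\<close> \<open>\<epsilon> > 0\<close> by simp
      moreover have "bad ?xs = 1" using False unfolding bad_def by (rule if_not_P)
      ultimately show ?thesis by simp
    qed
    then show ?thesis
      using block_code_distortion(2)[of s n P N m \<rho> c x f ?C, OF s sN abs_rho_le] by linarith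
  qed
  have "real N * code_distortion M X \<rho> m N f ?g \<le> (\<integral>x. real P * (H + \<epsilon>)
      + real P * (real n * c) * bad (window x 1 (int N)) + real (N - n * P) * c \<partial>\<mu>)"
    unfolding code_distortion_eq
    by (intro integral_mono finitely_determined_integrable finitely_determined_code pt
        finitely_determined_comp[OF finitely_determined_window, of "\<lambda>u. real P * (H + \<epsilon>)
      + real P * (real n * c) * bad u + real (N - n * P) * c"])
  also have "\<dots> = real P * (H + \<epsilon>) + real P * (real n * c) * (\<integral>x. bad (window x 1 (int N)) \<partial>\<mu>)
      + real (N - n * P) * c"
    using finitely_determined_integrable[OF finitely_determined_comp[OF finitely_determined_window], of bad 1 "int N"]
    by (simp add: prob_process_UNIV)
  also have "\<dots> \<le> real P * (H + \<epsilon>) + real P * (real n * c) * \<epsilon> + real (N - n * P) * c"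
    using bad_le c_pos by (intro add_mono mult_left_mono) auto
  finally show ?thesis
    using f_le Kle by (intro exI[of _ f] exI[of _ ?g]) (meson le_trans of_nat_mono order_trans)
qed

end

section \<open>Large block numbers and positive rate\<close>

lemma exp_minus_le:
  fixes x \<eta> :: real
  assumes "\<eta> > 0" and "x \<ge> 1 / \<eta>"
  shows "exp (- x) \<le> \<eta>"
proof -
  have "1 / \<eta> \<le> exp x"
    using assms(2) exp_ge_add_one_self[of x] by linarith
  then show ?thesis
    using assms(1) by (simp add: exp_minus field_simps)
qed

text \<open>From \<open>2 powr t \<ge> t * ln 2 \<ge> t / 2\<close> the exponent is at least
  \<open>t / 8\<close>, and 16 makes this at least \<open>2 / \<epsilon>\<close>.\<close>

lemma exp_minus_powr_le:
  fixes t \<epsilon> :: real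
  assumes "\<epsilon> > 0" and "t \<ge> 16 / \<epsilon>"
  shows "exp (- (2 powr t / 4)) \<le> \<epsilon> / 2"
proof (rule exp_minus_le)
  have "t \<ge> 0" using assms by (meson divide_nonneg_pos order_trans zero_le_numeral)
  have "t / 2 \<le> t * ln 2"
    using mult_left_mono[OF ln2_ge_two_thirds \<open>t \<ge> 0\<close>] \<open>t \<ge> 0\<close> by simp
  also have "\<dots> \<le> exp (t * ln 2)"
    using exp_ge_add_one_self[of "t * ln 2"] by linarith
  also have "\<dots> = 2 powr t"
    by (simp add: powr_def)
  finally show "1 / (\<epsilon> / 2) \<le> 2 powr t / 4"
    using assms by simp
qed (use assms in simp)

context feedforward_setting
begin

text \<open>The strategy channel is known to dominate \<open>W\<close> only for words in the support
  of the block law; by stationarity the block at any position almost surely is such a word.\<close>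

lemma AE_window_shift: "AE x in \<mu>. window ((shift ^^ k) x) 1 (int n) \<in> set_pmf P\<^sub>n"
proof -
  have fd: "finitely_determined (\<lambda>x :: int \<Rightarrow> 'a. indicator (- set_pmf P\<^sub>n) (window x 1 (int n)) :: real)"
    by (rule finitely_determined_comp[OF finitely_determined_window])
  have "(\<integral>x. indicator (- set_pmf P\<^sub>n) (window x 1 (int n)) \<partial>\<mu>) = (0 :: real)"
    by (simp add: integral_window measure_pmf_zero_iff)
  then have "AE x in \<mu>. indicator (- set_pmf P\<^sub>n) (window x 1 (int n)) = (0 :: real)"
    by (subst (asm) integral_nonneg_eq_0_iff_AE) (auto intro: finitely_determined_integrable fd)
  then have "AE x in \<mu>. window x 1 (int n) \<in> set_pmf P\<^sub>n"
    by eventually_elim (auto simp: indicator_def split: if_splits)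
  then have "AE x in distr \<mu> \<mu> (shift ^^ k). window x 1 (int n) \<in> set_pmf P\<^sub>n"
    unfolding law.distr_T_pow .
  then show ?thesis by (rule AE_distrD[rotated]) (rule law.measurable_T_pow)
qed

text \<open>Markov's inequality applied to the convergence in mean; the initial offset
  \<open>m\<close> is moved into the function, whose mean it does not change.\<close>

lemma interleaved_deviation:
  fixes h :: "(int \<Rightarrow> 'a) \<Rightarrow> real"
  assumes h: "finitely_determined h" and "\<delta> > 0"
  shows "(\<lambda>k. measure \<mu> {x. \<not> (\<Sum>p<n * 2 ^ k. h ((shift ^^ (m + interleaved_pos n (2 ^ k) p)) x))
    \<le> real (n * 2 ^ k) * ((\<integral>x. h x \<partial>\<mu>) + \<delta>)}) \<longlonglongrightarrow> 0"
proof -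
  let ?h = "\<lambda>x. h ((shift ^^ m) x)"
  let ?S = "\<lambda>k x. \<Sum>p<n * 2 ^ k. ?h ((shift ^^ interleaved_pos n (2 ^ k) p) x)"
  let ?u = "\<lambda>k x. \<bar>?S k x / real (n * 2 ^ k) - (\<integral>x. h x \<partial>\<mu>)\<bar>"
  have fh: "finitely_determined ?h" by (rule finitely_determined_shift[OF h])
  obtain B where "\<And>x. \<bar>?h x\<bar> \<le> B" using finitely_determined_bounded[OF fh] by blast
  then have "(\<lambda>k. \<integral>x. \<bar>?S k x / real (n * 2 ^ k) - (\<integral>x. ?h x \<partial>\<mu>)\<bar> \<partial>\<mu>) \<longlonglongrightarrow> 0"
    using n_pos by (intro law.interleaved_ergodic finitely_determined_borel fh) auto
  also have "(\<integral>x. ?h x \<partial>\<mu>) = (\<integral>x. h x \<partial>\<mu>)"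
    by (rule law.integral_T_pow[OF finitely_determined_borel[OF h]])
  finally have "(\<lambda>k. (\<integral>x. ?u k x \<partial>\<mu>) / \<delta>) \<longlonglongrightarrow> 0 / \<delta>"
    by (rule tendsto_divide) (use \<open>\<delta> > 0\<close> in auto)
  then have lim: "(\<lambda>k. (\<integral>x. ?u k x \<partial>\<mu>) / \<delta>) \<longlonglongrightarrow> 0" by simp
  have le: "measure \<mu> {x. \<not> (\<Sum>p<n * 2 ^ k. h ((shift ^^ (m + interleaved_pos n (2 ^ k) p)) x))
    \<le> real (n * 2 ^ k) * ((\<integral>x. h x \<partial>\<mu>) + \<delta>)} \<le> (\<integral>x. ?u k x \<partial>\<mu>) / \<delta>" for k
  proof -
    have fu: "finitely_determined (?u k)"
      by (rule finitely_determined_comp[of _ "\<lambda>s. \<bar>s / real (n * 2 ^ k) - (\<integral>x. h x \<partial>\<mu>)\<bar>"])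
         (intro finitely_determined_sum finitely_determined_shift[OF fh])
    note [measurable] = finitely_determined_borel[OF fu]
    have "measure \<mu> {x. \<not> (\<Sum>p<n * 2 ^ k. h ((shift ^^ (m + interleaved_pos n (2 ^ k) p)) x))
        \<le> real (n * 2 ^ k) * ((\<integral>x. h x \<partial>\<mu>) + \<delta>)} \<le> measure \<mu> {x \<in> space \<mu>. ?u k x \<ge> \<delta>}"
    proof (rule law.finite_measure_mono)
      have q: "real (n * 2 ^ k) > 0" using n_pos by simp
      show "{x. \<not> (\<Sum>p<n * 2 ^ k. h ((shift ^^ (m + interleaved_pos n (2 ^ k) p)) x))
        \<le> real (n * 2 ^ k) * ((\<integral>x. h x \<partial>\<mu>) + \<delta>)} \<subseteq> {x \<in> space \<mu>. ?u k x \<ge> \<delta>}"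
      proof (intro subsetI)
        fix x assume "x \<in> {x. \<not> (\<Sum>p<n * 2 ^ k. h ((shift ^^ (m + interleaved_pos n (2 ^ k) p)) x))
          \<le> real (n * 2 ^ k) * ((\<integral>x. h x \<partial>\<mu>) + \<delta>)}"
        then have "((\<integral>x. h x \<partial>\<mu>) + \<delta>) * real (n * 2 ^ k) < ?S k x"
          by (simp add: funpow_add not_le mult.commute)
        then have "(\<integral>x. h x \<partial>\<mu>) + \<delta> < ?S k x / real (n * 2 ^ k)"
          by (simp only: pos_less_divide_eq[OF q])
        then have "\<delta> \<le> ?u k x" by (intro order.trans[OF _ abs_ge_self]) (simp only: le_diff_eq add.commute less_imp_le)
        then show "x \<in> {x \<in> space \<mu>. ?u k x \<ge> \<delta>}" by simp
      qed
      show "{x \<in> space \<mu>. ?u k x \<ge> \<delta>} \<in> sets \<mu>" by measurable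
    qed
    also have "\<dots> \<le> (\<integral>x. ?u k x \<partial>\<mu>) / \<delta>"
      by (rule integral_Markov_inequality_measure[where A = "{}"])
         (use \<open>\<delta> > 0\<close> finitely_determined_integrable[OF fu] in auto)
    finally show ?thesis .
  qed
  show ?thesis
    by (rule tendsto_sandwich[OF _ _ tendsto_const lim]) (use le in auto)
qed

text \<open>The \<open>n * 2 ^ k\<close> blocks occupy \<open>n\<close> times as many letters. The
  remaining \<open>m + n\<close> letters leave room for the \<open>m\<close> letters in front and
  for the fewer than \<open>n\<close> skipped ones.\<close>

lemma covering_codes_eventually:
  fixes W :: "'a list \<Rightarrow> 'b list pmf"
  assumes W: "test_channel n W" and "\<epsilon> > 0"
  defines "I \<equiv> directed_information n (joint_law P\<^sub>n W)"
    and "H \<equiv> real n * channel_distortion M X \<rho> m n W"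
  shows "\<forall>\<^sub>F k in sequentially. \<forall>N \<ge> m + n * (n * 2 ^ k) + n. \<exists>f g.
    (\<forall>xs. 1 \<le> f xs \<and> real (f xs) \<le> 2 powr (real (n * 2 ^ k) * (I + 2 * \<epsilon>))) \<and>
    real N * code_distortion M X \<rho> m N f g
    \<le> real (n * 2 ^ k) * (H + \<epsilon>) + real (n * 2 ^ k) * (real n * c) * \<epsilon> + real (N - n * (n * 2 ^ k)) * c"
proof -
  obtain \<Phi> where V: "\<And>x y. x \<in> set_pmf P\<^sub>n \<Longrightarrow> y \<in> set_pmf (W x) \<Longrightarrow> pmf (strategy_channel n \<Phi> x) y > 0"
    and I: "I = measure_pmf.expectation P\<^sub>n (\<lambda>x.
      measure_pmf.expectation (W x) (\<lambda>y. log 2 (pmf (W x) y / pmf (strategy_channel n \<Phi> x) y)))"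
    unfolding I_def using directed_information_strategies[OF length_block_law W] by blast
  define l where "l u y = log 2 (pmf (W u) y / pmf (strategy_channel n \<Phi> u) y)" for u y
  define hl where "hl x = measure_pmf.expectation (W (window x 1 (int n))) (l (window x 1 (int n)))"
    for x
  have fhl: "finitely_determined hl"
    unfolding hl_def by (rule finitely_determined_comp[OF finitely_determined_window])
  have Ehl: "(\<integral>x. hl x \<partial>\<mu>) = I"
    unfolding hl_def I l_def by (rule integral_window)
  have Ehd: "(\<integral>x. mean_distortion W x \<partial>\<mu>) = H"
    unfolding H_def by (rule channel_distortion_eq[symmetric])
  have "I \<ge> 0" unfolding I_def by (rule directed_information_nonneg[OF W])
  have "H \<ge> 0"
    unfolding Ehd[symmetric] mean_distortion_def
    by (intro Bochner_Integration.integral_nonneg block_distortion_nonneg)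
  obtain B\<^sub>0 where B\<^sub>0: "\<And>u y. length u = n \<Longrightarrow> \<bar>l u y\<bar> \<le> B\<^sub>0"
  proof -
    let ?L = "(\<lambda>(u, y). \<bar>l u y\<bar>) ` ({u :: 'a list. length u = n} \<times> {y :: 'b list. length y = n})"
    have "finite ?L" by (intro finite_imageI finite_cartesian_product finite_lists_length)
    then obtain b where b: "\<forall>v\<in>?L. v \<le> b"
      using bdd_above_finite unfolding bdd_above_def by blast
    have "\<bar>l u y\<bar> \<le> max b 0" if u: "length u = n" for u y
    proof (cases "length y = n")
      case True
      then show ?thesis using b u by (auto intro!: max.coboundedI1)
    next
      case False
      \<comment> \<open>For outputs of the wrong length the ratio is 0, and so is its logarithm by
        convention; thus finitely many values determine the bound.\<close>
      then have "pmf (W u) y = 0"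
        using finite_set_test_channel(2)[OF W u] by (auto simp: pmf_eq_0_set_pmf)
      then show ?thesis by (simp add: l_def log_def)
    qed
    then show ?thesis by (rule that)
  qed
  define B where "B = max B\<^sub>0 (real n * c)"
  have B: "B > 0" "real n * c \<le> B" "\<And>u y. length u = n \<Longrightarrow> \<bar>l u y\<bar> \<le> B"
    unfolding B_def using n_pos c_pos B\<^sub>0 by (auto simp: less_max_iff_disj intro!: max.coboundedI1)
  let ?A = "\<lambda>h E k. {x. \<not> (\<Sum>p<n * 2 ^ k. h ((shift ^^ (m + interleaved_pos n (2 ^ k) p)) x))
    \<le> real (n * 2 ^ k) * (E + \<epsilon> / 2)}"
  have P_lim: "filterlim (\<lambda>k. real (n * 2 ^ k)) at_top sequentially"
  proof -
    have "filterlim (\<lambda>k. n * 2 ^ k) at_top sequentially"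
      using n_pos by (intro filterlim_subseq) (auto simp: strict_mono_def)
    then show ?thesis by (rule filterlim_compose[OF filterlim_real_sequentially])
  qed
  \<comment> \<open>Two averages have to be typical, each failing with probability below
    \<open>\<epsilon> / 4\<close>.\<close>
  have "\<forall>\<^sub>F k in sequentially. measure \<mu> (?A hl I k) < \<epsilon> / 4"
    using interleaved_deviation[OF fhl, of "\<epsilon> / 2"] \<open>\<epsilon> > 0\<close> unfolding Ehl
    by (intro order_tendstoD(2)) auto
  moreover have "\<forall>\<^sub>F k in sequentially. measure \<mu> (?A (mean_distortion W) H k) < \<epsilon> / 4"
    using interleaved_deviation[OF finitely_determined_mean_distortion[of W], of "\<epsilon> / 2"] \<open>\<epsilon> > 0\<close> unfolding Ehd
    by (intro order_tendstoD(2)) auto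
  \<comment> \<open>These thresholds are what \<open>exp_minus_le\<close> with
    \<open>\<eta> = 1 / 4\<close> and \<open>exp_minus_powr_le\<close> with
    \<open>t = P * \<epsilon>\<close> ask for.\<close>
  moreover have "\<forall>\<^sub>F k in sequentially. 4 * (8 * B\<^sup>2) / \<epsilon>\<^sup>2 \<le> real (n * 2 ^ k)"
    using P_lim by (simp only: filterlim_at_top)
  moreover have "\<forall>\<^sub>F k in sequentially. 16 / \<epsilon> / \<epsilon> \<le> real (n * 2 ^ k)"
    using P_lim by (simp only: filterlim_at_top)
  ultimately show ?thesis
  proof eventually_elim
    case (elim k)
    let ?P = "n * 2 ^ k"
    define s where "s p = m + interleaved_pos n (2 ^ k) p" for p
    have s: "s p + n \<le> s (Suc p)" for p
      using div_le_mono[of p "Suc p" "2 ^ k"] by (simp add: s_def interleaved_pos_def)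
    have s_end: "s p + n \<le> m + n * ?P + n" if "p < ?P" for p
    proof -
      have "p div 2 ^ k < n" using that by (rule less_mult_imp_div_less)
      moreover have "n * Suc p \<le> n * ?P" using that by (intro mult_le_mono2) simp
      ultimately show ?thesis by (simp add: s_def interleaved_pos_def)
    qed
    let ?T = "\<lambda>x. (\<Sum>p<?P. measure_pmf.expectation (W (window ((shift ^^ s p) x) 1 (int n)))
          (l (window ((shift ^^ s p) x) 1 (int n)))) \<le> real ?P * (I + \<epsilon> / 2)
      \<and> (\<Sum>p<?P. mean_distortion W ((shift ^^ s p) x)) \<le> real ?P * (H + \<epsilon> / 2)
      \<and> (\<forall>p<?P. window ((shift ^^ s p) x) 1 (int n) \<in> set_pmf P\<^sub>n)"
    have sets: "?A h E k \<in> sets \<mu>" if h: "finitely_determined h" for h E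
    proof -
      have "(\<lambda>x. \<Sum>p<?P. h ((shift ^^ (m + interleaved_pos n (2 ^ k) p)) x)) \<in> borel_measurable \<mu>"
        by (intro finitely_determined_borel finitely_determined_sum finitely_determined_shift h)
      then have "{x \<in> space \<mu>. \<not> (\<Sum>p<?P. h ((shift ^^ (m + interleaved_pos n (2 ^ k) p)) x))
          \<le> real ?P * (E + \<epsilon> / 2)} \<in> sets \<mu>"
        by measurable
      then show ?thesis by simp
    qed
    have "measure \<mu> {x. \<not> ?T x} \<le> measure \<mu> (?A hl I k \<union> ?A (mean_distortion W) H k)"
    proof (rule law.finite_measure_mono_AE)
      have "AE x in \<mu>. \<forall>p\<in>{..<?P}. window ((shift ^^ s p) x) 1 (int n) \<in> set_pmf P\<^sub>n"
        by (intro AE_finite_allI AE_window_shift) simp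
      then show "AE x in \<mu>. x \<in> {x. \<not> ?T x} \<longrightarrow> x \<in> ?A hl I k \<union> ?A (mean_distortion W) H k"
        by eventually_elim (auto simp: s_def hl_def)
      show "?A hl I k \<union> ?A (mean_distortion W) H k \<in> sets \<mu>"
        by (intro sets.Un sets fhl finitely_determined_mean_distortion)
    qed
    also have "\<dots> \<le> measure \<mu> (?A hl I k) + measure \<mu> (?A (mean_distortion W) H k)"
      by (intro measure_Un_le sets fhl finitely_determined_mean_distortion)
    also have "\<dots> \<le> \<epsilon> / 2" using elim(1,2) by linarith
    finally have typical: "measure \<mu> {x. \<not> ?T x} \<le> \<epsilon> / 2" .
    have small1: "exp (- (real ?P * \<epsilon>\<^sup>2 / (8 * B\<^sup>2))) \<le> 1 / 4"
      using elim(3) \<open>\<epsilon> > 0\<close> B(1) by (intro exp_minus_le) (auto simp: field_simps)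
    have small2: "exp (- (2 powr (real ?P * \<epsilon>) / 4)) \<le> \<epsilon> / 2"
      using elim(4) \<open>\<epsilon> > 0\<close> by (intro exp_minus_powr_le) (auto simp: field_simps)
    show ?case
    proof (intro allI impI)
      fix N assume N: "m + n * ?P + n \<le> N"
      show "\<exists>f g. (\<forall>xs. 1 \<le> f xs \<and> real (f xs) \<le> 2 powr (real ?P * (I + 2 * \<epsilon>))) \<and>
        real N * code_distortion M X \<rho> m N f g
        \<le> real ?P * (H + \<epsilon>) + real ?P * (real n * c) * \<epsilon> + real (N - n * ?P) * c"
      proof (rule covering_code[where s = s and \<Phi> = \<Phi> and W = W and B = B])
        show "s p + n \<le> N" if "p < ?P" for p using s_end[OF that] N by simp
        show "measure \<mu> {x. \<not> ((\<Sum>p<?P. measure_pmf.expectation (W (window ((shift ^^ s p) x) 1 (int n)))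
            (\<lambda>y. log 2 (pmf (W (window ((shift ^^ s p) x) 1 (int n))) y
              / pmf (strategy_channel n \<Phi> (window ((shift ^^ s p) x) 1 (int n))) y)))
            \<le> real ?P * (I + \<epsilon> / 2)
          \<and> (\<Sum>p<?P. mean_distortion W ((shift ^^ s p) x)) \<le> real ?P * (H + \<epsilon> / 2)
          \<and> (\<forall>p<?P. window ((shift ^^ s p) x) 1 (int n) \<in> set_pmf P\<^sub>n))} \<le> \<epsilon> / 2"
          using typical unfolding l_def .
        show "\<bar>log 2 (pmf (W u) y / pmf (strategy_channel n \<Phi> u) y)\<bar> \<le> B" if "length u = n" for u y
          using B(3)[OF that] unfolding l_def .
        show "0 < ?P" using n_pos by simp
        show "m \<le> s p" for p by (simp add: s_def)
      qed (use W V s B(1,2) \<open>\<epsilon> > 0\<close> \<open>I \<ge> 0\<close> \<open>H \<ge> 0\<close> small1 small2 in blast)+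
    qed
  qed
qed

text \<open>The three terms in the bracket come from the tolerance \<open>\<epsilon>\<close> of the
  covering code, from the boundedly many letters around the blocks, and from the letters added to
  bring the rate down to \<open>R\<close>.\<close>

lemma positive_rate_codes:
  fixes W :: "'a list \<Rightarrow> 'b list pmf"
  assumes W: "test_channel n W" and D: "channel_distortion M X \<rho> m n W \<le> D"
    and R: "R > 0" and "\<delta> > 0"
    and I_le: "directed_information n (joint_law P\<^sub>n W) \<le> real n * (R + \<delta>)"
  shows "\<exists>N\<ge>N\<^sub>0. \<exists>f g. code_encoder N R f \<and> code_distortion M X \<rho> m N f g
    \<le> D + \<delta> * ((1 + real n * c) / 2 + c + 2 * c / R)"
proof -
  define I where "I = directed_information n (joint_law P\<^sub>n W)"
  define H where "H = real n * channel_distortion M X \<rho> m n W"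
  \<comment> \<open>With this choice \<open>I + 2 * \<epsilon> \<le> n * (R + 2 * \<delta>)\<close>,
    and the covering error per letter is \<open>\<delta> * (1 + n * c) / 2\<close>.\<close>
  define \<epsilon> where "\<epsilon> = real n * \<delta> / 2"
  have n: "real n > 0" using n_pos by simp
  have "\<epsilon> > 0" using n \<open>\<delta> > 0\<close> by (simp add: \<epsilon>_def)
  have H: "H \<le> real n * D" unfolding H_def using D n by (intro mult_left_mono) auto
  have "H \<ge> 0"
    unfolding H_def channel_distortion_eq mean_distortion_def
    by (intro Bochner_Integration.integral_nonneg block_distortion_nonneg)
  have "filterlim (\<lambda>k. n * 2 ^ k) at_top sequentially"
    using n_pos by (intro filterlim_subseq) (auto simp: strict_mono_def)
  then have P_lim: "filterlim (\<lambda>k. real (n * 2 ^ k)) at_top sequentially"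
    by (rule filterlim_compose[OF filterlim_real_sequentially])
  have "\<forall>\<^sub>F k in sequentially. (\<forall>N \<ge> m + n * (n * 2 ^ k) + n. \<exists>f g.
    (\<forall>xs. 1 \<le> f xs \<and> real (f xs) \<le> 2 powr (real (n * 2 ^ k) * (I + 2 * \<epsilon>))) \<and>
    real N * code_distortion M X \<rho> m N f g
    \<le> real (n * 2 ^ k) * (H + \<epsilon>) + real (n * 2 ^ k) * (real n * c) * \<epsilon> + real (N - n * (n * 2 ^ k)) * c)
    \<and> real (m + n + 1) / real n / \<delta> \<le> real (n * 2 ^ k) \<and> real N\<^sub>0 \<le> real (n * 2 ^ k)"
    using P_lim unfolding I_def H_def
    by (intro eventually_conj covering_codes_eventually[OF W \<open>\<epsilon> > 0\<close>]) (simp_all only: filterlim_at_top)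
  then obtain k where k: "\<And>N. N \<ge> m + n * (n * 2 ^ k) + n \<Longrightarrow> \<exists>f g.
    (\<forall>xs. 1 \<le> f xs \<and> real (f xs) \<le> 2 powr (real (n * 2 ^ k) * (I + 2 * \<epsilon>))) \<and>
    real N * code_distortion M X \<rho> m N f g
    \<le> real (n * 2 ^ k) * (H + \<epsilon>) + real (n * 2 ^ k) * (real n * c) * \<epsilon> + real (N - n * (n * 2 ^ k)) * c"
    and k1: "real (m + n + 1) / real n / \<delta> \<le> real (n * 2 ^ k)" and k0: "real N\<^sub>0 \<le> real (n * 2 ^ k)"
    unfolding eventually_sequentially by blast
  define P where "P = n * 2 ^ k"
  have P: "real P > 0" using n_pos by (simp add: P_def)
  \<comment> \<open>The least length that holds all the blocks and satisfies
    \<open>P * (I + 2 * \<epsilon>) \<le> N * R\<close>.\<close>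
  define N where "N = max (m + n * P + n) (nat \<lceil>real P * (I + 2 * \<epsilon>) / R\<rceil>)"
  have nP: "n * P \<le> N" by (simp add: N_def)
  obtain f g where f: "\<And>xs. 1 \<le> f xs \<and> real (f xs) \<le> 2 powr (real P * (I + 2 * \<epsilon>))"
    and d: "real N * code_distortion M X \<rho> m N f g
      \<le> real P * (H + \<epsilon>) + real P * (real n * c) * \<epsilon> + real (N - n * P) * c"
    using k[of N] unfolding P_def[symmetric] by (auto simp: N_def)
  have "real P * (I + 2 * \<epsilon>) / R \<le> real N" unfolding N_def by linarith
  then have "real P * (I + 2 * \<epsilon>) \<le> real N * R" using R by (simp add: field_simps)
  then have "code_encoder N R f"
    unfolding code_encoder_def using f by (meson order_trans powr_mono one_le_numeral)
  \<comment> \<open>Uncoded letters: \<open>m\<close> in front, up to \<open>n\<close> skipped, 1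
    for rounding up, and the excess \<open>2 * n * P * \<delta> / R\<close> due to the
    lengthening.\<close>
  define Z where "Z = real (m + n + 1) + 2 * (real n * real P) * \<delta> / R"
  have Z: "real (N - n * P) \<le> Z"
  proof -
    have "real P * (I + 2 * \<epsilon>) / R \<le> real P * (real n * (R + 2 * \<delta>)) / R"
      using I_le R P by (intro divide_right_mono mult_left_mono) (auto simp: I_def \<epsilon>_def algebra_simps)
    also have "\<dots> = real n * real P + 2 * (real n * real P) * \<delta> / R"
      using R by (simp add: field_simps)
    finally have a: "real (nat \<lceil>real P * (I + 2 * \<epsilon>) / R\<rceil>) \<le> real n * real P + 2 * (real n * real P) * \<delta> / R + 1"
    proof -
      assume le: "real P * (I + 2 * \<epsilon>) / R \<le> real n * real P + 2 * (real n * real P) * \<delta> / R"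
      have "0 \<le> real n * real P + 2 * (real n * real P) * \<delta> / R" using R \<open>\<delta> > 0\<close> by simp
      with le show ?thesis by linarith
    qed
    have b: "0 \<le> 2 * (real n * real P) * \<delta> / R" using R \<open>\<delta> > 0\<close> by simp
    have "real N \<le> real n * real P + Z"
    proof (cases "m + n * P + n \<le> nat \<lceil>real P * (I + 2 * \<epsilon>) / R\<rceil>")
      case True
      then have "N = nat \<lceil>real P * (I + 2 * \<epsilon>) / R\<rceil>" by (simp add: N_def)
      then show ?thesis using a by (simp add: Z_def)
    next
      case False
      then have "N = m + n * P + n" by (simp add: N_def)
      then show ?thesis using b by (simp add: Z_def)
    qed
    then show ?thesis using nP by (simp add: of_nat_diff)
  qed
  let ?q = "real n * real P"
  have q: "?q > 0" "?q \<le> real N" using n P nP by (auto simp flip: of_nat_mult)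
  let ?X = "real P * (H + \<epsilon>) + real P * (real n * c) * \<epsilon> + Z * c"
  have "Z \<ge> 0" using R \<open>\<delta> > 0\<close> by (simp add: Z_def)
  then have X: "?X \<ge> 0" using \<open>H \<ge> 0\<close> \<open>\<epsilon> > 0\<close> c_pos by simp
  have "real N * code_distortion M X \<rho> m N f g \<le> ?X"
    using d mult_right_mono[OF Z, of c] c_pos by linarith
  then have "code_distortion M X \<rho> m N f g \<le> ?X / real N"
    using q by (simp add: field_simps)
  also have "\<dots> \<le> ?X / ?q"
    using q X by (intro divide_left_mono) auto
  also have "\<dots> = H / real n + \<epsilon> * (1 + real n * c) / real n + Z / ?q * c"
    using n P by (simp add: field_simps)
  also have "\<dots> \<le> D + \<delta> * ((1 + real n * c) / 2) + (\<delta> + 2 * \<delta> / R) * c"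
  proof (intro add_mono mult_right_mono)
    show "H / real n \<le> D" using H n by (simp add: field_simps)
    show "\<epsilon> * (1 + real n * c) / real n \<le> \<delta> * ((1 + real n * c) / 2)"
      using n by (simp add: \<epsilon>_def)
    have "real (m + n + 1) / ?q \<le> \<delta>"
      using k1 n P \<open>\<delta> > 0\<close> unfolding P_def[symmetric] by (simp add: field_simps)
    moreover have "Z / ?q = real (m + n + 1) / ?q + 2 * \<delta> / R"
      using n P R by (simp add: Z_def add_divide_distrib)
    ultimately show "Z / ?q \<le> \<delta> + 2 * \<delta> / R" by linarith
  qed (use c_pos in simp)
  also have "\<dots> = D + \<delta> * ((1 + real n * c) / 2 + c + 2 * c / R)"
    by (simp add: algebra_simps add_divide_distrib)
  finally have "code_distortion M X \<rho> m N f g \<le> D + \<delta> * ((1 + real n * c) / 2 + c + 2 * c / R)" .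
  moreover have "N\<^sub>0 \<le> N"
  proof -
    have "N\<^sub>0 \<le> P" using k0 unfolding P_def of_nat_le_iff .
    also have "P \<le> n * P" using n_pos by simp
    finally show ?thesis using nP by simp
  qed
  ultimately show ?thesis using \<open>code_encoder N R f\<close> by blast
qed

text \<open>The rate is an infimum that is only approached, so each accuracy \<open>\<eta>\<close>
  uses its own nearly optimal test channel, while the rate of the codes stays
  \<open>R\<close>.\<close>

lemma feedforward_rate_achievable:
  assumes fin: "feedforward_rate M X \<rho> m n D < \<infinity>"
  shows "achievable M X \<rho> m (real_of_ereal (feedforward_rate M X \<rho> m n D)) D"
proof -
  define S where "S = {W :: 'a list \<Rightarrow> 'b list pmf. test_channel n W \<and> channel_distortion M X \<rho> m n W \<le> D}"
  define r where "r W = 1 / real n * directed_information n (joint_law P\<^sub>n W)"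
    for W :: "'a list \<Rightarrow> 'b list pmf"
  have rate: "feedforward_rate M X \<rho> m n D = (INF W\<in>S. ereal (r W))"
    by (simp add: feedforward_rate_def S_def r_def)
  have "0 \<le> feedforward_rate M X \<rho> m n D"
    unfolding rate
    by (intro INF_greatest) (auto simp: S_def r_def intro!: divide_nonneg_nonneg directed_information_nonneg)
  with fin obtain R where R: "feedforward_rate M X \<rho> m n D = ereal R" "R \<ge> 0"
    by (cases "feedforward_rate M X \<rho> m n D") auto
  have n: "real n > 0" using n_pos by simp
  have near: "\<exists>W. test_channel n W \<and> channel_distortion M X \<rho> m n W \<le> D \<and>
      directed_information n (joint_law P\<^sub>n W) \<le> real n * (R + \<delta>)" if "\<delta> > 0" for \<delta>
  proof -
    have "(INF W\<in>S. ereal (r W)) < ereal (R + \<delta>)"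
      using R(1) that unfolding rate by simp
    then obtain W where "W \<in> S" "r W < R + \<delta>"
      by (auto simp: INF_less_iff)
    then show ?thesis
      using n by (intro exI[of _ W]) (auto simp: S_def r_def field_simps)
  qed
  have "achievable M X \<rho> m R D"
  proof (rule achievableI)
    fix \<eta> :: real and N\<^sub>0 assume "\<eta> > 0"
    show "\<exists>N\<ge>N\<^sub>0. \<exists>f g. code_encoder N R f \<and> code_distortion M X \<rho> m N f g \<le> D + \<eta>"
    proof (cases "R = 0")
      case True
      \<comment> \<open>Chosen so that \<open>c * (2 * sqrt (n * \<delta>)) = \<eta>\<close>, the
        excess distortion of a single strategy.\<close>
      let ?\<delta> = "(\<eta> / (2 * c))\<^sup>2 / real n"
      have "?\<delta> > 0" using \<open>\<eta> > 0\<close> c_pos n by simp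
      then obtain W where W: "test_channel n W" "channel_distortion M X \<rho> m n W \<le> D"
        and I: "directed_information n (joint_law P\<^sub>n W) \<le> real n * (R + ?\<delta>)"
        using near by blast
      from I have "directed_information n (joint_law P\<^sub>n W) \<le> (\<eta> / (2 * c))\<^sup>2"
        using n True by simp
      then have "sqrt (directed_information n (joint_law P\<^sub>n W)) \<le> \<eta> / (2 * c)"
        using \<open>\<eta> > 0\<close> c_pos by (intro real_le_lsqrt directed_information_nonneg W) auto
      then have "c * (2 * sqrt (directed_information n (joint_law P\<^sub>n W))) \<le> \<eta>"
        using c_pos by (simp add: field_simps)
      then show ?thesis
        using zero_rate_codes[OF W, of N\<^sub>0] True by (meson add_left_mono order_trans)
    next
      case False
      with R(2) have "R > 0" by simp
      define \<kappa> where "\<kappa> = (1 + real n * c) / 2 + c + 2 * c / R"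
      have "\<kappa> > 0" unfolding \<kappa>_def using c_pos \<open>R > 0\<close> by (intro add_nonneg_pos add_nonneg_nonneg) auto
      let ?\<delta> = "\<eta> / \<kappa>"
      have "?\<delta> > 0" using \<open>\<eta> > 0\<close> \<open>\<kappa> > 0\<close> by (rule divide_pos_pos)
      then obtain W where W: "test_channel n W" "channel_distortion M X \<rho> m n W \<le> D"
        and I: "directed_information n (joint_law P\<^sub>n W) \<le> real n * (R + ?\<delta>)"
        using near by blast
      have "?\<delta> * \<kappa> = \<eta>" using \<open>\<kappa> > 0\<close> by simp
      then show ?thesis
        using positive_rate_codes[OF W \<open>R > 0\<close> \<open>?\<delta> > 0\<close> I, of N\<^sub>0, folded \<kappa>_def] by (simp only:)
    qed
  qed
  then show ?thesis by (simp add: R(1))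
qed

end

theorem theorem1:
  fixes M :: "'w measure"
    and X :: "int \<Rightarrow> 'w \<Rightarrow> 'a::finite"
    and \<rho> :: "'a list \<Rightarrow> 'b::finite \<Rightarrow> real"
    and m n :: nat and D :: real
  assumes "discrete_source M X" and "stationary M X" and "ergodic M X"
    and "\<And>u y. length u = m + 1 \<Longrightarrow> 0 \<le> \<rho> u y"
    and "n \<ge> 1"
    and "feedforward_rate M X \<rho> m n D < \<infinity>"
  shows "achievable M X \<rho> m (real_of_ereal (feedforward_rate M X \<rho> m n D)) D"
proof -
  \<comment> \<open>Boundedness of the distortion comes from the finitely many windows and letters;
    the maximum with 1 makes the bound positive.\<close>
  let ?L = "(\<lambda>(u, y). \<rho> u y) ` ({u :: 'a list. length u = m + 1} \<times> UNIV)"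
  have "finite ?L" by (intro finite_imageI finite_cartesian_product finite_lists_length) simp
  then obtain b where b: "\<forall>v\<in>?L. v \<le> b"
    using bdd_above_finite unfolding bdd_above_def by blast
  interpret feedforward_setting M X \<rho> m n "max b 1"
  proof unfold_locales
    show "\<rho> u y \<le> max b 1" if "length u = m + 1" for u y
      using b that by (auto intro!: max.coboundedI1)
  qed (use assms in auto)
  show ?thesis by (rule feedforward_rate_achievable) fact
qed

end
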